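(* Let $\mathbf{k}=(k_1,\ldots,k_d)\in(\mathbb{Z}_{\ge1})^d$. Write $\mathbf{k}_{i,j}=(k_i,\ldots,k_j)$ and $|(a_1,\ldots,a_s)|=a_1+\cdots+a_s$. Then for odd $r$ the derivation $D_r$ is given by $$\begin{aligned}D_r\,\widetilde{t}^{\,\mathfrak m}(k_1,\ldots,k_d)={}&\sum_{1\le j\le d}\delta_{|\mathbf{k}_{1,j}|=r}\ \widetilde{t}^{\,\mathfrak l}(k_1,\ldots,k_j)\otimes\widetilde{t}^{\,\mathfrak m}(k_{j+1},\ldots,k_d)\\ &+\sum_{1\le i<j\le d}\delta_{|\mathbf{k}_{i+1,j}|\le r<|\mathbf{k}_{i,j}|-1}\Big(\zeta^{\mathfrak l}_{r-|\mathbf{k}_{i+1,j}|}(k_{i+1},\ldots,k_j)-\delta_{r=1}\log^{\mathfrak l}(2)\Big)\otimes\widetilde{t}^{\,\mathfrak m}(k_1,\ldots,k_{i-1},|\mathbf{k}_{i,j}|-r,k_{j+1},\ldots,k_d)\\ &-\sum_{1\le i<j\le d}\delta_{|\mathbf{k}_{i,j-1}|\le r<|\mathbf{k}_{i,j}|-1}\Big(\zeta^{\mathfrak l}_{r-|\mathbf{k}_{i,j-1}|}(k_{j-1},\ldots,k_i)-\delta_{r=1}\log^{\mathfrak l}(2)\Big)\otimes\widetilde{t}^{\,\mathfrak m}(k_1,\ldots,k_{i-1},|\mathbf{k}_{i,j}|-r,k_{j+1},\ldots,k_d).\end{aligned}$$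
   Context: Motivic iterated integrals $I^{\mathfrak m}(x_0;x_1,\ldots,x_N;x_{N+1})$ ($x_i\in\{0,\pm1\}$) are those of Brown (extending Goncharov): weight-$N$ elements of the weight-graded $\mathbb{Q}$-algebra $\mathcal{H}$ of motivic iterated integrals (a comodule over Goncharov's Hopf algebra $\mathcal{A}=\mathcal{H}/\zeta^{\mathfrak m}(2)\mathcal{H}$), with period map sending $I^{\mathfrak m}(x_0;x_1,\ldots,x_N;x_{N+1})$ to $\int_{x_0<s_1<\cdots<s_N<x_{N+1}}\prod_i \frac{\mathrm{d}s_i}{s_i-x_i}$. They multiply by the shuffle product, and divergent ones are shuffle-regularised with $I^{\mathfrak m}(0;0;1)=I^{\mathfrak m}(0;1;1)=0$. For $\ell\ge0$, $k_i\ge1$, $\epsilon_i\in\{\pm1\}$, $$\zeta_\ell^{\mathfrak m}\left(\begin{matrix}\epsilon_1,\ldots,\epsilon_d\\k_1,\ldots,k_d\end{matrix}\right)=(-1)^dI^{\mathfrak m}(0;\{0\}^\ell,\eta_1,\{0\}^{k_1-1},\ldots,\eta_d,\{0\}^{k_d-1};1),\qquad \eta_i=\prod_{j=i}^d\epsilon_j,$$ $\zeta^{\mathfrak m}=\zeta^{\mathfrak m}_0$; signs are omitted when all equal $1$. $\log^{\mathfrak m}(2)=I^{\mathfrak m}(0;-1;1)$. The (rescaled) motivic multiple $t$ value is $$\widetilde{t}^{\,\mathfrak m}(k_1,\ldots,k_d)=2^{k_1+\cdots+k_d-d}\sum_{\epsilon_i\in\{\pm1\}}\epsilon_1\cdots\epsilon_d\,\zeta^{\mathfrak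 m}\left(\begin{matrix}\epsilon_1,\ldots,\epsilon_d\\k_1,\ldots,k_d\end{matrix}\right),\quad \widetilde{t}^{\,\mathfrak m}(\emptyset)=1.$$ Let $\mathcal{L}=\mathcal{A}_{>0}/(\mathcal{A}_{>0}\cdot\mathcal{A}_{>0})$, with weight-$r$ part $\mathcal{L}_r$; a superscript $\mathfrak l$ denotes the image in $\mathcal{L}$ of the corresponding object with superscript $\mathfrak m$. For odd $r\ge1$, $D_r:\mathcal{H}\to\mathcal{L}_r\otimes_{\mathbb{Q}}\mathcal{H}$ is the derivation obtained from the motivic coaction $\Delta:\mathcal{H}\to\mathcal{A}\otimes\mathcal{H}$ by projecting $\Delta-1\otimes\mathrm{id}$ to $\mathcal{L}_r$ in the left factor; explicitly $$D_rI^{\mathfrak m}(x_0;x_1,\ldots,x_N;x_{N+1})=\sum_{p=0}^{N-r}I^{\mathfrak l}(x_p;x_{p+1},\ldots,x_{p+r};x_{p+r+1})\otimes I^{\mathfrak m}(x_0;x_1,\ldots,x_p,x_{p+r+1},\ldots,x_N;x_{N+1}).$$ $\delta_\bullet$ is $1$ if the condition $\bullet$ holds, else $0$; $\{0\}^n$ is $0$ repeated $n$ times. *)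

theory Defs
  imports "HOL-Analysis.Analysis" "HOL-Library.Poly_Mapping"
begin

section \<open>Vector spaces over the rationals and tensor products\<close>

class rat_vector = ab_group_add +
  fixes scaleQ :: "rat \<Rightarrow> 'a \<Rightarrow> 'a"  (infixr "*\<^sub>Q" 75)
  assumes scaleQ_add_right: "c *\<^sub>Q (x + y) = c *\<^sub>Q x + c *\<^sub>Q y"
    and scaleQ_add_left: "(c + d) *\<^sub>Q x = c *\<^sub>Q x + d *\<^sub>Q x"
    and scaleQ_scaleQ: "c *\<^sub>Q (d *\<^sub>Q x) = (c * d) *\<^sub>Q x"
    and scaleQ_one: "1 *\<^sub>Q x = x"

global_interpretation ratvs: vector_space "scaleQ :: rat \<Rightarrow> 'a \<Rightarrow> 'a::rat_vector"
  by unfold_locales (simp_all add: scaleQ_add_right scaleQ_add_left scaleQ_scaleQ scaleQ_one)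

abbreviation rat_linear :: "('a::rat_vector \<Rightarrow> 'b::rat_vector) \<Rightarrow> bool" where
  "rat_linear \<equiv> Vector_Spaces.linear scaleQ scaleQ"

lemma rat_linearI:
  assumes "\<And>x y. f (x + y) = f x + f y" "\<And>c x. f (c *\<^sub>Q x) = c *\<^sub>Q f x"
  shows "rat_linear f"
  using assms by unfold_locales auto

lemma rat_linear_add: "rat_linear f \<Longrightarrow> f (x + y) = f x + f y"
  and rat_linear_scale: "rat_linear f \<Longrightarrow> f (c *\<^sub>Q x) = c *\<^sub>Q f x"
  by (simp_all add: Vector_Spaces.linear_def module_hom_def module_hom_axioms_def)

lemma rat_linear_0: "rat_linear f \<Longrightarrow> f 0 = 0"
  using rat_linear_scale[of f 0 0] by simp

lemma rat_linear_diff: "rat_linear f \<Longrightarrow> f (x - y) = f x - f y"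
  by (metis add_diff_cancel diff_add_cancel rat_linear_add)

lemma rat_linear_sum: "rat_linear f \<Longrightarrow> f (sum g S) = (\<Sum>x\<in>S. f (g x))"
  by (induction S rule: infinite_finite_induct) (simp_all add: rat_linear_0 rat_linear_add)

lemma rat_linear_span:
  assumes f: "rat_linear f" and x: "x \<in> ratvs.span S"
    and S: "\<And>s. s \<in> S \<Longrightarrow> f s \<in> ratvs.span T"
  shows "f x \<in> ratvs.span T"
  using x
proof (induction rule: ratvs.span_induct_alt)
  case base
  then show ?case by (simp add: rat_linear_0[OF f] ratvs.span_zero)
next
  case (step c s y)
  then show ?case
    by (simp add: rat_linear_add[OF f] rat_linear_scale[OF f] S ratvs.span_add ratvs.span_scale)
qed

instantiation rat :: rat_vector
begin
definition scaleQ_rat :: "rat \<Rightarrow> rat \<Rightarrow> rat" where "scaleQ_rat c x = c * x"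
instance by standard (simp_all add: scaleQ_rat_def algebra_simps)
end

instantiation poly_mapping :: (type, rat_vector) rat_vector
begin
lift_definition scaleQ_poly_mapping :: "rat \<Rightarrow> ('a \<Rightarrow>\<^sub>0 'b) \<Rightarrow> ('a \<Rightarrow>\<^sub>0 'b)"
  is "\<lambda>c f k. c *\<^sub>Q f k"
  by (erule finite_subset[rotated]) auto
instance
  by standard
    (transfer; simp add: scaleQ_add_right scaleQ_add_left scaleQ_scaleQ scaleQ_one)+
end

lemma lookup_scaleQ:
  "Poly_Mapping.lookup (c *\<^sub>Q x) k = c *\<^sub>Q Poly_Mapping.lookup x k"
  by transfer simp

abbreviation basis :: "'k \<Rightarrow> ('k \<Rightarrow>\<^sub>0 rat)" where
  "basis k \<equiv> Poly_Mapping.single k 1"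

definition lin_ext :: "('k \<Rightarrow> 'v::rat_vector) \<Rightarrow> ('k \<Rightarrow>\<^sub>0 rat) \<Rightarrow> 'v" where
  "lin_ext f x = (\<Sum>k\<in>Poly_Mapping.keys x. Poly_Mapping.lookup x k *\<^sub>Q f k)"

lemma lin_ext_superset:
  assumes "finite S" "Poly_Mapping.keys x \<subseteq> S"
  shows "lin_ext f x = (\<Sum>k\<in>S. Poly_Mapping.lookup x k *\<^sub>Q f k)"
  unfolding lin_ext_def using assms
  by (intro sum.mono_neutral_left) (auto simp: in_keys_iff)

lemma lin_ext_basis [simp]: "lin_ext f (basis k) = f k"
  by (simp add: lin_ext_def scaleQ_one)

lemma rat_linear_lin_ext: "rat_linear (lin_ext f)"
proof (rule rat_linearI)
  fix x y :: "'a \<Rightarrow>\<^sub>0 rat"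
  let ?S = "Poly_Mapping.keys x \<union> Poly_Mapping.keys y"
  have "lin_ext f (x + y) = (\<Sum>k\<in>?S. Poly_Mapping.lookup (x + y) k *\<^sub>Q f k)"
    by (rule lin_ext_superset) (auto simp: Poly_Mapping.keys_add)
  also have "\<dots> = lin_ext f x + lin_ext f y"
    by (subst (1 2) lin_ext_superset[of ?S])
      (auto simp: Poly_Mapping.lookup_add scaleQ_add_left sum.distrib)
  finally show "lin_ext f (x + y) = lin_ext f x + lin_ext f y" .
next
  fix c and x :: "'a \<Rightarrow>\<^sub>0 rat"
  have "lin_ext f (c *\<^sub>Q x) = (\<Sum>k\<in>Poly_Mapping.keys x. Poly_Mapping.lookup (c *\<^sub>Q x) k *\<^sub>Q f k)"
    by (rule lin_ext_superset) (auto simp: in_keys_iff lookup_scaleQ scaleQ_rat_def)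
  also have "\<dots> = c *\<^sub>Q lin_ext f x"
    by (simp add: lin_ext_def lookup_scaleQ scaleQ_rat_def ratvs.scale_sum_right)
  finally show "lin_ext f (c *\<^sub>Q x) = c *\<^sub>Q lin_ext f x" .
qed

lemma lin_ext_id: "lin_ext basis x = x"
proof (rule poly_mapping_eqI)
  fix k
  have *: "Poly_Mapping.lookup (\<Sum>j\<in>S. g j) k = (\<Sum>j\<in>S. Poly_Mapping.lookup (g j) k)"
    for g :: "'a \<Rightarrow> 'a \<Rightarrow>\<^sub>0 rat" and S
    by (induction S rule: infinite_finite_induct) (simp_all add: Poly_Mapping.lookup_add)
  have "Poly_Mapping.lookup (lin_ext basis x) k
      = (\<Sum>j\<in>Poly_Mapping.keys x. if j = k then Poly_Mapping.lookup x k else 0)"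
    unfolding lin_ext_def *
    by (intro sum.cong) (auto simp: lookup_scaleQ scaleQ_rat_def Poly_Mapping.lookup_single)
  then show "Poly_Mapping.lookup (lin_ext basis x) k = Poly_Mapping.lookup x k"
    by (simp add: in_keys_iff)
qed

lemma rat_linear_lin_ext_swap:
  assumes "rat_linear g"
  shows "g (lin_ext f x) = lin_ext (\<lambda>k. g (f k)) x"
  by (simp add: lin_ext_def rat_linear_sum[OF assms] rat_linear_scale[OF assms])

lemma rat_linear_eq_lin_ext: "rat_linear f \<Longrightarrow> f x = lin_ext (\<lambda>k. f (basis k)) x"
  using rat_linear_lin_ext_swap[of f basis x] by (simp add: lin_ext_id)

definition bilinear_relations ::
  "(('a::rat_vector \<times> 'b::rat_vector) \<Rightarrow>\<^sub>0 rat) set" where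
  "bilinear_relations =
     {basis (a + a', b) - basis (a, b) - basis (a', b) | a a' b. True} \<union>
     {basis (a, b + b') - basis (a, b) - basis (a, b') | a b b'. True} \<union>
     {basis (c *\<^sub>Q a, b) - c *\<^sub>Q basis (a, b) | c a b. True} \<union>
     {basis (a, c *\<^sub>Q b) - c *\<^sub>Q basis (a, b) | c a b. True}"

definition tensor_eq ::
  "(('a::rat_vector \<times> 'b::rat_vector) \<Rightarrow>\<^sub>0 rat) \<Rightarrow> (('a \<times> 'b) \<Rightarrow>\<^sub>0 rat) \<Rightarrow> bool" where
  "tensor_eq x y \<longleftrightarrow> x - y \<in> ratvs.span bilinear_relations"

lemma equivp_span: "equivp (\<lambda>x y. x - y \<in> ratvs.span S)"
proof (rule equivpI)
  show "reflp (\<lambda>x y. x - y \<in> ratvs.span S)" by (simp add: reflp_def ratvs.span_zero)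
  show "symp (\<lambda>x y. x - y \<in> ratvs.span S)"
    by (metis (mono_tags, lifting) minus_diff_eq ratvs.span_neg sympI)
  show "transp (\<lambda>x y. x - y \<in> ratvs.span S)"
    by (rule transpI) (metis diff_add_cancel add_diff_eq ratvs.span_add)
qed

lemma span_diff_cong:
  "x - x' \<in> ratvs.span S \<Longrightarrow> y - y' \<in> ratvs.span S \<Longrightarrow> (x + y) - (x' + y') \<in> ratvs.span S"
  "x - x' \<in> ratvs.span S \<Longrightarrow> y - y' \<in> ratvs.span S \<Longrightarrow> (x - y) - (x' - y') \<in> ratvs.span S"
  "x - x' \<in> ratvs.span S \<Longrightarrow> (- x) - (- x') \<in> ratvs.span S"
  "x - x' \<in> ratvs.span S \<Longrightarrow> (c *\<^sub>Q x) - (c *\<^sub>Q x') \<in> ratvs.span S"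
  subgoal using ratvs.span_add[of "x - x'" S "y - y'"] by (simp add: algebra_simps)
  subgoal using ratvs.span_diff[of "x - x'" S "y - y'"] by (simp add: algebra_simps)
  subgoal using ratvs.span_neg[of "x - x'" S] by simp
  subgoal using ratvs.span_scale[of "x - x'" S c] by (simp add: ratvs.scale_right_diff_distrib)
  done

quotient_type (overloaded) ('a, 'b) tensor =
    "('a::rat_vector \<times> 'b::rat_vector) \<Rightarrow>\<^sub>0 rat" / tensor_eq
  morphisms rep_tensor abs_tensor
  unfolding tensor_eq_def by (rule equivp_span)

instantiation tensor :: (rat_vector, rat_vector) rat_vector
begin
lift_definition zero_tensor :: "('a, 'b) tensor" is 0 .
lift_definition plus_tensor :: "('a, 'b) tensor \<Rightarrow> ('a, 'b) tensor \<Rightarrow> ('a, 'b) tensor" is "(+)"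
  unfolding tensor_eq_def by (rule span_diff_cong)
lift_definition minus_tensor :: "('a, 'b) tensor \<Rightarrow> ('a, 'b) tensor \<Rightarrow> ('a, 'b) tensor" is "(-)"
  unfolding tensor_eq_def by (rule span_diff_cong)
lift_definition uminus_tensor :: "('a, 'b) tensor \<Rightarrow> ('a, 'b) tensor" is uminus
  unfolding tensor_eq_def by (rule span_diff_cong)
lift_definition scaleQ_tensor :: "rat \<Rightarrow> ('a, 'b) tensor \<Rightarrow> ('a, 'b) tensor" is "scaleQ"
  unfolding tensor_eq_def by (rule span_diff_cong)
instance
  by standard
    (transfer; simp add: tensor_eq_def algebra_simps ratvs.span_zero
       scaleQ_add_right scaleQ_add_left scaleQ_scaleQ scaleQ_one)+
end

definition tensor :: "'a::rat_vector \<Rightarrow> 'b::rat_vector \<Rightarrow> ('a, 'b) tensor"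
    (infixr "\<otimes>\<^sub>Q" 72) where
  "a \<otimes>\<^sub>Q b = abs_tensor (basis (a, b))"

text \<open>The following two maps are computed on a representative; this is independent of the choice
  when \<open>f\<close> is bilinear, respectively when \<open>f\<close> and \<open>g\<close> are linear (\<open>tensor_lift_abs\<close>).\<close>

definition tensor_lift ::
  "('a::rat_vector \<Rightarrow> 'b::rat_vector \<Rightarrow> 'c::rat_vector) \<Rightarrow> ('a, 'b) tensor \<Rightarrow> 'c" where
  "tensor_lift f t = lin_ext (\<lambda>(a, b). f a b) (rep_tensor t)"

definition tensor_map ::
  "('a::rat_vector \<Rightarrow> 'c::rat_vector) \<Rightarrow> ('b::rat_vector \<Rightarrow> 'd::rat_vector)
    \<Rightarrow> ('a, 'b) tensor \<Rightarrow> ('c, 'd) tensor" where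
  "tensor_map f g = tensor_lift (\<lambda>a b. f a \<otimes>\<^sub>Q g b)"

definition rat_bilinear :: "('a::rat_vector \<Rightarrow> 'b::rat_vector \<Rightarrow> 'c::rat_vector) \<Rightarrow> bool" where
  "rat_bilinear f \<longleftrightarrow> (\<forall>a. rat_linear (f a)) \<and> (\<forall>b. rat_linear (\<lambda>a. f a b))"

lemma tensor_lift_abs:
  assumes "rat_bilinear f"
  shows "tensor_lift f (abs_tensor x) = lin_ext (\<lambda>(a, b). f a b) x"
proof -
  let ?F = "lin_ext (\<lambda>(a, b). f a b)"
  note F = rat_linear_lin_ext[of "\<lambda>(a, b). f a b"]
  have 1: "rat_linear (f a)" "rat_linear (\<lambda>a. f a b)" for a b
    using assms by (auto simp: rat_bilinear_def)
  have gen: "?F s = 0" if "s \<in> bilinear_relations" for s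
    using that unfolding bilinear_relations_def
    by (auto simp: rat_linear_diff[OF F] rat_linear_scale[OF F]
        rat_linear_add[OF 1(1)] rat_linear_scale[OF 1(1)]
        rat_linear_add[OF 1(2)] rat_linear_scale[OF 1(2)])
  have "tensor_eq (rep_tensor (abs_tensor x)) x"
    using Quotient_rep_abs[OF Quotient_tensor] by (simp add: tensor_eq_def ratvs.span_zero)
  then have "?F (rep_tensor (abs_tensor x) - x) \<in> ratvs.span {}"
    unfolding tensor_eq_def by (rule rat_linear_span[OF F]) (simp add: gen)
  then show ?thesis
    by (simp add: tensor_lift_def rat_linear_diff[OF F])
qed

lemma tensor_lift_tensor: "rat_bilinear f \<Longrightarrow> tensor_lift f (a \<otimes>\<^sub>Q b) = f a b"
  by (simp add: tensor_def tensor_lift_abs)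

lemma rat_linear_tensor_lift:
  assumes "rat_bilinear f"
  shows "rat_linear (tensor_lift f)"
proof (rule rat_linearI)
  fix s t :: "('a, 'b) tensor" and c
  obtain x y where "s = abs_tensor x" "t = abs_tensor y"
    by (metis Quotient_abs_rep Quotient_tensor)
  then show "tensor_lift f (s + t) = tensor_lift f s + tensor_lift f t"
      and "tensor_lift f (c *\<^sub>Q s) = c *\<^sub>Q tensor_lift f s"
    by (simp_all add: plus_tensor.abs_eq scaleQ_tensor.abs_eq tensor_lift_abs[OF assms]
        rat_linear_add[OF rat_linear_lin_ext] rat_linear_scale[OF rat_linear_lin_ext])
qed

lemma rat_bilinear_tensor: "rat_bilinear (\<otimes>\<^sub>Q)"
proof -
  have "abs_tensor (basis (a + a', b)) = abs_tensor (basis (a, b)) + abs_tensor (basis (a', b))"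
    "abs_tensor (basis (a, b + b')) = abs_tensor (basis (a, b)) + abs_tensor (basis (a, b'))"
    "abs_tensor (basis (c *\<^sub>Q a, b)) = c *\<^sub>Q abs_tensor (basis (a, b))"
    "abs_tensor (basis (a, c *\<^sub>Q b)) = c *\<^sub>Q abs_tensor (basis (a, b))"
    for a a' :: 'a and b b' :: 'b and c
    by (simp_all add: plus_tensor.abs_eq scaleQ_tensor.abs_eq tensor.abs_eq_iff tensor_eq_def)
      (rule ratvs.span_base; force simp: bilinear_relations_def algebra_simps)+
  then show ?thesis
    by (auto simp: rat_bilinear_def tensor_def intro!: rat_linearI)
qed

lemmas rat_linear_tensor =
  rat_bilinear_tensor[unfolded rat_bilinear_def, THEN conjunct1, rule_format]
  rat_bilinear_tensor[unfolded rat_bilinear_def, THEN conjunct2, rule_format]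

lemma rat_bilinear_tensor_comp:
  assumes "rat_linear f" "rat_linear g"
  shows "rat_bilinear (\<lambda>a b. f a \<otimes>\<^sub>Q g b)"
  unfolding rat_bilinear_def
  by (auto intro!: rat_linearI simp: rat_linear_add[OF assms(1)] rat_linear_scale[OF assms(1)]
      rat_linear_add[OF assms(2)] rat_linear_scale[OF assms(2)]
      rat_linear_add[OF rat_linear_tensor(1)] rat_linear_scale[OF rat_linear_tensor(1)]
      rat_linear_add[OF rat_linear_tensor(2)] rat_linear_scale[OF rat_linear_tensor(2)])

lemma tensor_zero [simp]: "0 \<otimes>\<^sub>Q b = 0" "a \<otimes>\<^sub>Q 0 = 0"
  by (rule rat_linear_0[OF rat_linear_tensor(2)] rat_linear_0[OF rat_linear_tensor(1)])+


section \<open>The shuffle algebra on the letters 0, 1, -1\<close>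

text \<open>The word \<open>[x\<^sub>1, \<dots>, x\<^sub>N]\<close> stands for the iterated integral
  \<open>I(0; x\<^sub>1, \<dots>, x\<^sub>N; 1)\<close>, i.e. for a coordinate function on the scheme of de Rham paths from
  0 to 1 on the projective line minus \<open>{0, 1, -1, \<infinity>}\<close> (with the unit tangent
  vectors along \<open>[0, 1]\<close> as base points).\<close>

datatype letter = P0 | P1 | Pm1

fun letter_val :: "letter \<Rightarrow> real" where
  "letter_val P0 = 0"
| "letter_val P1 = 1"
| "letter_val Pm1 = - 1"

fun letter_neg :: "letter \<Rightarrow> letter" where
  "letter_neg P0 = P0"
| "letter_neg P1 = Pm1"
| "letter_neg Pm1 = P1"

type_synonym word_alg = "letter list \<Rightarrow>\<^sub>0 rat"

text \<open>Shuffles are counted with multiplicity.\<close>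

fun shuffle_list :: "'a list \<Rightarrow> 'a list \<Rightarrow> 'a list list" where
  "shuffle_list [] v = [v]"
| "shuffle_list u [] = [u]"
| "shuffle_list (a # u) (b # v) =
     map ((#) a) (shuffle_list u (b # v)) @ map ((#) b) (shuffle_list (a # u) v)"

definition shuffle_mult :: "word_alg \<Rightarrow> word_alg \<Rightarrow> word_alg"  (infixl "\<star>" 70) where
  "x \<star> y = lin_ext (\<lambda>u. lin_ext (\<lambda>v. \<Sum>w\<leftarrow>shuffle_list u v. basis w) y) x"

definition word_weight_part :: "nat \<Rightarrow> word_alg \<Rightarrow> word_alg" where
  "word_weight_part n = lin_ext (\<lambda>w. if length w = n then basis w else 0)"

definition word_zeta2 :: word_alg where
  "word_zeta2 = - basis [P1, P0]"

lemma rat_bilinear_shuffle: "rat_bilinear (\<star>)"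
proof -
  have 1: "rat_linear (\<lambda>x. x \<star> y)" for y
    unfolding shuffle_mult_def by (rule rat_linear_lin_ext)
  have 2: "x \<star> (y + z) = x \<star> y + x \<star> z" "x \<star> (c *\<^sub>Q y) = c *\<^sub>Q (x \<star> y)" for x y z c
    by (simp_all add: shuffle_mult_def lin_ext_def[of _ x] rat_linear_add[OF rat_linear_lin_ext]
        rat_linear_scale[OF rat_linear_lin_ext] scaleQ_add_right sum.distrib
        ratvs.scale_sum_right scaleQ_scaleQ mult.commute)
  then show ?thesis
    using 1 by (auto simp: rat_bilinear_def intro!: rat_linearI)
qed

lemmas rat_linear_shuffle =
  rat_bilinear_shuffle[unfolded rat_bilinear_def, THEN conjunct1, rule_format]
  rat_bilinear_shuffle[unfolded rat_bilinear_def, THEN conjunct2, rule_format]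


section \<open>The period map\<close>

text \<open>Iterated integrals along \<open>[0, t]\<close>, integrating the outermost variable last; the head of the
  reversed word belongs to the largest variable. The value is only used for words which do not
  begin with 0 and do not end with 1, for which the integral over \<open>[0, 1]\<close> converges.\<close>

primrec iter_int_rev :: "letter list \<Rightarrow> real \<Rightarrow> real" where
  "iter_int_rev [] t = 1"
| "iter_int_rev (x # w) t = integral {0..t} (\<lambda>s. iter_int_rev w s / (s - letter_val x))"

definition iter_int :: "letter list \<Rightarrow> real" where
  "iter_int w = iter_int_rev (rev w) 1"

definition convergent_word :: "letter list \<Rightarrow> bool" where
  "convergent_word w \<longleftrightarrow> w = [] \<or> (hd w \<noteq> P0 \<and> last w \<noteq> P1)"

definition is_period_map :: "(word_alg \<Rightarrow> real) \<Rightarrow> bool" where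
  "is_period_map \<phi> \<longleftrightarrow>
     (\<forall>x y. \<phi> (x + y) = \<phi> x + \<phi> y) \<and>
     (\<forall>c x. \<phi> (c *\<^sub>Q x) = of_rat c * \<phi> x) \<and>
     (\<forall>x y. \<phi> (x \<star> y) = \<phi> x * \<phi> y) \<and>
     \<phi> (basis [P0]) = 0 \<and> \<phi> (basis [P1]) = 0 \<and>
     (\<forall>w. convergent_word w \<longrightarrow> \<phi> (basis w) = iter_int w)"

text \<open>There is exactly one such map, since the shuffle algebra is a polynomial algebra in the two
  letters 0 and 1 over the subalgebra spanned by the convergent words.\<close>

definition period :: "word_alg \<Rightarrow> real" where
  "period = (THE \<phi>. is_period_map \<phi>)"


section \<open>The coaction on words\<close>

text \<open>Iterated integrals with arbitrary end points in \<open>{0, 1, -1}\<close>, expressed by those from 0 to 1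
  through homothety \<open>I(0; w; -1) = I(0; -w; 1)\<close>, reversal of paths and composition of paths
  at the point 0. In particular \<open>I(a; w; a)\<close> vanishes for nonempty \<open>w\<close>.\<close>

fun int_from0 :: "letter list \<Rightarrow> letter \<Rightarrow> word_alg" where
  "int_from0 w P0 = (if w = [] then basis [] else 0)"
| "int_from0 w P1 = basis w"
| "int_from0 w Pm1 = basis (map letter_neg w)"

definition int_to0 :: "letter \<Rightarrow> letter list \<Rightarrow> word_alg" where
  "int_to0 a w = (- 1) ^ length w *\<^sub>Q int_from0 (rev w) a"

definition word_int :: "letter \<Rightarrow> letter list \<Rightarrow> letter \<Rightarrow> word_alg" where
  "word_int a w b = (\<Sum>n\<le>length w. int_to0 a (take n w) \<star> int_from0 (drop n w) b)"

text \<open>\<open>goncharov_cuts a u w b\<close> lists the terms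
  \<open>\<Prod>\<^sub>p I(y\<^bsub>i\<^sub>p\<^esub>; \<dots>; y\<^bsub>i\<^sub>p\<^sub>+\<^sub>1\<^esub>) \<otimes> I(y\<^sub>0; y\<^bsub>i\<^sub>1\<^esub>, \<dots>, y\<^bsub>i\<^sub>k\<^esub>; y\<^bsub>N+1\<^esub>)\<close> of Goncharov's formula
  for \<open>I(a; u w; b)\<close>, where the marked positions \<open>i\<^sub>1 < \<dots> < i\<^sub>k\<close> range over all subsets of the
  positions in \<open>w\<close>, and \<open>u\<close> collects the unmarked letters since the last marked one.\<close>

fun goncharov_cuts ::
  "letter \<Rightarrow> letter list \<Rightarrow> letter list \<Rightarrow> letter \<Rightarrow> (word_alg \<times> letter list) list" where
  "goncharov_cuts a u [] b = [(word_int a u b, [])]"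
| "goncharov_cuts a u (x # w) b =
     goncharov_cuts a (u @ [x]) w b @
     map (\<lambda>(l, v). (word_int a u x \<star> l, x # v)) (goncharov_cuts x [] w b)"

definition word_coaction :: "word_alg \<Rightarrow> (word_alg, word_alg) tensor" where
  "word_coaction =
     lin_ext (\<lambda>w. \<Sum>(l, v)\<leftarrow>goncharov_cuts P0 [] w P1. l \<otimes>\<^sub>Q basis v)"


section \<open>Motivic iterated integrals\<close>

text \<open>Brown's definition: the ideal of motivic relations is the largest graded ideal which is
  contained in the kernel of the period map and stable under the coaction. The left factor of the
  coaction lives in the quotient by \<open>\<zeta>(2)\<close>, so for an ideal \<open>I\<close> of the algebra \<open>O\<close> of words
  stability means \<open>\<Delta> I \<subseteq> (I + \<zeta>(2) O) \<otimes> O + O \<otimes> I\<close>. The sum of all ideals with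
  these properties has them as well.\<close>

definition graded_ideal :: "word_alg set \<Rightarrow> bool" where
  "graded_ideal I \<longleftrightarrow>
     ratvs.subspace I \<and>
     (\<forall>x\<in>I. \<forall>y. x \<star> y \<in> I \<and> y \<star> x \<in> I) \<and>
     (\<forall>x\<in>I. \<forall>n. word_weight_part n x \<in> I)"

definition coaction_stable :: "word_alg set \<Rightarrow> bool" where
  "coaction_stable I \<longleftrightarrow>
     (\<forall>x\<in>I. word_coaction x \<in> ratvs.span
        ({a \<otimes>\<^sub>Q b | a b. a \<in> I} \<union> {(word_zeta2 \<star> a) \<otimes>\<^sub>Q b | a b. True} \<union>
         {a \<otimes>\<^sub>Q b | a b. b \<in> I}))"

definition motivic_relations :: "word_alg set" where
  "motivic_relations =
     ratvs.span (\<Union>{I. graded_ideal I \<and> coaction_stable I \<and> (\<forall>x\<in>I. period x = 0)})"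

lemma motivic_relations_mult:
  assumes "x \<in> motivic_relations"
  shows "x \<star> y \<in> motivic_relations" "y \<star> x \<in> motivic_relations"
  using assms unfolding motivic_relations_def
  by (rule rat_linear_span[OF rat_linear_shuffle(2)] rat_linear_span[OF rat_linear_shuffle(1)],
      intro ratvs.span_base, auto simp: graded_ideal_def)+

lemma motivic_relations_weight:
  assumes "x \<in> motivic_relations"
  shows "word_weight_part n x \<in> motivic_relations"
  using assms unfolding motivic_relations_def word_weight_part_def
  by (rule rat_linear_span[OF rat_linear_lin_ext], intro ratvs.span_base)
    (auto simp: graded_ideal_def word_weight_part_def)

lemma motivic_relations_coaction:
  assumes "x \<in> motivic_relations"
  shows "word_coaction x \<in> ratvs.span
     ({a \<otimes>\<^sub>Q b | a b. a \<in> motivic_relations} \<union> {(word_zeta2 \<star> a) \<otimes>\<^sub>Q b | a b. True} \<union>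
      {a \<otimes>\<^sub>Q b | a b. b \<in> motivic_relations})"
    (is "_ \<in> ratvs.span ?S")
  using assms unfolding motivic_relations_def word_coaction_def
proof (rule rat_linear_span[OF rat_linear_lin_ext], fold motivic_relations_def word_coaction_def)
  fix s assume "s \<in> \<Union>{I. graded_ideal I \<and> coaction_stable I \<and> (\<forall>x\<in>I. period x = 0)}"
  then obtain I where I: "s \<in> I" "graded_ideal I" "coaction_stable I" "\<forall>x\<in>I. period x = 0"
    by auto
  then have sub: "I \<subseteq> motivic_relations"
    unfolding motivic_relations_def by (auto intro: ratvs.span_base)
  have "word_coaction s \<in> ratvs.span
      ({a \<otimes>\<^sub>Q b | a b. a \<in> I} \<union> {(word_zeta2 \<star> a) \<otimes>\<^sub>Q b | a b. True} \<union> {a \<otimes>\<^sub>Q b | a b. b \<in> I})"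
    using I by (auto simp: coaction_stable_def)
  moreover have "\<dots> \<subseteq> ratvs.span ?S"
    by (rule ratvs.span_mono) (use sub in blast)
  ultimately show "word_coaction s \<in> ratvs.span ?S" by blast
qed

definition motivic_eq :: "word_alg \<Rightarrow> word_alg \<Rightarrow> bool" where
  "motivic_eq x y \<longleftrightarrow> x - y \<in> motivic_relations"

quotient_type motH = word_alg / motivic_eq
  morphisms rep_motH motH_of_words
  unfolding motivic_eq_def motivic_relations_def by (rule equivp_span)

instantiation motH :: "{rat_vector, one, times}"
begin
lift_definition zero_motH :: motH is 0 .
lift_definition one_motH :: motH is "basis []" .
lift_definition plus_motH :: "motH \<Rightarrow> motH \<Rightarrow> motH" is "(+)"
  unfolding motivic_eq_def motivic_relations_def by (rule span_diff_cong)
lift_definition minus_motH :: "motH \<Rightarrow> motH \<Rightarrow> motH" is "(-)"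
  unfolding motivic_eq_def motivic_relations_def by (rule span_diff_cong)
lift_definition uminus_motH :: "motH \<Rightarrow> motH" is uminus
  unfolding motivic_eq_def motivic_relations_def by (rule span_diff_cong)
lift_definition scaleQ_motH :: "rat \<Rightarrow> motH \<Rightarrow> motH" is scaleQ
  unfolding motivic_eq_def motivic_relations_def by (rule span_diff_cong)
lift_definition times_motH :: "motH \<Rightarrow> motH \<Rightarrow> motH" is "(\<star>)"
proof -
  fix x x' y y' assume "motivic_eq x x'" "motivic_eq y y'"
  then have "(x - x') \<star> y \<in> motivic_relations" "x' \<star> (y - y') \<in> motivic_relations"
    by (auto simp: motivic_eq_def intro: motivic_relations_mult)
  then have "(x - x') \<star> y + x' \<star> (y - y') \<in> motivic_relations"
    unfolding motivic_relations_def by (rule ratvs.span_add)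
  then show "motivic_eq (x \<star> y) (x' \<star> y')"
    by (simp add: motivic_eq_def rat_linear_diff[OF rat_linear_shuffle(1)]
        rat_linear_diff[OF rat_linear_shuffle(2)])
qed
instance
  by standard
    (transfer; simp add: motivic_eq_def motivic_relations_def algebra_simps ratvs.span_zero
       scaleQ_add_right scaleQ_add_left scaleQ_scaleQ scaleQ_one)+
end

lift_definition weight_part :: "nat \<Rightarrow> motH \<Rightarrow> motH" is word_weight_part
proof -
  fix n x y assume "motivic_eq x y"
  then show "motivic_eq (word_weight_part n x) (word_weight_part n y)"
    using motivic_relations_weight[of "x - y" n]
    by (simp add: motivic_eq_def word_weight_part_def rat_linear_diff[OF rat_linear_lin_ext])
qed

definition I_mot :: "letter \<Rightarrow> letter list \<Rightarrow> letter \<Rightarrow> motH" where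
  "I_mot a w b = motH_of_words (word_int a w b)"

text \<open>For signs \<open>e = \<plusminus> 1\<close>.\<close>

definition sign_letter :: "int \<Rightarrow> letter" where
  "sign_letter e = (if e = 1 then P1 else Pm1)"

definition zeta_word :: "nat \<Rightarrow> int list \<Rightarrow> nat list \<Rightarrow> letter list" where
  "zeta_word l es ks =
     replicate l P0 @
     concat (map (\<lambda>i. sign_letter (prod_list (drop i es)) # replicate (ks ! i - 1) P0)
       [0..<length ks])"

text \<open>\<open>zeta_mot l [\<epsilon>\<^sub>1, \<dots>, \<epsilon>\<^sub>d] [k\<^sub>1, \<dots>, k\<^sub>d]\<close>, for signs \<open>\<epsilon>\<^sub>i = \<plusminus> 1\<close> and \<open>k\<^sub>i \<ge> 1\<close>; the
  summation convention is that \<open>k\<^sub>d\<close> belongs to the largest summation index.\<close>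

definition zeta_mot :: "nat \<Rightarrow> int list \<Rightarrow> nat list \<Rightarrow> motH" where
  "zeta_mot l es ks = (- 1) ^ length ks *\<^sub>Q I_mot P0 (zeta_word l es ks) P1"

definition log2_mot :: motH where
  "log2_mot = I_mot P0 [Pm1] P1"

definition t_mot :: "nat list \<Rightarrow> motH" where
  "t_mot ks = 2 ^ (sum_list ks - length ks) *\<^sub>Q
     (\<Sum>es | length es = length ks \<and> set es \<subseteq> {1, - 1}.
        of_int (prod_list es) *\<^sub>Q zeta_mot 0 es ks)"


section \<open>The Hopf algebra \<open>A\<close>, the Lie coalgebra \<open>L\<close> and the derivations \<open>D\<^sub>r\<close>\<close>

definition zeta2_mot :: motH where
  "zeta2_mot = zeta_mot 0 [1] [2]"

definition A_eq :: "motH \<Rightarrow> motH \<Rightarrow> bool" where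
  "A_eq x y \<longleftrightarrow> x - y \<in> ratvs.span (range (\<lambda>h. zeta2_mot * h))"

quotient_type motA = motH / A_eq
  morphisms rep_motA motA_of
  unfolding A_eq_def by (rule equivp_span)

instantiation motA :: rat_vector
begin
lift_definition zero_motA :: motA is 0 .
lift_definition plus_motA :: "motA \<Rightarrow> motA \<Rightarrow> motA" is "(+)"
  unfolding A_eq_def by (rule span_diff_cong)
lift_definition minus_motA :: "motA \<Rightarrow> motA \<Rightarrow> motA" is "(-)"
  unfolding A_eq_def by (rule span_diff_cong)
lift_definition uminus_motA :: "motA \<Rightarrow> motA" is uminus
  unfolding A_eq_def by (rule span_diff_cong)
lift_definition scaleQ_motA :: "rat \<Rightarrow> motA \<Rightarrow> motA" is scaleQ
  unfolding A_eq_def by (rule span_diff_cong)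
instance
  by standard
    (transfer; simp add: A_eq_def algebra_simps ratvs.span_zero
       scaleQ_add_right scaleQ_add_left scaleQ_scaleQ scaleQ_one)+
end

text \<open>\<open>A\<^sub>>\<^sub>0 / (A\<^sub>>\<^sub>0 \<cdot> A\<^sub>>\<^sub>0)\<close> as a quotient of the whole of \<open>H\<close>: in addition to \<open>\<zeta>(2) H\<close> and to
  the products of two elements without component of weight 0, the weight 0 part \<open>\<rat> \<cdot> 1\<close> of \<open>H\<close> is
  killed.\<close>

definition L_eq :: "motH \<Rightarrow> motH \<Rightarrow> bool" where
  "L_eq x y \<longleftrightarrow> x - y \<in> ratvs.span
     ({1} \<union> range (\<lambda>h. zeta2_mot * h) \<union>
      {g * h | g h. weight_part 0 g = 0 \<and> weight_part 0 h = 0})"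

quotient_type motL = motH / L_eq
  morphisms rep_motL motL_of
  unfolding L_eq_def by (rule equivp_span)

instantiation motL :: rat_vector
begin
lift_definition zero_motL :: motL is 0 .
lift_definition plus_motL :: "motL \<Rightarrow> motL \<Rightarrow> motL" is "(+)"
  unfolding L_eq_def by (rule span_diff_cong)
lift_definition minus_motL :: "motL \<Rightarrow> motL \<Rightarrow> motL" is "(-)"
  unfolding L_eq_def by (rule span_diff_cong)
lift_definition uminus_motL :: "motL \<Rightarrow> motL" is uminus
  unfolding L_eq_def by (rule span_diff_cong)
lift_definition scaleQ_motL :: "rat \<Rightarrow> motL \<Rightarrow> motL" is scaleQ
  unfolding L_eq_def by (rule span_diff_cong)
instance
  by standard
    (transfer; simp add: L_eq_def algebra_simps ratvs.span_zero
       scaleQ_add_right scaleQ_add_left scaleQ_scaleQ scaleQ_one)+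
end

text \<open>The coaction \<open>\<Delta> : H \<rightarrow> A \<otimes> H\<close>, the projection \<open>A \<rightarrow> L\<^sub>r\<close>, and \<open>D\<^sub>r\<close>. The first two are
  computed on a representative; \<open>coaction_of_words\<close> and \<open>proj_L_of\<close> show that the choice does not
  matter.\<close>

definition coaction :: "motH \<Rightarrow> (motA, motH) tensor" where
  "coaction h =
     tensor_map (\<lambda>x. motA_of (motH_of_words x)) motH_of_words (word_coaction (rep_motH h))"

definition proj_L :: "nat \<Rightarrow> motA \<Rightarrow> motL" where
  "proj_L r a = motL_of (weight_part r (rep_motA a))"

definition D :: "nat \<Rightarrow> motH \<Rightarrow> (motL, motH) tensor" where
  "D r h = tensor_map (proj_L r) (\<lambda>x. x) (coaction h - motA_of 1 \<otimes>\<^sub>Q h)"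

lemma rat_linear_motH_of_words: "rat_linear motH_of_words"
  by (rule rat_linearI) (simp_all add: plus_motH.abs_eq scaleQ_motH.abs_eq)

lemma rat_linear_motA_of: "rat_linear motA_of"
  by (rule rat_linearI) (simp_all add: plus_motA.abs_eq scaleQ_motA.abs_eq)

lemma rat_linear_motL_of: "rat_linear motL_of"
  by (rule rat_linearI) (simp_all add: plus_motL.abs_eq scaleQ_motL.abs_eq)

lemma zeta2_mot_eq: "zeta2_mot = motH_of_words word_zeta2"
proof -
  have "word_int P0 [P1, P0] P1 = basis [P1, P0]"
    by (simp add: word_int_def int_to0_def shuffle_mult_def numeral_2_eq_2 scaleQ_one
        lin_ext_def[of _ 0])
  then show ?thesis
    by (simp add: zeta2_mot_def zeta_mot_def zeta_word_def sign_letter_def I_mot_def word_zeta2_def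
        scaleQ_motH.abs_eq[symmetric] uminus_motH.abs_eq)
qed

lemma coaction_of_words:
  "coaction (motH_of_words x) =
     tensor_map (\<lambda>x. motA_of (motH_of_words x)) motH_of_words (word_coaction x)"
proof -
  let ?F = "tensor_map (\<lambda>x. motA_of (motH_of_words x)) motH_of_words"
  let ?y = "rep_motH (motH_of_words x)"
  have lin: "rat_linear (\<lambda>x. motA_of (motH_of_words x))"
    by (rule rat_linearI)
      (simp_all add: rat_linear_add[OF rat_linear_motA_of] rat_linear_scale[OF rat_linear_motA_of]
        rat_linear_add[OF rat_linear_motH_of_words] rat_linear_scale[OF rat_linear_motH_of_words])
  note bil = rat_bilinear_tensor_comp[OF lin rat_linear_motH_of_words]
  have F: "?F (a \<otimes>\<^sub>Q b) = motA_of (motH_of_words a) \<otimes>\<^sub>Q motH_of_words b" for a b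
    unfolding tensor_map_def by (rule tensor_lift_tensor[OF bil])
  have linF: "rat_linear ?F"
    unfolding tensor_map_def by (rule rat_linear_tensor_lift[OF bil])
  have H0: "motH_of_words a = 0" if "a \<in> motivic_relations" for a
    using that by (simp add: zero_motH_def motH.abs_eq_iff motivic_eq_def)
  have A0: "motA_of (motH_of_words (word_zeta2 \<star> a)) = 0" for a
    by (auto simp: zero_motA_def motA.abs_eq_iff A_eq_def zeta2_mot_eq times_motH.abs_eq[symmetric]
        intro!: ratvs.span_base)
  have "motivic_eq ?y x"
    by (metis Quotient_abs_rep Quotient_motH motH.abs_eq_iff)
  then have "?y - x \<in> motivic_relations" by (simp add: motivic_eq_def)
  from motivic_relations_coaction[OF this] have "?F (word_coaction (?y - x)) \<in> ratvs.span {}"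
    by (rule rat_linear_span[OF linF])
      (auto simp: F H0 A0 rat_linear_0[OF rat_linear_motA_of])
  then show ?thesis
    by (simp add: coaction_def word_coaction_def rat_linear_diff[OF rat_linear_lin_ext]
        rat_linear_diff[OF linF])
qed

lemma length_shuffle_list: "w \<in> set (shuffle_list u v) \<Longrightarrow> length w = length u + length v"
  by (induction u v arbitrary: w rule: shuffle_list.induct) auto

lemma rat_linear_word_weight_part: "rat_linear (word_weight_part n)"
  unfolding word_weight_part_def by (rule rat_linear_lin_ext)

lemma word_weight_part_zeta2:
  "word_weight_part n (word_zeta2 \<star> x) =
     (if 2 \<le> n then word_zeta2 \<star> word_weight_part (n - 2) x else 0)"
proof -
  note W = rat_linear_word_weight_part
  let ?f = "\<lambda>x. word_weight_part n (word_zeta2 \<star> x)"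
  let ?g = "\<lambda>x. if 2 \<le> n then word_zeta2 \<star> word_weight_part (n - 2) x else 0"
  note simps = rat_linear_add[OF W] rat_linear_scale[OF W]
    rat_linear_add[OF rat_linear_shuffle(1)] rat_linear_scale[OF rat_linear_shuffle(1)]
  have f: "rat_linear ?f" and g: "rat_linear ?g"
    by (rule rat_linearI; simp add: simps)+
  have neg: "(- a) \<star> b = - (a \<star> b)" for a b
    using rat_linear_diff[OF rat_linear_shuffle(2), of 0 a b]
    by (simp add: rat_linear_0[OF rat_linear_shuffle(2)])
  have sum: "word_weight_part n (\<Sum>w\<leftarrow>ws. basis w) = (if m = n then (\<Sum>w\<leftarrow>ws. basis w) else 0)"
    if "\<forall>w\<in>set ws. length w = m" for ws m
    using that
    by (induction ws) (auto simp: rat_linear_0[OF W] rat_linear_add[OF W] word_weight_part_def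
        rat_linear_0[OF rat_linear_lin_ext] rat_linear_add[OF rat_linear_lin_ext])
  have "?f (basis w) = ?g (basis w)" for w
  proof -
    have "word_weight_part n (basis [P1, P0] \<star> basis w)
        = (if length w + 2 = n then basis [P1, P0] \<star> basis w else 0)"
      unfolding shuffle_mult_def lin_ext_basis
      by (rule sum) (auto dest: length_shuffle_list)
    moreover have "word_weight_part (n - 2) (basis w) = (if length w = n - 2 then basis w else 0)"
      by (simp add: word_weight_part_def)
    moreover have "word_weight_part n (- a) = - word_weight_part n a" for a
      using rat_linear_diff[OF W, of n 0 a] by (simp add: rat_linear_0[OF W])
    ultimately show ?thesis
      by (auto simp: word_zeta2_def neg rat_linear_0[OF rat_linear_shuffle(1)])
  qed
  then show ?thesis
    using rat_linear_eq_lin_ext[OF f, of x] rat_linear_eq_lin_ext[OF g, of x] by simp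
qed

lemma proj_L_of: "proj_L r (motA_of h) = motL_of (weight_part r h)"
proof -
  let ?Z = "ratvs.span (range (\<lambda>h. zeta2_mot * h))"
  have wp: "weight_part r (motH_of_words x) = motH_of_words (word_weight_part r x)" for x
    by (rule weight_part.abs_eq)
  have repr: "\<exists>x. g = motH_of_words x" for g
    by (metis Quotient_abs_rep Quotient_motH)
  have lin: "rat_linear (weight_part r)"
  proof (rule rat_linearI)
    fix g g' c
    obtain x x' where "g = motH_of_words x" "g' = motH_of_words x'" using repr by metis
    then show "weight_part r (g + g') = weight_part r g + weight_part r g'"
      and "weight_part r (c *\<^sub>Q g) = c *\<^sub>Q weight_part r g"
      by (simp_all add: plus_motH.abs_eq scaleQ_motH.abs_eq wp
          rat_linear_add[OF rat_linear_word_weight_part]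
          rat_linear_scale[OF rat_linear_word_weight_part])
  qed
  have gen: "weight_part r (zeta2_mot * g) \<in> ?Z" for g
  proof -
    obtain x where "g = motH_of_words x" using repr by metis
    then have "weight_part r (zeta2_mot * g) =
        (if 2 \<le> r then zeta2_mot * motH_of_words (word_weight_part (r - 2) x) else 0)"
      by (simp add: zeta2_mot_eq times_motH.abs_eq wp word_weight_part_zeta2 zero_motH_def)
    then show ?thesis
      by (auto intro: ratvs.span_base ratvs.span_zero)
  qed
  have "A_eq (rep_motA (motA_of h)) h"
    by (metis Quotient_abs_rep Quotient_motA motA.abs_eq_iff)
  then have "weight_part r (rep_motA (motA_of h) - h) \<in> ?Z"
    unfolding A_eq_def by (rule rat_linear_span[OF lin]) (auto intro: gen)
  then have "weight_part r (rep_motA (motA_of h)) - weight_part r h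
      \<in> ratvs.span ({1} \<union> range (\<lambda>h. zeta2_mot * h) \<union>
        {g * h | g h. weight_part 0 g = 0 \<and> weight_part 0 h = 0})"
    unfolding rat_linear_diff[OF lin] by (rule subsetD[OF ratvs.span_mono, rotated]) auto
  then show ?thesis
    by (simp add: proj_L_def motL.abs_eq_iff L_eq_def)
qed

lemma rat_linear_proj_L: "rat_linear (proj_L r)"
proof (rule rat_linearI)
  fix a b :: motA and c
  obtain x y where xy: "a = motA_of (motH_of_words x)" "b = motA_of (motH_of_words y)"
    by (metis Quotient_abs_rep Quotient_motA Quotient_motH)
  note simps = rat_linear_add[OF rat_linear_motA_of] rat_linear_scale[OF rat_linear_motA_of]
    rat_linear_add[OF rat_linear_motL_of] rat_linear_scale[OF rat_linear_motL_of]
    rat_linear_add[OF rat_linear_motH_of_words] rat_linear_scale[OF rat_linear_motH_of_words]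
    rat_linear_add[OF rat_linear_word_weight_part] rat_linear_scale[OF rat_linear_word_weight_part]
  show "proj_L r (a + b) = proj_L r a + proj_L r b"
    unfolding xy by (simp only: simps[symmetric] proj_L_of weight_part.abs_eq)
  show "proj_L r (c *\<^sub>Q a) = c *\<^sub>Q proj_L r a"
    unfolding xy by (simp only: simps[symmetric] proj_L_of weight_part.abs_eq)
qed

text \<open>Images in \<open>L\<close>.\<close>

definition zeta_L :: "nat \<Rightarrow> int list \<Rightarrow> nat list \<Rightarrow> motL" where
  "zeta_L l es ks = motL_of (zeta_mot l es ks)"

definition t_L :: "nat list \<Rightarrow> motL" where
  "t_L ks = motL_of (t_mot ks)"

definition log2_L :: motL where
  "log2_L = motL_of log2_mot"

text \<open>\<open>slice ks i j\<close> is \<open>(k\<^sub>i, \<dots>, k\<^sub>j)\<close> for \<open>ks = [k\<^sub>1, \<dots>, k\<^sub>d]\<close>, with indices starting at 1; it is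
  empty if \<open>j < i\<close>.\<close>

definition slice :: "nat list \<Rightarrow> nat \<Rightarrow> nat \<Rightarrow> nat list" where
  "slice ks i j = map (\<lambda>m. ks ! (m - 1)) [i..<Suc j]"

end

theory Submission
  imports Defs
begin

text \<open>Let \<open>\<Phi>\<close> be the shuffle homomorphism which replaces the letter 0 by twice itself and the
  letter 1 by the sum of 1 and -1. Apart from the sign attached to the first letter, a motivic
  multiple \<open>t\<close> value is \<open>I(0; \<Phi> w; 1)\<close> for a word \<open>w\<close> in 0 and 1, and \<open>D\<^sub>r\<close> cuts gaps out of
  \<open>w\<close>. A gap that contains the first letter gives the first sum of the formula. By homothety,
  any other gap summed over the signs of its letters is \<open>I(a; \<Phi> u; b)\<close> with \<open>a\<close> and \<open>b\<close> in
  \<open>{0, 1}\<close>, whatever the signs of its end points. It vanishes for \<open>a = b\<close>, and since \<open>r\<close> is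
  odd, reversal of paths gives the two remaining cases opposite signs. Modulo products \<open>I(0; \<Phi>
  u; 1)\<close> is \<open>I(0; u; 1)\<close>, except that \<open>log 2\<close> appears for the word \<open>u = 1\<close>.

  The last statement is a distribution relation. It holds motivically because the ideal
  generated by the letters 0 and 1 and by the differences \<open>\<Phi> w - w\<close> for convergent words \<open>w\<close>
  in 0 and 1 is graded, stable under the coaction (which commutes with \<open>\<Phi>\<close>), and annihilated
  by the period map (by the substitution \<open>s \<mapsto> s\<^sup>2\<close>).\<close>

section \<open>Sums over deconcatenations and over shuffles of words\<close>

text \<open>Equality of periods does not give equality of motivic integrals, so the distribution
  relation needs an explicit stable ideal. Its generators \<Phi> w - w are limited to convergent
  words because \<Phi> w = w fails at the tangential base point 1: for w = 1 it would say that log 2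
  vanishes. Single terms of Goncharov's formula contain words ending in 1 even if w does not; these
  cancel only in the sum. On all words \<Phi> is therefore compared with a second shuffle
  homomorphism E = \<open>base_point_change\<close>, which fixes convergent words in 0 and 1 and
  agrees with \<Phi> on the letter 1; the two are congruent modulo the ideal. For a word w in 0 and
  1 that does not end in 1, the derivation removing a final 1 kills the coaction of w in either
  factor, and on such tensors E acts as the identity. Hence the coaction of \<Phi> w - w is the
  image of the coaction of w under \<Phi> \<otimes> \<Phi> - E \<otimes> E, and this difference
  splits into terms with a factor in the ideal.\<close>

primrec split_sum :: "('a list \<Rightarrow> 'a list \<Rightarrow> 'b::comm_monoid_add) \<Rightarrow> 'a list \<Rightarrow> 'b" where
  "split_sum f [] = f [] []"
| "split_sum f (x # w) = f [] (x # w) + split_sum (\<lambda>s. f (x # s)) w"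

lemma split_sum_take_drop: "(\<Sum>n\<le>length w. f (take n w) (drop n w)) = split_sum f w"
proof (induction w arbitrary: f)
  case (Cons x w)
  show ?case
    by (simp add: sum.atMost_Suc_shift Cons.IH[symmetric] del: sum.atMost_Suc)
qed simp

lemma split_sum_cong:
  "(\<And>s t. w = s @ t \<Longrightarrow> f s t = g s t) \<Longrightarrow> split_sum f w = split_sum g w"
  by (simp add: split_sum_take_drop[symmetric])

lemma split_sum_add: "split_sum (\<lambda>s t. f s t + g s t) w = split_sum f w + split_sum g w"
  by (simp add: split_sum_take_drop[symmetric] sum.distrib)

lemma split_sum_diff:
  fixes f g :: "'a list \<Rightarrow> 'a list \<Rightarrow> 'b::ab_group_add"
  shows "split_sum (\<lambda>s t. f s t - g s t) w = split_sum f w - split_sum g w"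
  by (simp add: split_sum_take_drop[symmetric] sum_subtractf)

lemma split_sum_zero [simp]: "split_sum (\<lambda>s t. 0) w = 0"
  by (simp add: split_sum_take_drop[symmetric])

lemma split_sum_swap:
  "split_sum (\<lambda>s t. split_sum (f s t) v) w = split_sum (\<lambda>a b. split_sum (\<lambda>s t. f s t a b) w) v"
  unfolding split_sum_take_drop[symmetric] by (rule sum.swap)

lemma split_sum_snoc:
  "split_sum f (w @ [x]) = split_sum (\<lambda>s t. f s (t @ [x])) w + f (w @ [x]) []"
  by (induction w arbitrary: f) (simp_all add: add.assoc)

lemma split_sum_rev: "split_sum f (rev w) = split_sum (\<lambda>s t. f (rev t) (rev s)) w"
  by (induction w arbitrary: f) (simp_all add: split_sum_snoc add.commute)

text \<open>Both sides run over the ways to cut w into three parts: deconcatenation is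
  coassociative.\<close>

lemma split_sum_assoc:
  "split_sum (\<lambda>s t. split_sum (\<lambda>a b. f a b t) s) w = split_sum (\<lambda>a u. split_sum (f a) u) w"
  by (induction w arbitrary: f) (simp_all add: split_sum_add add.assoc)

text \<open>A cut next to a distinguished letter can be made after that letter or before it. This
  cancels the sums in \<open>remove_last_conv_negate_only\<close> and
  \<open>remove_last_coact_left\<close>.\<close>

lemma split_sum_shift:
  "split_sum (\<lambda>s t. if s = [] then 0 else f (butlast s) (last s # t)) w =
   split_sum (\<lambda>s t. if t = [] then 0 else f s t) w"
proof (induction w arbitrary: f)
  case (Cons x w)
  have "split_sum (\<lambda>s t. f (butlast (x # s)) (last (x # s) # t)) w
      = f [] (x # w) + split_sum (\<lambda>s t. if s = [] then 0 else f (x # butlast s) (last s # t)) w"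
    by (cases w) simp_all
  then show ?case
    using Cons.IH[of "\<lambda>s. f (x # s)"] by simp
qed simp

lemma split_sum_linear:
  "rat_linear h \<Longrightarrow> h (split_sum f w) = split_sum (\<lambda>s t. h (f s t)) w"
  by (simp add: split_sum_take_drop[symmetric] rat_linear_sum)

lemma split_sum_only_Nil:
  "(\<And>s t. w = s @ t \<Longrightarrow> s \<noteq> [] \<Longrightarrow> f s t = 0) \<Longrightarrow> split_sum f w = f [] w"
proof (cases w)
  case (Cons x v)
  assume *: "\<And>s t. w = s @ t \<Longrightarrow> s \<noteq> [] \<Longrightarrow> f s t = 0"
  have "split_sum (\<lambda>s. f (x # s)) v = split_sum (\<lambda>s t. 0) v"
    by (rule split_sum_cong) (simp add: * Cons)
  then show ?thesis by (simp add: Cons)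
qed simp

lemma split_sum_nonempty_right:
  "split_sum (\<lambda>s t. if t = [] then 0 else f s t) w + f w [] = split_sum f w"
proof (induction w arbitrary: f)
  case (Cons x w)
  show ?case
    using Cons.IH[of "\<lambda>s. f (x # s)"] by (simp add: add.assoc)
qed simp

section \<open>Sums over shuffles\<close>

definition shuffle_sum :: "('a list \<Rightarrow> 'b::comm_monoid_add) \<Rightarrow> 'a list \<Rightarrow> 'a list \<Rightarrow> 'b" where
  "shuffle_sum f u v = (\<Sum>w\<leftarrow>shuffle_list u v. f w)"

lemma shuffle_list_Nil2 [simp]: "shuffle_list u [] = [u]"
  by (cases u) simp_all

lemma shuffle_sum_simps [simp]:
  "shuffle_sum f [] = f"
  "shuffle_sum f u [] = f u"
  "shuffle_sum f (a # u) (b # v) =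
     shuffle_sum (\<lambda>w. f (a # w)) u (b # v) + shuffle_sum (\<lambda>w. f (b # w)) (a # u) v"
  by (simp_all add: fun_eq_iff shuffle_sum_def comp_def)

lemma shuffle_sum_cong:
  "(\<And>w. w \<in> set (shuffle_list u v) \<Longrightarrow> f w = g w) \<Longrightarrow> shuffle_sum f u v = shuffle_sum g u v"
  unfolding shuffle_sum_def by (metis map_cong)

lemma shuffle_sum_add:
  "shuffle_sum (\<lambda>w. f w + g w) u v = shuffle_sum f u v + shuffle_sum g u v"
  by (simp add: shuffle_sum_def sum_list_addf)

lemma shuffle_sum_linear:
  assumes "rat_linear h"
  shows "h (shuffle_sum f u v) = shuffle_sum (\<lambda>w. h (f w)) u v"
proof -
  have "h (\<Sum>w\<leftarrow>ws. f w) = (\<Sum>w\<leftarrow>ws. h (f w))" for ws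
    by (induction ws) (simp_all add: rat_linear_0[OF assms] rat_linear_add[OF assms])
  then show ?thesis by (simp add: shuffle_sum_def)
qed

lemma shuffle_sum_commute: "shuffle_sum f u v = shuffle_sum f v u"
  by (induction u v arbitrary: f rule: shuffle_list.induct) (simp_all add: add.commute)

text \<open>The first letter of a triple shuffle comes from u, v or z, and each case is an instance
  of smaller total length.\<close>

lemma shuffle_sum_assoc:
  "shuffle_sum (\<lambda>w. shuffle_sum f w z) u v = shuffle_sum (\<lambda>w. shuffle_sum f u w) v z"
proof (induction "length u + length v + length z" arbitrary: u v z f rule: less_induct)
  case less
  show ?case
  proof (cases "u = [] \<or> v = [] \<or> z = []")
    case True
    then show ?thesis by auto
  next
    case False
    then obtain a u' b v' c z' where eq: "u = a # u'" "v = b # v'" "z = c # z'"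
      by (auto simp: neq_Nil_conv)
    have 1: "shuffle_sum (\<lambda>w. shuffle_sum (\<lambda>w. f (a # w)) w z) u' v =
        shuffle_sum (\<lambda>w. shuffle_sum (\<lambda>w. f (a # w)) u' w) v z"
      by (rule less) (simp add: eq)
    have 2: "shuffle_sum (\<lambda>w. shuffle_sum (\<lambda>w. f (b # w)) w z) u v' =
        shuffle_sum (\<lambda>w. shuffle_sum (\<lambda>w. f (b # w)) u w) v' z"
      by (rule less) (simp add: eq)
    have 3: "shuffle_sum (\<lambda>w. shuffle_sum (\<lambda>w. f (c # w)) w z') u v =
        shuffle_sum (\<lambda>w. shuffle_sum (\<lambda>w. f (c # w)) u w) v z'"
      by (rule less) (simp add: eq)
    show ?thesis
      using 1 2 3 unfolding eq by (simp add: shuffle_sum_add add_ac)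
  qed
qed

text \<open>The bialgebra axiom: a cut of a shuffle cuts u and v separately and leaves a shuffle of
  the left parts and one of the right parts.\<close>

lemma shuffle_sum_split_sum:
  "shuffle_sum (split_sum h) u v =
   split_sum (\<lambda>u1 u2. split_sum (\<lambda>v1 v2. shuffle_sum (\<lambda>s. shuffle_sum (h s) u2 v2) u1 v1) v) u"
proof (induction u v arbitrary: h rule: shuffle_list.induct)
  case (3 a u b v)
  show ?case
    by (simp add: shuffle_sum_add 3 split_sum_add add_ac)
qed simp_all

text \<open>The mirror image of the defining recursion. It makes shuffles compatible with reversal
  and with removal of last letters.\<close>

lemma shuffle_sum_snoc:
  "shuffle_sum f (u @ [a]) (v @ [b]) =
     shuffle_sum (\<lambda>w. f (w @ [a])) u (v @ [b]) + shuffle_sum (\<lambda>w. f (w @ [b])) (u @ [a]) v"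
proof (induction "length u + length v" arbitrary: u v f rule: less_induct)
  case less
  show ?case
  proof (cases u)
    case u: Nil
    show ?thesis
    proof (cases v)
      case v: (Cons d v')
      show ?thesis
        using less[of "[]" v' "\<lambda>w. f (d # w)"] by (simp add: u v add_ac)
    qed (simp add: u add_ac)
  next
    case u: (Cons c u')
    show ?thesis
    proof (cases v)
      case Nil
      then show ?thesis
        using less[of u' "[]" "\<lambda>w. f (c # w)"] by (simp add: u add_ac)
    next
      case v: (Cons d v')
      show ?thesis
        using less[of u' v "\<lambda>w. f (c # w)"] less[of u v' "\<lambda>w. f (d # w)"]
        by (simp add: u v add_ac)
    qed
  qed
qed

lemma shuffle_sum_rev: "shuffle_sum f (rev u) (rev v) = shuffle_sum (\<lambda>w. f (rev w)) u v"
  by (induction u v arbitrary: f rule: shuffle_list.induct) (simp_all add: shuffle_sum_snoc)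

section \<open>The algebra of words\<close>

lemma rat_linear_id: "rat_linear (\<lambda>x. x)"
  by (rule rat_linearI) simp_all

lemma rat_linear_compose:
  "rat_linear f \<Longrightarrow> rat_linear g \<Longrightarrow> rat_linear (\<lambda>x. f (g x))"
  by (rule rat_linearI) (simp_all add: rat_linear_add rat_linear_scale)

lemma rat_linear_plus:
  "rat_linear f \<Longrightarrow> rat_linear g \<Longrightarrow> rat_linear (\<lambda>x. f x + g x)"
  by (rule rat_linearI)
    (simp_all add: rat_linear_add[of f] rat_linear_scale[of f] rat_linear_add[of g]
      rat_linear_scale[of g] scaleQ_add_right)

lemma rat_linear_minus:
  "rat_linear f \<Longrightarrow> rat_linear g \<Longrightarrow> rat_linear (\<lambda>x. f x - g x)"
  by (rule rat_linearI)
    (simp_all add: rat_linear_add[of f] rat_linear_scale[of f] rat_linear_add[of g]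
      rat_linear_scale[of g] ratvs.scale_right_diff_distrib)

lemma rat_linear_scaleQ: "rat_linear f \<Longrightarrow> rat_linear (\<lambda>x. c *\<^sub>Q f x)"
  by (rule rat_linearI)
    (simp_all add: rat_linear_add[of f] rat_linear_scale[of f] scaleQ_add_right scaleQ_scaleQ
      mult.commute)

lemma rat_linear_const_0: "rat_linear (\<lambda>x. 0)"
  by (rule rat_linearI) simp_all

lemma rat_linear_neg: "rat_linear f \<Longrightarrow> f (- x) = - f x"
  using rat_linear_diff[of f 0 x] by (simp add: rat_linear_0)

lemma lin_ext_add: "lin_ext f (x + y) = lin_ext f x + lin_ext f y"
  and lin_ext_diff: "lin_ext f (x - y) = lin_ext f x - lin_ext f y"
  and lin_ext_scale: "lin_ext f (c *\<^sub>Q x) = c *\<^sub>Q lin_ext f x"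
  and lin_ext_zero [simp]: "lin_ext f 0 = 0"
  and lin_ext_neg: "lin_ext f (- x) = - lin_ext f x"
  by (simp_all add: rat_linear_add[OF rat_linear_lin_ext] rat_linear_diff[OF rat_linear_lin_ext]
      rat_linear_scale[OF rat_linear_lin_ext] rat_linear_0[OF rat_linear_lin_ext]
      rat_linear_neg[OF rat_linear_lin_ext])

lemma rat_linear_eqI:
  assumes "rat_linear f" "rat_linear g" "\<And>w. f (basis w) = g (basis w)"
  shows "f x = g x"
  using rat_linear_eq_lin_ext[OF assms(1), of x] rat_linear_eq_lin_ext[OF assms(2), of x]
  by (simp add: assms(3))

lemma lin_ext_zero_fun [simp]: "lin_ext (\<lambda>_. 0) x = 0"
  by (simp add: lin_ext_def)

lemma lin_ext_fun_add: "lin_ext (\<lambda>w. f w + g w) x = lin_ext f x + lin_ext g x"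
  by (rule rat_linear_eqI[of "lin_ext (\<lambda>w. f w + g w)"])
    (simp_all add: rat_linear_lin_ext rat_linear_plus)

lemma lin_ext_scale_fun: "lin_ext (\<lambda>w. c *\<^sub>Q f w) x = c *\<^sub>Q lin_ext f x"
  using rat_linear_lin_ext_swap[OF rat_linear_scaleQ[OF rat_linear_id], of c f x] by simp

lemmas shuffle_add_left = rat_linear_add[OF rat_linear_shuffle(2)]
lemmas shuffle_add_right = rat_linear_add[OF rat_linear_shuffle(1)]
lemmas shuffle_diff_left = rat_linear_diff[OF rat_linear_shuffle(2)]
lemmas shuffle_diff_right = rat_linear_diff[OF rat_linear_shuffle(1)]
lemmas shuffle_scale_left = rat_linear_scale[OF rat_linear_shuffle(2)]
lemmas shuffle_scale_right = rat_linear_scale[OF rat_linear_shuffle(1)]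
lemmas shuffle_zero_left [simp] = rat_linear_0[OF rat_linear_shuffle(2)]
lemmas shuffle_zero_right [simp] = rat_linear_0[OF rat_linear_shuffle(1)]

lemma shuffle_basis: "basis u \<star> basis v = shuffle_sum basis u v"
  by (simp add: shuffle_mult_def shuffle_sum_def)

lemma shuffle_one_left [simp]: "basis [] \<star> x = x"
  by (rule rat_linear_eqI[of "\<lambda>x. basis [] \<star> x"])
    (simp_all add: rat_linear_shuffle rat_linear_id shuffle_basis)

lemma shuffle_commute: "x \<star> y = y \<star> x"
proof -
  have *: "basis u \<star> y = y \<star> basis u" for u
    by (rule rat_linear_eqI[of "\<lambda>y. basis u \<star> y"])
      (simp_all add: rat_linear_shuffle shuffle_basis shuffle_sum_commute[of basis u])
  show ?thesis
    by (rule rat_linear_eqI[of "\<lambda>x. x \<star> y" "\<lambda>x. y \<star> x"])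
      (simp_all add: rat_linear_shuffle *)
qed

lemma shuffle_one_right [simp]: "x \<star> basis [] = x"
  by (simp add: shuffle_commute[of x])

lemma shuffle_assoc: "(x \<star> y) \<star> z = x \<star> (y \<star> z)"
proof -
  have 1: "(basis u \<star> basis v) \<star> basis w = basis u \<star> (basis v \<star> basis w)" for u v w
    by (simp add: shuffle_basis shuffle_sum_linear[OF rat_linear_shuffle(1)]
        shuffle_sum_linear[OF rat_linear_shuffle(2)] shuffle_sum_assoc)
  have 2: "(basis u \<star> basis v) \<star> z = basis u \<star> (basis v \<star> z)" for u v
    by (rule rat_linear_eqI[of "\<lambda>z. (basis u \<star> basis v) \<star> z"])
      (simp_all add: rat_linear_compose[OF rat_linear_shuffle(1)] rat_linear_shuffle 1)
  have 3: "(basis u \<star> y) \<star> z = basis u \<star> (y \<star> z)" for u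
    by (rule rat_linear_eqI[of "\<lambda>y. (basis u \<star> y) \<star> z"])
      (simp_all add: rat_linear_compose[OF rat_linear_shuffle(1)]
        rat_linear_compose[OF rat_linear_shuffle(2)] rat_linear_shuffle 2)
  show ?thesis
    by (rule rat_linear_eqI[of "\<lambda>x. (x \<star> y) \<star> z"])
      (simp_all add: rat_linear_compose[OF rat_linear_shuffle(2)] rat_linear_shuffle 3)
qed

lemma shuffle_left_commute: "x \<star> (y \<star> z) = y \<star> (x \<star> z)"
  by (metis shuffle_assoc shuffle_commute)

lemmas shuffle_ac = shuffle_assoc shuffle_commute shuffle_left_commute

definition prepend :: "letter \<Rightarrow> word_alg \<Rightarrow> word_alg" where
  "prepend a = lin_ext (\<lambda>w. basis (a # w))"

lemma rat_linear_prepend: "rat_linear (prepend a)"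
  unfolding prepend_def by (rule rat_linear_lin_ext)

lemma prepend_basis [simp]: "prepend a (basis w) = basis (a # w)"
  by (simp add: prepend_def)

text \<open>The recursion of the shuffle product, extended bilinearly to elements that are not
  words, such as images under letter substitutions.\<close>

lemma prepend_shuffle:
  "prepend a x \<star> prepend b y = prepend a (x \<star> prepend b y) + prepend b (prepend a x \<star> y)"
proof -
  note lin = rat_linear_prepend rat_linear_shuffle rat_linear_plus
    rat_linear_compose[OF rat_linear_prepend] rat_linear_compose[OF rat_linear_shuffle(1)]
    rat_linear_compose[OF rat_linear_shuffle(2)]
  have 1: "prepend a (basis u) \<star> prepend b (basis v) =
     prepend a (basis u \<star> prepend b (basis v)) + prepend b (prepend a (basis u) \<star> basis v)" for u v
    by (simp add: shuffle_basis shuffle_sum_linear[OF rat_linear_prepend])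
  have 2: "prepend a (basis u) \<star> prepend b y =
     prepend a (basis u \<star> prepend b y) + prepend b (prepend a (basis u) \<star> y)" for u
    by (rule rat_linear_eqI[of "\<lambda>y. prepend a (basis u) \<star> prepend b y"])
      (intro lin, intro lin, rule 1)
  show ?thesis
    by (rule rat_linear_eqI[of "\<lambda>x. prepend a x \<star> prepend b y"]) (intro lin, intro lin, rule 2)
qed

section \<open>Convolution and homomorphisms of the shuffle algebra\<close>

definition conv :: "(letter list \<Rightarrow> word_alg) \<Rightarrow> (letter list \<Rightarrow> word_alg) \<Rightarrow> letter list \<Rightarrow> word_alg"
  where "conv f g w = split_sum (\<lambda>s t. f s \<star> g t) w"

definition counit :: "letter list \<Rightarrow> word_alg" where
  "counit w = (if w = [] then basis [] else 0)"

definition shuffle_hom :: "(letter list \<Rightarrow> word_alg) \<Rightarrow> bool" where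
  "shuffle_hom f \<longleftrightarrow> f [] = basis [] \<and> (\<forall>u v. f u \<star> f v = shuffle_sum f u v)"

lemma shuffle_hom_lin_ext:
  assumes "shuffle_hom f"
  shows "lin_ext f (x \<star> y) = lin_ext f x \<star> lin_ext f y"
proof -
  note lin = rat_linear_lin_ext rat_linear_shuffle rat_linear_compose[OF rat_linear_lin_ext]
    rat_linear_compose[OF rat_linear_shuffle(1)] rat_linear_compose[OF rat_linear_shuffle(2)]
  have 1: "lin_ext f (basis u \<star> basis v) = lin_ext f (basis u) \<star> lin_ext f (basis v)" for u v
    using assms by (simp add: shuffle_basis shuffle_sum_linear[OF rat_linear_lin_ext] shuffle_hom_def)
  have 2: "lin_ext f (basis u \<star> y) = lin_ext f (basis u) \<star> lin_ext f y" for u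
    by (rule rat_linear_eqI[of "\<lambda>y. lin_ext f (basis u \<star> y)"]) (intro lin, intro lin, rule 1)
  show ?thesis
    by (rule rat_linear_eqI[of "\<lambda>x. lin_ext f (x \<star> y)"]) (intro lin, intro lin, rule 2)
qed

lemma shuffle_hom_compose:
  assumes "shuffle_hom f" "shuffle_hom g"
  shows "shuffle_hom (\<lambda>w. lin_ext f (g w))"
  using assms(2) unfolding shuffle_hom_def
  by (auto simp: shuffle_hom_lin_ext[OF assms(1), symmetric] shuffle_sum_linear[OF rat_linear_lin_ext])
    (use assms(1) in \<open>simp add: shuffle_hom_def\<close>)

lemma shuffle_hom_basis: "shuffle_hom basis"
  by (simp add: shuffle_hom_def shuffle_basis)

lemma shuffle_hom_rev: "shuffle_hom f \<Longrightarrow> shuffle_hom (\<lambda>w. f (rev w))"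
  unfolding shuffle_hom_def by (metis rev.simps(1) shuffle_sum_rev)

text \<open>The target is commutative, which is used where the four factors are regrouped; the rest
  is compatibility of deconcatenation with shuffles.\<close>

lemma shuffle_hom_conv:
  assumes "shuffle_hom f" "shuffle_hom g"
  shows "shuffle_hom (conv f g)"
proof -
  note lin = split_sum_linear[OF rat_linear_shuffle(1)] split_sum_linear[OF rat_linear_shuffle(2)]
    shuffle_sum_linear[OF rat_linear_shuffle(1)] shuffle_sum_linear[OF rat_linear_shuffle(2)]
  have "conv f g u \<star> conv f g v = shuffle_sum (conv f g) u v" for u v
  proof -
    have "conv f g u \<star> conv f g v =
        split_sum (\<lambda>u1 u2. split_sum (\<lambda>v1 v2. (f u1 \<star> g u2) \<star> (f v1 \<star> g v2)) v) u"
      by (subst split_sum_swap) (simp add: conv_def lin)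
    also have "\<dots> = split_sum (\<lambda>u1 u2. split_sum (\<lambda>v1 v2. (f u1 \<star> f v1) \<star> (g u2 \<star> g v2)) v) u"
      by (simp add: shuffle_ac)
    also have "\<dots> = split_sum (\<lambda>u1 u2. split_sum (\<lambda>v1 v2.
        shuffle_sum (\<lambda>s. shuffle_sum (\<lambda>t. f s \<star> g t) u2 v2) u1 v1) v) u"
      using assms by (simp add: shuffle_hom_def shuffle_sum_linear[OF rat_linear_shuffle(2)])
        (simp add: shuffle_sum_linear[OF rat_linear_shuffle(1)])
    also have "\<dots> = shuffle_sum (conv f g) u v"
      unfolding shuffle_sum_split_sum[symmetric] conv_def ..
    finally show ?thesis .
  qed
  then show ?thesis
    using assms by (simp add: shuffle_hom_def conv_def)
qed

lemma conv_assoc: "conv (conv f g) h = conv f (conv g h)"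
proof
  fix w
  have "conv (conv f g) h w = split_sum (\<lambda>s t. split_sum (\<lambda>a b. f a \<star> (g b \<star> h t)) s) w"
    by (simp add: conv_def split_sum_linear[OF rat_linear_shuffle(2)] shuffle_assoc)
  also have "\<dots> = conv f (conv g h) w"
    unfolding split_sum_assoc by (simp add: conv_def split_sum_linear[OF rat_linear_shuffle(1)])
  finally show "conv (conv f g) h w = conv f (conv g h) w" .
qed

lemma conv_counit_left [simp]: "conv counit f = f"
  by (rule ext, subst conv_def, subst split_sum_only_Nil) (auto simp: counit_def)

lemma conv_counit_right [simp]: "conv f counit = f"
proof
  fix w show "conv f counit w = f w"
  proof (cases w rule: rev_cases)
    case (snoc v x)
    have "split_sum (\<lambda>s t. f s \<star> counit (t @ [x])) v = split_sum (\<lambda>s t. 0) v"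
      by (rule split_sum_cong) (simp add: counit_def)
    then show ?thesis by (simp add: snoc conv_def split_sum_snoc) (simp add: counit_def)
  qed (simp add: conv_def counit_def)
qed

lemma lin_ext_conv:
  assumes "shuffle_hom h"
  shows "lin_ext h (conv f g w) = conv (\<lambda>w. lin_ext h (f w)) (\<lambda>w. lin_ext h (g w)) w"
  by (simp add: conv_def split_sum_linear[OF rat_linear_lin_ext] shuffle_hom_lin_ext[OF assms])

section \<open>Letter substitutions, path composition and removal of letters\<close>

text \<open>\<open>c x y\<close> is the coefficient of the letter y in the image of the letter x.
  The doubling \<Phi>, the reflection of signs, the counit and \<open>negate_only\<close> are all of
  this form, so one proof shows that they are shuffle homomorphisms.\<close>

definition subst_letter :: "(letter \<Rightarrow> letter \<Rightarrow> rat) \<Rightarrow> letter \<Rightarrow> word_alg \<Rightarrow> word_alg" where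
  "subst_letter c x z =
     c x P0 *\<^sub>Q prepend P0 z + (c x P1 *\<^sub>Q prepend P1 z + c x Pm1 *\<^sub>Q prepend Pm1 z)"

primrec subst :: "(letter \<Rightarrow> letter \<Rightarrow> rat) \<Rightarrow> letter list \<Rightarrow> word_alg" where
  "subst c [] = basis []"
| "subst c (x # w) = subst_letter c x (subst c w)"

lemma rat_linear_subst_letter: "rat_linear (subst_letter c x)"
  unfolding subst_letter_def by (intro rat_linear_plus rat_linear_scaleQ rat_linear_prepend)

lemma lin_ext_prepend: "lin_ext f (prepend a z) = lin_ext (\<lambda>w. f (a # w)) z"
  by (rule rat_linear_eqI[of "\<lambda>z. lin_ext f (prepend a z)"])
    (simp_all add: rat_linear_compose[OF rat_linear_lin_ext rat_linear_prepend] rat_linear_lin_ext)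

lemma lin_ext_subst_Cons:
  "lin_ext f (subst c (x # w)) =
     c x P0 *\<^sub>Q lin_ext (\<lambda>w. f (P0 # w)) (subst c w) +
     (c x P1 *\<^sub>Q lin_ext (\<lambda>w. f (P1 # w)) (subst c w) +
      c x Pm1 *\<^sub>Q lin_ext (\<lambda>w. f (Pm1 # w)) (subst c w))"
  by (simp add: subst_letter_def lin_ext_add lin_ext_scale lin_ext_prepend)

lemma split_sum_scale: "split_sum (\<lambda>s t. c *\<^sub>Q f s t) w = c *\<^sub>Q split_sum f w"
  using split_sum_linear[OF rat_linear_scaleQ[OF rat_linear_id], of c f w] by simp

text \<open>Substitution works letter by letter, so a cut of a word in the image of w comes from the
  cut of w at the same place.\<close>

lemma lin_ext_subst_split_sum:
  "lin_ext (split_sum h) (subst c w) =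
   split_sum (\<lambda>s t. lin_ext (\<lambda>s'. lin_ext (h s') (subst c t)) (subst c s)) w"
proof (induction w arbitrary: h)
  case (Cons x w)
  show ?case
    by (simp only: split_sum.simps lin_ext_subst_Cons lin_ext_fun_add Cons.IH split_sum_add
        split_sum_scale subst.simps(1) lin_ext_basis)
      (simp add: scaleQ_add_right add_ac)
qed simp

lemma lin_ext_subst_snoc:
  "lin_ext f (subst c (w @ [x])) =
     c x P0 *\<^sub>Q lin_ext (\<lambda>w. f (w @ [P0])) (subst c w) +
     (c x P1 *\<^sub>Q lin_ext (\<lambda>w. f (w @ [P1])) (subst c w) +
      c x Pm1 *\<^sub>Q lin_ext (\<lambda>w. f (w @ [Pm1])) (subst c w))"
proof (induction w arbitrary: f)
  case (Cons y w)
  show ?case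
    by (simp only: append_Cons lin_ext_subst_Cons Cons.IH)
      (simp add: scaleQ_add_right scaleQ_scaleQ mult.commute add_ac)
qed (simp add: subst_letter_def lin_ext_add lin_ext_scale)

lemma lin_ext_subst_rev: "lin_ext (\<lambda>w. f (rev w)) (subst c w) = lin_ext f (subst c (rev w))"
proof (induction w arbitrary: f)
  case (Cons x w)
  show ?case
    by (simp only: lin_ext_subst_Cons rev.simps lin_ext_subst_snoc Cons.IH[symmetric])
qed simp

lemma shuffle_hom_subst: "shuffle_hom (subst c)"
proof -
  have 1: "subst_letter c a x \<star> subst_letter c b y =
      subst_letter c a (x \<star> subst_letter c b y) + subst_letter c b (subst_letter c a x \<star> y)"
    for a b x y
    unfolding subst_letter_def
    by (simp add: shuffle_add_left shuffle_add_right shuffle_scale_left shuffle_scale_right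
        rat_linear_add[OF rat_linear_prepend] rat_linear_scale[OF rat_linear_prepend]
        scaleQ_add_right scaleQ_scaleQ prepend_shuffle mult.commute add_ac)
  have "subst c u \<star> subst c v = shuffle_sum (subst c) u v" for u v
    by (induction u v rule: shuffle_list.induct)
      (simp_all add: 1 shuffle_sum_linear[OF rat_linear_subst_letter, symmetric])
  then show ?thesis by (simp add: shuffle_hom_def)
qed

lemma counit_eq_subst: "counit = subst (\<lambda>x y. 0)"
proof
  show "counit w = subst (\<lambda>x y. 0) w" for w
    by (cases w) (simp_all add: counit_def subst_letter_def)
qed

lemma map_letter_neg_eq_subst:
  "basis (map letter_neg w) = subst (\<lambda>x y. if y = letter_neg x then 1 else 0) w"
proof (induction w)
  case (Cons x w)
  show ?case
    by (cases x) (simp_all add: subst_letter_def scaleQ_one Cons.IH[symmetric])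
qed simp

lemma int_from0_P0: "(\<lambda>w. int_from0 w P0) = counit"
  by (simp add: fun_eq_iff counit_def)

lemma shuffle_hom_int_from0: "shuffle_hom (\<lambda>w. int_from0 w b)"
proof (cases b)
  case P0
  then show ?thesis
    by (simp only: int_from0_P0 counit_eq_subst shuffle_hom_subst)
next
  case Pm1
  then show ?thesis
    by (simp add: map_letter_neg_eq_subst shuffle_hom_subst)
qed (simp add: shuffle_hom_basis)

lemma shuffle_hom_sign:
  assumes "shuffle_hom f"
  shows "shuffle_hom (\<lambda>w. (- 1) ^ length w *\<^sub>Q f w)"
proof -
  have "((- 1) ^ length u *\<^sub>Q f u) \<star> ((- 1) ^ length v *\<^sub>Q f v) =
      shuffle_sum (\<lambda>w. (- 1) ^ length w *\<^sub>Q f w) u v" for u v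
  proof -
    have "((- 1) ^ length u *\<^sub>Q f u) \<star> ((- 1) ^ length v *\<^sub>Q f v) =
        shuffle_sum (\<lambda>w. (- 1) ^ (length u + length v) *\<^sub>Q f w) u v"
      using assms
      by (simp add: shuffle_scale_left shuffle_scale_right scaleQ_scaleQ shuffle_hom_def power_add
          shuffle_sum_linear[OF rat_linear_scaleQ[OF rat_linear_id], symmetric])
    also have "\<dots> = shuffle_sum (\<lambda>w. (- 1) ^ length w *\<^sub>Q f w) u v"
      by (rule shuffle_sum_cong) (simp add: length_shuffle_list)
    finally show ?thesis .
  qed
  then show ?thesis
    using assms by (simp add: shuffle_hom_def scaleQ_one)
qed

lemma shuffle_hom_int_to0: "shuffle_hom (int_to0 a)"
  unfolding int_to0_def
  by (rule shuffle_hom_sign, rule shuffle_hom_rev, rule shuffle_hom_int_from0)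

text \<open>Composition of paths at 0 becomes a convolution, so cancellation of a path with its
  reverse becomes the antipode property below.\<close>

lemma word_int_conv: "(\<lambda>w. word_int a w b) = conv (int_to0 a) (\<lambda>w. int_from0 w b)"
  by (simp add: fun_eq_iff word_int_def conv_def
      split_sum_take_drop[of "\<lambda>s t. int_to0 a s \<star> int_from0 t b"])

lemma shuffle_hom_word_int: "shuffle_hom (\<lambda>w. word_int a w b)"
  unfolding word_int_conv by (intro shuffle_hom_conv shuffle_hom_int_to0 shuffle_hom_int_from0)

text \<open>Signed reversal is the antipode of the shuffle Hopf algebra. The case
  \<open>f = basis\<close> suffices, since \<open>lin_ext f\<close> carries convolutions to
  convolutions.\<close>

lemma antipode_right:
  assumes "shuffle_hom f"
  shows "conv f (\<lambda>w. (- 1) ^ length w *\<^sub>Q f (rev w)) = counit"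
proof
  define S where "S = conv basis (\<lambda>w. (- 1) ^ length w *\<^sub>Q basis (rev w))"
  \<comment> \<open>A shuffle of s with the reverse of t begins with the first letter of w, taken
    from s, or with the last letter of w, taken from the reverse of t. For words of length one the
    two terms cancel; for longer words both vanish by induction.\<close>
  have step: "S w = prepend (hd w) (S (tl w)) - prepend (last w) (S (butlast w))"
    if "w \<noteq> []" for w
  proof -
    define p q where
      "p = (\<lambda>s t. (- 1) ^ length t *\<^sub>Q prepend (hd s) (basis (tl s) \<star> basis (rev t)))" and
      "q = (\<lambda>s t. (- 1) ^ length t *\<^sub>Q prepend (last t) (basis s \<star> basis (rev (butlast t))))"
    have "basis s \<star> ((- 1) ^ length t *\<^sub>Q basis (rev t)) =
        (if s = [] then 0 else p s t) + (if t = [] then 0 else q s t)" if "w = s @ t" for s t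
    proof (cases s; cases t rule: rev_cases)
      fix a s' t' b assume "s = a # s'" "t = t' @ [b]"
      then show ?thesis
        using prepend_shuffle[of a "basis s'" b "basis (rev t')"]
        by (simp add: p_def q_def shuffle_scale_right scaleQ_add_right
            rat_linear_neg[OF rat_linear_shuffle(1)])
    qed (use \<open>w \<noteq> []\<close> that in \<open>auto simp: p_def q_def shuffle_scale_right\<close>)
    then have "S w = split_sum (\<lambda>s t. if s = [] then 0 else p s t) w +
        split_sum (\<lambda>s t. if t = [] then 0 else q s t) w"
      unfolding S_def conv_def split_sum_add[symmetric] by (rule split_sum_cong)
    moreover have "split_sum (\<lambda>s t. if s = [] then 0 else p s t) w = prepend (hd w) (S (tl w))"
      using \<open>w \<noteq> []\<close> by (cases w)
        (simp_all add: p_def S_def conv_def shuffle_scale_right rat_linear_scale[OF rat_linear_prepend]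
          split_sum_linear[OF rat_linear_prepend])
    moreover have "split_sum (\<lambda>s t. if t = [] then 0 else q s t) w
        = - prepend (last w) (S (butlast w))"
      using \<open>w \<noteq> []\<close> by (cases w rule: rev_cases)
        (simp_all add: q_def S_def conv_def shuffle_scale_right split_sum_snoc
          rat_linear_scale[OF rat_linear_prepend] split_sum_linear[OF rat_linear_prepend]
          split_sum_linear[OF rat_linear_scaleQ[OF rat_linear_id, of "-1"], simplified])
    ultimately show ?thesis by simp
  qed
  have "S w = counit w" for w
  proof (induction w rule: length_induct)
    case (1 w)
    show ?case
    proof (cases w rule: rev_cases)
      case Nil
      then show ?thesis by (simp add: S_def conv_def counit_def scaleQ_one)
    next
      case (snoc v b)
      show ?thesis
      proof (cases v)
        case Nil
        then show ?thesis
          using 1 step[of w] by (simp add: snoc counit_def)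
      next
        case (Cons a u)
        then have "S (tl w) = 0" "S (butlast w) = 0"
          using 1 by (simp_all add: snoc counit_def)
        then show ?thesis
          using step[of w] by (simp add: snoc counit_def rat_linear_0[OF rat_linear_prepend])
      qed
    qed
  qed
  moreover have "conv f (\<lambda>w. (- 1) ^ length w *\<^sub>Q f (rev w)) w = lin_ext f (S w)" for w
    unfolding S_def lin_ext_conv[OF assms] by (simp add: lin_ext_scale)
  ultimately show "conv f (\<lambda>w. (- 1) ^ length w *\<^sub>Q f (rev w)) w = counit w" for w
    using assms by (simp add: counit_def shuffle_hom_def)
qed

text \<open>Reversal of words exchanges the two factors of a convolution, so this is
  \<open>antipode_right\<close> for f composed with reversal.\<close>

lemma antipode_left:
  assumes "shuffle_hom f"
  shows "conv (\<lambda>w. (- 1) ^ length w *\<^sub>Q f (rev w)) f = counit"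
proof
  fix w
  have "conv (\<lambda>w. (- 1) ^ length w *\<^sub>Q f (rev w)) f w =
      conv (\<lambda>w. f (rev w)) (\<lambda>w. (- 1) ^ length w *\<^sub>Q f (rev (rev w))) (rev w)"
    unfolding conv_def split_sum_rev by (simp add: shuffle_commute[of "f _"])
  then show "conv (\<lambda>w. (- 1) ^ length w *\<^sub>Q f (rev w)) f w = counit w"
    by (simp only: antipode_right[OF shuffle_hom_rev[OF assms]]) (simp add: counit_def)
qed

text \<open>The path runs from a to 0 and back, and signed reversal is inverse for
  convolution.\<close>

lemma word_int_same: "word_int a w a = counit w"
  using antipode_left[OF shuffle_hom_int_from0[of a]] word_int_conv[of a a]
  by (simp add: fun_eq_iff int_to0_def[abs_def])

text \<open>Both paths pass through 0, and the pieces from 0 to x and from x back to 0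
  cancel.\<close>

lemma word_int_compose:
  "conv (\<lambda>w. word_int a w x) (\<lambda>w. word_int x w b) = (\<lambda>w. word_int a w b)"
proof -
  have "conv (\<lambda>w. int_from0 w x) (int_to0 x) = counit"
    using antipode_right[OF shuffle_hom_int_from0[of x]] by (simp add: int_to0_def[abs_def])
  then show ?thesis
    unfolding word_int_conv by (metis conv_assoc conv_counit_right)
qed

lemma int_to0_P0: "int_to0 P0 = counit"
  by (rule ext) (simp add: int_to0_def counit_def scaleQ_one)

lemma word_int_from_P0: "word_int P0 w b = int_from0 w b"
  using fun_cong[OF word_int_conv[of P0 b], of w] by (simp add: int_to0_P0)

lemma word_int_to_P0: "word_int a w P0 = int_to0 a w"
  using fun_cong[OF word_int_conv[of a P0], of w] by (simp only: int_from0_P0 conv_counit_right)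

lemma word_int_Nil [simp]: "word_int a [] b = basis []"
  using shuffle_hom_word_int[of a b] by (simp add: shuffle_hom_def)

definition remove_last :: "letter \<Rightarrow> word_alg \<Rightarrow> word_alg" where
  "remove_last c = lin_ext (\<lambda>w. if w \<noteq> [] \<and> last w = c then basis (butlast w) else 0)"

lemma rat_linear_remove_last: "rat_linear (remove_last c)"
  unfolding remove_last_def by (rule rat_linear_lin_ext)

lemma remove_last_basis [simp]:
  "remove_last c (basis w) = (if w \<noteq> [] \<and> last w = c then basis (butlast w) else 0)"
  by (simp add: remove_last_def)

text \<open>A shuffle ends with the last letter of one of the two factors, whence the Leibniz
  rule.\<close>

lemma remove_last_shuffle: "remove_last c (x \<star> y) = remove_last c x \<star> y + x \<star> remove_last c y"
proof -
  note lin = rat_linear_remove_last rat_linear_shuffle rat_linear_plus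
    rat_linear_compose[OF rat_linear_remove_last] rat_linear_compose[OF rat_linear_shuffle(1)]
    rat_linear_compose[OF rat_linear_shuffle(2)]
  have 1: "remove_last c (basis u \<star> basis v) =
      remove_last c (basis u) \<star> basis v + basis u \<star> remove_last c (basis v)" for u v
  proof (cases u rule: rev_cases; cases v rule: rev_cases)
    fix u' a v' b assume "u = u' @ [a]" "v = v' @ [b]"
    moreover have "shuffle_sum (\<lambda>w. 0) s t = (0::word_alg)" for s t :: "letter list"
      by (simp add: shuffle_sum_def)
    ultimately show ?thesis
      by (simp add: shuffle_basis shuffle_sum_snoc rat_linear_add[OF rat_linear_remove_last]
          shuffle_sum_linear[OF rat_linear_remove_last])
  qed simp_all
  have 2: "remove_last c (basis u \<star> y) = remove_last c (basis u) \<star> y + basis u \<star> remove_last c y" for u y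
    by (rule rat_linear_eqI[of "\<lambda>y. remove_last c (basis u \<star> y)"]) (intro lin, intro lin, rule 1)
  show ?thesis
    by (rule rat_linear_eqI[of "\<lambda>x. remove_last c (x \<star> y)"]) (intro lin, intro lin, rule 2)
qed

definition drop_last_if :: "letter \<Rightarrow> (letter list \<Rightarrow> 'v::zero) \<Rightarrow> letter list \<Rightarrow> 'v" where
  "drop_last_if b f w = (if w \<noteq> [] \<and> last w = b \<and> b \<noteq> P0 then f (butlast w) else 0)"

definition drop_first_if :: "letter \<Rightarrow> (letter list \<Rightarrow> 'v::zero) \<Rightarrow> letter list \<Rightarrow> 'v" where
  "drop_first_if a f w = (if w \<noteq> [] \<and> hd w = a \<and> a \<noteq> P0 then f (tl w) else 0)"

lemma split_sum_drop_last_if: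
  "split_sum (\<lambda>s t. drop_last_if b (f s) t) w = drop_last_if b (split_sum f) w"
proof (cases w rule: rev_cases)
  case (snoc v x)
  show ?thesis
    by (cases "x = b \<and> b \<noteq> P0") (auto simp: snoc split_sum_snoc drop_last_if_def)
qed (simp add: drop_last_if_def)

lemma split_sum_drop_first_if:
  "split_sum (\<lambda>s t. drop_first_if a (\<lambda>s. f s t) s) w = drop_first_if a (split_sum f) w"
proof (cases w)
  case (Cons x v)
  show ?thesis
    by (cases "x = a \<and> a \<noteq> P0") (auto simp: Cons drop_first_if_def)
qed (simp add: drop_first_if_def)

text \<open>Homothety moves the end point b to 1, so a final 1 stems from a last letter equal to
  b.\<close>

lemma remove_last_int_from0: "remove_last P1 (int_from0 w b) = drop_last_if b (\<lambda>w. int_from0 w b) w"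
proof (cases b)
  case Pm1
  have neg: "letter_neg x = P1 \<longleftrightarrow> x = Pm1" for x by (cases x) simp_all
  show ?thesis
    by (cases w rule: rev_cases) (simp_all add: Pm1 drop_last_if_def neg)
qed (auto simp: drop_last_if_def rat_linear_0[OF rat_linear_remove_last])

text \<open>Reversal makes the first letter the last one, and the loss of one letter changes the
  sign of the reversal.\<close>

lemma remove_last_int_to0: "remove_last P1 (int_to0 a w) = - drop_first_if a (int_to0 a) w"
proof (cases w)
  case (Cons x v)
  then show ?thesis
    by (simp add: int_to0_def rat_linear_neg[OF rat_linear_remove_last]
        rat_linear_scale[OF rat_linear_remove_last] remove_last_int_from0
        drop_first_if_def drop_last_if_def)
qed (simp add: int_to0_def scaleQ_one remove_last_int_from0 drop_first_if_def drop_last_if_def)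

lemma remove_last_word_int:
  "remove_last P1 (word_int a w b) =
     drop_last_if b (\<lambda>w. word_int a w b) w - drop_first_if a (\<lambda>w. word_int a w b) w"
proof -
  let ?S = "int_to0 a" and ?F = "\<lambda>w. int_from0 w b"
  have "remove_last P1 (conv ?S ?F w) =
      split_sum (\<lambda>s t. drop_last_if b (\<lambda>t. ?S s \<star> ?F t) t) w -
      split_sum (\<lambda>s t. drop_first_if a (\<lambda>s. ?S s \<star> ?F t) s) w"
    unfolding conv_def split_sum_linear[OF rat_linear_remove_last] split_sum_diff[symmetric]
    by (rule split_sum_cong)
      (simp add: remove_last_shuffle remove_last_int_from0 remove_last_int_to0 drop_last_if_def
        drop_first_if_def rat_linear_neg[OF rat_linear_shuffle(2)])
  then show ?thesis
    unfolding word_int_conv split_sum_drop_last_if split_sum_drop_first_if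
    by (simp only: conv_def[abs_def] fun_cong[OF word_int_conv])
qed

section \<open>The coaction on words\<close>

lemma rat_linear_abs_tensor: "rat_linear abs_tensor"
  by (rule rat_linearI) (simp_all add: plus_tensor.abs_eq scaleQ_tensor.abs_eq)

lemma tensor_eqI:
  assumes "rat_linear f" "rat_linear g" "\<And>a b. f (a \<otimes>\<^sub>Q b) = g (a \<otimes>\<^sub>Q b)"
  shows "f t = g t"
proof -
  obtain x where x: "t = abs_tensor x"
    by (metis Quotient_abs_rep Quotient_tensor)
  show ?thesis
    unfolding x
    by (rule rat_linear_eqI[of "\<lambda>x. f (abs_tensor x)"])
      (auto intro: rat_linear_compose[OF _ rat_linear_abs_tensor] assms(1,2)
        simp: assms(3)[unfolded tensor_def])
qed

lemma tensor_eqI2: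
  assumes "\<And>t. rat_linear (\<lambda>s. f s t)" "\<And>s. rat_linear (f s)"
    and "\<And>t. rat_linear (\<lambda>s. g s t)" "\<And>s. rat_linear (g s)"
    and "\<And>a b a' b'. f (a \<otimes>\<^sub>Q b) (a' \<otimes>\<^sub>Q b') = g (a \<otimes>\<^sub>Q b) (a' \<otimes>\<^sub>Q b')"
  shows "f s t = g s t"
  by (rule tensor_eqI[of "\<lambda>s. f s t"], rule assms, rule assms, rule tensor_eqI, (rule assms)+)

lemma tensor_map_tensor [simp]:
  "rat_linear f \<Longrightarrow> rat_linear g \<Longrightarrow> tensor_map f g (a \<otimes>\<^sub>Q b) = f a \<otimes>\<^sub>Q g b"
  by (simp add: tensor_map_def tensor_lift_tensor rat_bilinear_tensor_comp)

lemma rat_linear_tensor_map: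
  "rat_linear f \<Longrightarrow> rat_linear g \<Longrightarrow> rat_linear (tensor_map f g)"
  unfolding tensor_map_def by (rule rat_linear_tensor_lift, rule rat_bilinear_tensor_comp)

lemmas tensor_add_left = rat_linear_add[OF rat_linear_tensor(2)]
lemmas tensor_add_right = rat_linear_add[OF rat_linear_tensor(1)]
lemmas tensor_diff_left = rat_linear_diff[OF rat_linear_tensor(2)]
lemmas tensor_diff_right = rat_linear_diff[OF rat_linear_tensor(1)]
lemmas tensor_scale_left = rat_linear_scale[OF rat_linear_tensor(2)]
lemmas tensor_scale_right = rat_linear_scale[OF rat_linear_tensor(1)]

lemma tensor_map_compose:
  assumes "rat_linear f" "rat_linear g" "rat_linear f'" "rat_linear g'"
  shows "tensor_map f g (tensor_map f' g' t) = tensor_map (\<lambda>x. f (f' x)) (\<lambda>x. g (g' x)) t"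
  by (rule tensor_eqI)
    (auto intro: rat_linear_compose rat_linear_tensor_map assms simp: assms rat_linear_compose)

lemma tensor_map_fun_add_left:
  assumes "rat_linear f" "rat_linear f'" "rat_linear g"
  shows "tensor_map (\<lambda>x. f x + f' x) g t = tensor_map f g t + tensor_map f' g t"
  by (rule tensor_eqI)
    (auto intro: rat_linear_plus rat_linear_tensor_map assms
      simp: assms rat_linear_plus tensor_add_left)

lemma tensor_map_fun_add_right:
  assumes "rat_linear f" "rat_linear g'" "rat_linear g"
  shows "tensor_map f (\<lambda>x. g x + g' x) t = tensor_map f g t + tensor_map f g' t"
  by (rule tensor_eqI)
    (auto intro: rat_linear_plus rat_linear_tensor_map assms
      simp: assms rat_linear_plus tensor_add_right)

lemma tensor_map_fun_scale_left:
  assumes "rat_linear f" "rat_linear g"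
  shows "tensor_map (\<lambda>x. c *\<^sub>Q f x) g t = c *\<^sub>Q tensor_map f g t"
  by (rule tensor_eqI)
    (auto intro: rat_linear_scaleQ rat_linear_tensor_map assms
      simp: assms rat_linear_scaleQ tensor_scale_left)

lemma tensor_map_fun_scale_right:
  assumes "rat_linear f" "rat_linear g"
  shows "tensor_map f (\<lambda>x. c *\<^sub>Q g x) t = c *\<^sub>Q tensor_map f g t"
  by (rule tensor_eqI)
    (auto intro: rat_linear_scaleQ rat_linear_tensor_map assms
      simp: assms rat_linear_scaleQ tensor_scale_right)

section \<open>The product on the tensor square of the word algebra\<close>

definition tensor_times ::
  "(word_alg, word_alg) tensor \<Rightarrow> (word_alg, word_alg) tensor \<Rightarrow> (word_alg, word_alg) tensor" where
  "tensor_times s t = tensor_lift (\<lambda>a b. tensor_map ((\<star>) a) ((\<star>) b) t) s"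

lemma rat_bilinear_tensor_times_aux: "rat_bilinear (\<lambda>a b. tensor_map ((\<star>) a) ((\<star>) b) t)"
  unfolding rat_bilinear_def
  by (auto intro!: rat_linearI simp: shuffle_add_left[abs_def] shuffle_scale_left[abs_def]
      tensor_map_fun_add_left tensor_map_fun_add_right tensor_map_fun_scale_left
      tensor_map_fun_scale_right rat_linear_shuffle)

lemma tensor_times_tensor_left: "tensor_times (a \<otimes>\<^sub>Q b) t = tensor_map ((\<star>) a) ((\<star>) b) t"
  by (simp add: tensor_times_def tensor_lift_tensor rat_bilinear_tensor_times_aux)

lemma tensor_times_tensor [simp]:
  "tensor_times (a \<otimes>\<^sub>Q b) (a' \<otimes>\<^sub>Q b') = (a \<star> a') \<otimes>\<^sub>Q (b \<star> b')"
  by (simp add: tensor_times_tensor_left rat_linear_shuffle)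

lemma rat_linear_tensor_times_left: "rat_linear (\<lambda>s. tensor_times s t)"
  unfolding tensor_times_def by (rule rat_linear_tensor_lift[OF rat_bilinear_tensor_times_aux])

lemma rat_linear_tensor_times_right: "rat_linear (tensor_times s)"
proof (rule rat_linearI)
  note lin = rat_linear_tensor_times_left rat_linear_plus rat_linear_scaleQ
  fix t t' c
  show "tensor_times s (t + t') = tensor_times s t + tensor_times s t'"
    by (rule tensor_eqI[of "\<lambda>s. tensor_times s (t + t')"]) (intro lin, intro lin,
      simp add: tensor_times_tensor_left rat_linear_add rat_linear_tensor_map rat_linear_shuffle)
  show "tensor_times s (c *\<^sub>Q t) = c *\<^sub>Q tensor_times s t"
    by (rule tensor_eqI[of "\<lambda>s. tensor_times s (c *\<^sub>Q t)"]) (intro lin, intro lin,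
      simp add: tensor_times_tensor_left rat_linear_scale rat_linear_tensor_map rat_linear_shuffle)
qed

text \<open>The coaction is built from these two operations: \<open>times_left\<close> contributes
  the integral over the gap before the first marked letter, \<open>prepend_right\<close> the marked
  letter itself.\<close>

definition times_left :: "word_alg \<Rightarrow> (word_alg, 'v::rat_vector) tensor \<Rightarrow> (word_alg, 'v) tensor" where
  "times_left l = tensor_map ((\<star>) l) (\<lambda>x. x)"

definition prepend_right :: "letter \<Rightarrow> ('v::rat_vector, word_alg) tensor \<Rightarrow> ('v, word_alg) tensor" where
  "prepend_right x = tensor_map (\<lambda>x. x) (prepend x)"

lemma rat_linear_times_left: "rat_linear (times_left l)"
  unfolding times_left_def by (intro rat_linear_tensor_map rat_linear_shuffle rat_linear_id)

lemma rat_linear_times_left2: "rat_linear (\<lambda>l. times_left l t)"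
  unfolding times_left_def
  by (auto intro!: rat_linearI simp: shuffle_add_left[abs_def] shuffle_scale_left[abs_def]
      tensor_map_fun_add_left tensor_map_fun_scale_left rat_linear_shuffle rat_linear_id)

lemma rat_linear_prepend_right: "rat_linear (prepend_right x)"
  unfolding prepend_right_def by (intro rat_linear_tensor_map rat_linear_prepend rat_linear_id)

lemma times_left_tensor [simp]: "times_left l (a \<otimes>\<^sub>Q b) = (l \<star> a) \<otimes>\<^sub>Q b"
  by (simp add: times_left_def rat_linear_shuffle rat_linear_id)

lemma prepend_right_tensor [simp]: "prepend_right x (a \<otimes>\<^sub>Q b) = a \<otimes>\<^sub>Q prepend x b"
  by (simp add: prepend_right_def rat_linear_prepend rat_linear_id)

lemma times_left_times_left: "times_left l (times_left l' t) = times_left (l \<star> l') t"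
  by (rule tensor_eqI) (auto intro: rat_linear_times_left rat_linear_compose simp: shuffle_assoc)

lemma times_left_one [simp]: "times_left (basis []) t = t"
  by (rule tensor_eqI) (auto intro: rat_linear_times_left rat_linear_id)

lemma times_left_prepend_right:
  "times_left l (prepend_right x t) = prepend_right x (times_left l t)"
  by (rule tensor_eqI)
    (auto intro: rat_linear_times_left rat_linear_prepend_right rat_linear_compose)

lemma tensor_times_times_left:
  "tensor_times (times_left l s) t = times_left l (tensor_times s t)"
  "tensor_times s (times_left l t) = times_left l (tensor_times s t)"
proof -
  note lin = rat_linear_times_left rat_linear_tensor_times_left rat_linear_tensor_times_right
    rat_linear_compose[OF rat_linear_times_left] rat_linear_compose[OF rat_linear_tensor_times_left]
    rat_linear_compose[OF rat_linear_tensor_times_right]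
  show "tensor_times (times_left l s) t = times_left l (tensor_times s t)"
    by (rule tensor_eqI2[of "\<lambda>s t. tensor_times (times_left l s) t"])
      (auto intro: lin simp: shuffle_assoc)
  show "tensor_times s (times_left l t) = times_left l (tensor_times s t)"
    by (rule tensor_eqI2[of "\<lambda>s t. tensor_times s (times_left l t)"])
      (auto intro: lin simp: shuffle_left_commute)
qed

lemma tensor_times_prepend_right:
  "tensor_times (prepend_right x s) (prepend_right y t) =
     prepend_right x (tensor_times s (prepend_right y t)) +
     prepend_right y (tensor_times (prepend_right x s) t)"
proof -
  note lin = rat_linear_prepend_right rat_linear_tensor_times_left rat_linear_tensor_times_right
    rat_linear_plus rat_linear_compose[OF rat_linear_prepend_right]
    rat_linear_compose[OF rat_linear_tensor_times_left]
    rat_linear_compose[OF rat_linear_tensor_times_right]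
  show ?thesis
    by (rule tensor_eqI2[of "\<lambda>s t. tensor_times (prepend_right x s) (prepend_right y t)"])
      (intro lin | simp add: prepend_shuffle tensor_add_right)+
qed

lemma tensor_times_one [simp]:
  "tensor_times (basis [] \<otimes>\<^sub>Q basis []) t = t" "tensor_times t (basis [] \<otimes>\<^sub>Q basis []) = t"
  by (rule tensor_eqI[of "\<lambda>t. tensor_times _ t"] tensor_eqI[of "\<lambda>t. tensor_times t _"];
      simp add: rat_linear_tensor_times_left rat_linear_tensor_times_right rat_linear_id)+

section \<open>Goncharov's formula sorted by the first marked letter\<close>

definition coact :: "letter \<Rightarrow> letter \<Rightarrow> letter list \<Rightarrow> (word_alg, word_alg) tensor" where
  "coact a b w = (\<Sum>(l, v)\<leftarrow>goncharov_cuts a [] w b. l \<otimes>\<^sub>Q basis v)"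

text \<open>What follows the first gap: t begins with the first marked letter and is empty if no
  letter is marked.\<close>

definition coact_tail :: "letter \<Rightarrow> letter list \<Rightarrow> (word_alg, word_alg) tensor" where
  "coact_tail b t = (case t of [] \<Rightarrow> basis [] \<otimes>\<^sub>Q basis [] | x # t' \<Rightarrow> prepend_right x (coact x b t'))"

lemma coact_tail_simps [simp]:
  "coact_tail b [] = basis [] \<otimes>\<^sub>Q basis []"
  "coact_tail b (x # t) = prepend_right x (coact x b t)"
  by (simp_all add: coact_tail_def)

text \<open>Here s is the first gap. It ends at the first marked letter, or at b if there is none,
  which is what \<open>hd (t @ [b])\<close> encodes. In the induction, u is the part of the gap that
  has already been read.\<close>

lemma coact_rec:
  "coact a b w = split_sum (\<lambda>s t. times_left (word_int a s (hd (t @ [b]))) (coact_tail b t)) w"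
proof -
  have "(\<Sum>(l, v)\<leftarrow>goncharov_cuts a u w b. l \<otimes>\<^sub>Q basis v) =
     split_sum (\<lambda>s t. times_left (word_int a (u @ s) (hd (t @ [b]))) (coact_tail b t)) w" for u
  proof (induction w arbitrary: u)
    case (Cons x w)
    have "(\<Sum>(l, v)\<leftarrow>cs. (k \<star> l) \<otimes>\<^sub>Q basis (x # v)) =
        times_left k (prepend_right x (\<Sum>(l, v)\<leftarrow>cs. l \<otimes>\<^sub>Q basis v))" for k cs
      by (induction cs)
        (auto simp: rat_linear_0[OF rat_linear_times_left] rat_linear_add[OF rat_linear_times_left]
          rat_linear_0[OF rat_linear_prepend_right] rat_linear_add[OF rat_linear_prepend_right])
    then show ?case
      using Cons.IH[of "u @ [x]"]
      by (simp add: coact_def comp_def case_prod_beta' add.commute)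
  qed simp
  from this[of "[]"] show ?thesis by (simp add: coact_def)
qed

lemma word_coaction_eq: "word_coaction = lin_ext (coact P0 P1)"
  by (simp add: word_coaction_def coact_def[abs_def])

text \<open>Path composition takes place in the first gap only; the later gaps lie to the right of
  the first marked letter and are not affected.\<close>

lemma coact_compose:
  "split_sum (\<lambda>s t. times_left (word_int a s x) (coact x b t)) w = coact a b w"
proof -
  have "split_sum (\<lambda>s t. times_left (word_int a s x) (coact x b t)) w =
      split_sum (\<lambda>s t. split_sum (\<lambda>s' t'.
        times_left (word_int a s x \<star> word_int x s' (hd (t' @ [b]))) (coact_tail b t')) t) w"
    by (simp add: coact_rec[of x] split_sum_linear[OF rat_linear_times_left] times_left_times_left)
  also have "\<dots> = split_sum (\<lambda>S t'.
      times_left (conv (\<lambda>w. word_int a w x) (\<lambda>w. word_int x w (hd (t' @ [b]))) S) (coact_tail b t')) w"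
    unfolding conv_def split_sum_linear[OF rat_linear_times_left2] split_sum_assoc ..
  also have "\<dots> = coact a b w"
    by (simp add: word_int_compose coact_rec[of a])
  finally show ?thesis .
qed

lemma coact_tail_times:
  "tensor_times (coact_tail b u) (coact_tail b v) =
     (if u = [] \<and> v = [] then basis [] \<otimes>\<^sub>Q basis [] else 0) +
     (if u = [] then 0
      else prepend_right (hd u) (tensor_times (coact (hd u) b (tl u)) (coact_tail b v))) +
     (if v = [] then 0
      else prepend_right (hd v) (tensor_times (coact_tail b u) (coact (hd v) b (tl v))))"
  by (cases u; cases v) (simp_all add: tensor_times_prepend_right)

text \<open>In the shuffle of two words the first marked letter comes from one of them, and path
  composition at that letter splits the other word.\<close>

lemma coact_shuffle: "shuffle_sum (coact a b) u v = tensor_times (coact a b u) (coact a b v)"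
proof (induction "length u + length v" arbitrary: a u v rule: less_induct)
  case less
  let ?I = "\<lambda>s x. word_int a s x"
  note L = rat_linear_times_left and L2 = rat_linear_times_left2
  define h where "h = (\<lambda>s t. times_left (?I s (hd (t @ [b]))) (coact_tail b t))"
  \<comment> \<open>A collects the terms without a marked letter. In B1 and B2 the first marked
    letter is the head of u2; B1 cuts v at that letter, as a shuffle does, and B2 cuts v at its own
    first marked letter, as the product of coactions does.\<close>
  define A where "A = (\<lambda>u1 (u2 :: letter list) v1 (v2 :: letter list). if u2 = [] \<and> v2 = []
      then times_left (?I u1 b) (times_left (?I v1 b) (coact_tail b [])) else 0)"
  define B1 where "B1 = (\<lambda>u1 u2 v1 v2. if u2 = [] then 0 else
      times_left (?I u1 (hd u2)) (times_left (?I v1 (hd u2))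
        (prepend_right (hd u2) (tensor_times (coact (hd u2) b (tl u2)) (coact (hd u2) b v2)))))"
  define B2 where "B2 = (\<lambda>u1 u2 v1 v2. if u2 = [] then 0 else
      times_left (?I u1 (hd u2)) (times_left (?I v1 (hd (v2 @ [b])))
        (prepend_right (hd u2) (tensor_times (coact (hd u2) b (tl u2)) (coact_tail b v2)))))"
  have comm: "tensor_times s t = tensor_times t s" for s t
    by (rule tensor_eqI2[of tensor_times])
      (simp_all add: rat_linear_tensor_times_left rat_linear_tensor_times_right
        shuffle_commute)
  have hom: "shuffle_sum (\<lambda>s. times_left (?I s x) X) u1 v1 =
      times_left (?I u1 x) (times_left (?I v1 x) X)" for u1 v1 x X
    using shuffle_hom_word_int[of a x]
    by (simp add: shuffle_hom_def times_left_times_left shuffle_sum_linear[OF L2])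
  have "shuffle_sum (\<lambda>s. shuffle_sum (h s) u2 v2) u1 v1 =
      A u1 u2 v1 v2 + B1 u1 u2 v1 v2 + B1 v1 v2 u1 u2"
    if "u = u1 @ u2" "v = v1 @ v2" for u1 u2 v1 v2
  proof -
    \<comment> \<open>The parts p and q after the first marked letter x are shorter, so the
      induction hypothesis turns their shuffle into a product.\<close>
    have step: "shuffle_sum (\<lambda>s. shuffle_sum (\<lambda>t. h s (x # t)) p q) u1 v1 =
        times_left (?I u1 x) (times_left (?I v1 x)
          (prepend_right x (tensor_times (coact x b p) (coact x b q))))"
      if "length p + length q < length u + length v" for p q x
    proof -
      have "shuffle_sum (\<lambda>t. h s (x # t)) p q =
          times_left (?I s x) (prepend_right x (tensor_times (coact x b p) (coact x b q)))" for s
        unfolding less.hyps[OF that, symmetric]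
        by (simp add: h_def shuffle_sum_linear[OF L] shuffle_sum_linear[OF rat_linear_prepend_right])
      then show ?thesis by (simp add: hom)
    qed
    show ?thesis
    proof (cases u2; cases v2)
      assume "u2 = []" "v2 = []"
      then show ?thesis by (simp add: A_def B1_def h_def hom del: times_left_tensor)
    next
      fix x p assume "u2 = []" "v2 = x # p"
      then show ?thesis
        using step[of "[]" p x] that
        by (simp add: A_def B1_def comm[of "coact x b []"] times_left_times_left
            shuffle_commute[of "?I u1 x"])
    next
      fix x p assume "v2 = []" "u2 = x # p"
      then show ?thesis
        using step[of p "[]" x] that by (simp add: A_def B1_def)
    next
      fix x p y q assume "u2 = x # p" "v2 = y # q"
      then show ?thesis
        using step[of p v2 x] step[of u2 q y] that
        by (simp add: A_def B1_def shuffle_sum_add comm[of "coact y b (x # p)"]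
            times_left_times_left shuffle_commute[of "?I u1 y"])
    qed
  qed
  then have 1: "shuffle_sum (coact a b) u v =
      split_sum (\<lambda>u1 u2. split_sum (\<lambda>v1 v2. A u1 u2 v1 v2) v) u +
      split_sum (\<lambda>u1 u2. split_sum (\<lambda>v1 v2. B1 u1 u2 v1 v2) v) u +
      split_sum (\<lambda>v1 v2. split_sum (\<lambda>u1 u2. B1 v1 v2 u1 u2) u) v"
    unfolding split_sum_swap[of _ v u, symmetric] split_sum_add[symmetric]
      coact_rec[of a b, abs_def, folded h_def] shuffle_sum_split_sum
    by (intro split_sum_cong)
  have "tensor_times (h u1 u2) (h v1 v2) = A u1 u2 v1 v2 + B2 u1 u2 v1 v2 + B2 v1 v2 u1 u2"
    for u1 u2 v1 v2
  proof -
    have *: "times_left l (if P then x else y) = (if P then times_left l x else times_left l y)"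
      for l P and x y :: "(word_alg, word_alg) tensor"
      by simp
    show ?thesis
      unfolding h_def tensor_times_times_left coact_tail_times rat_linear_add[OF L] *
        rat_linear_0[OF L]
      by (auto simp: A_def B2_def comm[of "coact_tail b u2"] times_left_times_left
          shuffle_commute[of "?I v1 _"])
  qed
  then have 2: "tensor_times (coact a b u) (coact a b v) =
      split_sum (\<lambda>u1 u2. split_sum (\<lambda>v1 v2. A u1 u2 v1 v2) v) u +
      split_sum (\<lambda>u1 u2. split_sum (\<lambda>v1 v2. B2 u1 u2 v1 v2) v) u +
      split_sum (\<lambda>v1 v2. split_sum (\<lambda>u1 u2. B2 v1 v2 u1 u2) u) v"
    unfolding split_sum_swap[of _ v u, symmetric] split_sum_add[symmetric]
      coact_rec[of a b, folded h_def] split_sum_linear[OF rat_linear_tensor_times_right]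
      split_sum_linear[OF rat_linear_tensor_times_left]
    by simp
  \<comment> \<open>Summed over the cuts of v, both sides are the linear map \<open>?K\<close>
    applied to \<open>coact a b v\<close>: for B1 by path composition at the head of u2, for B2 by
    the recursion.\<close>
  have "split_sum (\<lambda>v1 v2. B1 u1 u2 v1 v2) v = split_sum (\<lambda>v1 v2. B2 u1 u2 v1 v2) v" for u1 u2 v
  proof -
    let ?x = "hd u2"
    let ?K = "\<lambda>t. if u2 = [] then 0 else times_left (?I u1 ?x)
        (prepend_right ?x (tensor_times (coact ?x b (tl u2)) t))"
    have K: "rat_linear ?K"
      by (cases "u2 = []")
        (auto intro!: rat_linear_const_0 rat_linear_compose[OF rat_linear_times_left]
          rat_linear_compose[OF rat_linear_prepend_right] rat_linear_tensor_times_right)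
    have "B1 u1 u2 v1 v2 = ?K (times_left (?I v1 ?x) (coact ?x b v2))"
      "B2 u1 u2 v1 v2 = ?K (times_left (?I v1 (hd (v2 @ [b]))) (coact_tail b v2))" for v1 v2
      by (simp_all add: B1_def B2_def tensor_times_times_left times_left_prepend_right)
    then show ?thesis
      by (simp only: split_sum_linear[OF K, symmetric] coact_compose coact_rec[symmetric])
  qed
  then show ?case
    using 1 2 by simp
qed

lemma word_coaction_shuffle:
  "word_coaction (x \<star> y) = tensor_times (word_coaction x) (word_coaction y)"
proof -
  note lin = rat_linear_lin_ext rat_linear_shuffle rat_linear_compose[OF rat_linear_lin_ext]
    rat_linear_compose[OF rat_linear_tensor_times_left]
    rat_linear_compose[OF rat_linear_tensor_times_right]
  have 1: "word_coaction (basis u \<star> basis v) =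
      tensor_times (word_coaction (basis u)) (word_coaction (basis v))" for u v
    by (simp add: word_coaction_eq shuffle_basis shuffle_sum_linear[OF rat_linear_lin_ext]
        coact_shuffle)
  have 2: "word_coaction (basis u \<star> y) = tensor_times (word_coaction (basis u)) (word_coaction y)"
    for u y
    by (rule rat_linear_eqI[of "\<lambda>y. word_coaction (basis u \<star> y)"])
      (unfold word_coaction_eq, intro lin, intro lin, rule 1[unfolded word_coaction_eq])
  show ?thesis
    by (rule rat_linear_eqI[of "\<lambda>x. word_coaction (x \<star> y)"])
      (unfold word_coaction_eq, intro lin, intro lin, rule 2[unfolded word_coaction_eq])
qed

text \<open>The model is a substitution c that pulls back forms along a map such as s \<mapsto> s^2.
  The condition says that y lies over x, as far as integrals starting at 0 can tell.\<close>

definition lifts_letter :: "(letter \<Rightarrow> letter \<Rightarrow> rat) \<Rightarrow> letter \<Rightarrow> letter \<Rightarrow> bool" where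
  "lifts_letter c x y \<longleftrightarrow>
     (\<forall>s. lin_ext (\<lambda>s. int_from0 s y) (subst c s) = lin_ext (subst c) (int_from0 s x))"

lemma lin_ext_subst_sign:
  "lin_ext (\<lambda>s. (- 1) ^ length s *\<^sub>Q f s) (subst c w) = (- 1) ^ length w *\<^sub>Q lin_ext f (subst c w)"
proof (induction w arbitrary: f)
  case (Cons x w)
  have "lin_ext (\<lambda>s. (- 1) ^ length (y # s) *\<^sub>Q f (y # s)) (subst c w) =
      (- 1) ^ length (x # w) *\<^sub>Q lin_ext (\<lambda>s. f (y # s)) (subst c w)" for y
    using Cons.IH[of "\<lambda>s. (-1) *\<^sub>Q f (y # s)"]
    by (simp add: scaleQ_scaleQ lin_ext_scale_fun[of "-1", simplified])
  then show ?case
    by (simp only: lin_ext_subst_Cons) (simp add: scaleQ_add_right scaleQ_scaleQ mult.commute)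
qed simp

lemma lin_ext_subst_conv:
  "lin_ext (conv f g) (subst c w) = conv (\<lambda>s. lin_ext f (subst c s)) (\<lambda>s. lin_ext g (subst c s)) w"
proof -
  have "lin_ext (\<lambda>s. lin_ext (\<lambda>t. f s \<star> g t) y) x = lin_ext f x \<star> lin_ext g y" for x y
    unfolding rat_linear_lin_ext_swap[OF rat_linear_shuffle(1), symmetric]
      rat_linear_lin_ext_swap[OF rat_linear_shuffle(2), symmetric] ..
  then show ?thesis
    unfolding conv_def[abs_def] lin_ext_subst_split_sum by simp
qed

lemma word_int_subst:
  assumes "lifts_letter c a' a" "lifts_letter c b' b"
  shows "lin_ext (\<lambda>s. word_int a s b) (subst c w) = lin_ext (subst c) (word_int a' w b')"
proof -
  have 1: "lin_ext (\<lambda>s. int_from0 s b) (subst c s) = lin_ext (subst c) (int_from0 s b')" for s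
    using assms(2) by (simp add: lifts_letter_def)
  have 2: "lin_ext (int_to0 a) (subst c s) = lin_ext (subst c) (int_to0 a' s)" for s
    using assms(1)
    by (simp add: int_to0_def[abs_def] lin_ext_subst_sign lifts_letter_def lin_ext_scale
        lin_ext_subst_rev[of "\<lambda>s. int_from0 s a"])
  show ?thesis
    unfolding word_int_conv lin_ext_subst_conv fun_cong[OF word_int_conv[of a' b']]
      lin_ext_conv[OF shuffle_hom_subst] by (simp add: 1 2)
qed

lemma tensor_map_times_left:
  assumes "shuffle_hom f" "rat_linear g"
  shows "tensor_map (lin_ext f) g (times_left l t) = times_left (lin_ext f l) (tensor_map (lin_ext f) g t)"
proof -
  note lin = rat_linear_times_left rat_linear_tensor_map[OF rat_linear_lin_ext assms(2)]
  show ?thesis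
    by (rule tensor_eqI)
      (auto intro: lin rat_linear_compose[OF _ lin(1)] rat_linear_compose[OF lin(1)]
        rat_linear_compose[OF lin(2)] simp: shuffle_hom_lin_ext[OF assms(1)] rat_linear_lin_ext assms(2))
qed

lemma lin_ext_subst_prepend: "lin_ext (subst c) (prepend x z) = subst_letter c x (lin_ext (subst c) z)"
  by (rule rat_linear_eqI[of "\<lambda>z. lin_ext (subst c) (prepend x z)"])
    (simp_all add: rat_linear_compose rat_linear_prepend rat_linear_subst_letter rat_linear_lin_ext)

lemma tensor_map_prepend_right:
  assumes "rat_linear f"
  shows "tensor_map f (lin_ext (subst c)) (prepend_right x t) =
     tensor_map (\<lambda>x. x) (subst_letter c x) (tensor_map f (lin_ext (subst c)) t)"
  unfolding prepend_right_def
  by (subst (1 2) tensor_map_compose)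
    (simp_all add: assms rat_linear_id rat_linear_prepend rat_linear_subst_letter
      rat_linear_lin_ext lin_ext_subst_prepend)

lemma tensor_map_subst_letter:
  "tensor_map (\<lambda>x. x) (subst_letter c x) t =
     c x P0 *\<^sub>Q prepend_right P0 t + (c x P1 *\<^sub>Q prepend_right P1 t + c x Pm1 *\<^sub>Q prepend_right Pm1 t)"
  unfolding subst_letter_def[abs_def] prepend_right_def
  by (subst tensor_map_fun_add_right | subst tensor_map_fun_scale_right |
      intro rat_linear_plus rat_linear_scaleQ rat_linear_prepend rat_linear_id)+ simp

text \<open>A marked letter is an end point of the two gaps beside it. Hence every letter y that
  occurs in the image of x has to lie over x; the gaps are then handled by
  \<open>word_int_subst\<close>.\<close>

lemma coact_subst:
  assumes "lifts_letter c a' a" "lifts_letter c b' b"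
    and "\<And>x y. x \<in> set w \<Longrightarrow> c x y \<noteq> 0 \<Longrightarrow> lifts_letter c x y"
  shows "lin_ext (coact a b) (subst c w) =
     tensor_map (lin_ext (subst c)) (lin_ext (subst c)) (coact a' b' w)"
  using assms(1,3)
proof (induction "length w" arbitrary: a a' w rule: less_induct)
  case less
  let ?T = "tensor_map (lin_ext (subst c)) (lin_ext (subst c))"
  have linT: "rat_linear ?T" by (rule rat_linear_tensor_map[OF rat_linear_lin_ext rat_linear_lin_ext])
  define h where "h = (\<lambda>s t. times_left (word_int a s (hd (t @ [b]))) (coact_tail b t))"
  have T: "lin_ext (\<lambda>s. times_left (f s) X) z = times_left (lin_ext f z) X"
    for f X and z :: word_alg
    by (simp add: rat_linear_lin_ext_swap[OF rat_linear_times_left2])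
  have "lin_ext (\<lambda>s'. lin_ext (h s') (subst c t)) (subst c s) =
      ?T (times_left (word_int a' s (hd (t @ [b']))) (coact_tail b' t))" if w: "w = s @ t" for s t
  proof (cases t)
    case Nil
    then show ?thesis
      by (simp add: h_def T word_int_subst[OF less.prems(1) assms(2)] rat_linear_lin_ext
          del: times_left_tensor) (simp add: rat_linear_lin_ext)
  next
    case (Cons x v)
    let ?X = "?T (coact x b' v)"
    have y: "c x y *\<^sub>Q lin_ext (\<lambda>s'. lin_ext (\<lambda>v. h s' (y # v)) (subst c v)) (subst c s) =
       c x y *\<^sub>Q times_left (lin_ext (subst c) (word_int a' s x)) (prepend_right y ?X)" for y
    proof (cases "c x y = 0")
      case False
      then have lift: "lifts_letter c x y"
        using less.prems(2) w Cons by simp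
      have "lin_ext (coact y b) (subst c v) = ?X"
        using lift less.prems(2) w Cons by (intro less.hyps) auto
      moreover have "lin_ext (\<lambda>v. h s' (y # v)) (subst c v) =
          times_left (word_int a s' y) (prepend_right y (lin_ext (coact y b) (subst c v)))" for s'
        by (simp add: h_def rat_linear_lin_ext_swap[OF rat_linear_times_left]
            rat_linear_lin_ext_swap[OF rat_linear_prepend_right])
      ultimately show ?thesis
        by (simp add: T word_int_subst[OF less.prems(1) lift])
    qed simp
    show ?thesis
      by (simp only: Cons lin_ext_subst_Cons lin_ext_fun_add lin_ext_scale_fun y)
        (simp add: tensor_map_times_left shuffle_hom_subst rat_linear_lin_ext
          tensor_map_prepend_right tensor_map_subst_letter
          rat_linear_add[OF rat_linear_times_left] rat_linear_scale[OF rat_linear_times_left])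
  qed
  then show ?case
    unfolding coact_rec[of a b, abs_def, folded h_def] coact_rec[of a' b'] lin_ext_subst_split_sum
      split_sum_linear[OF linT] by (rule split_sum_cong)
qed

section \<open>Removal of a final 1 in the factors of the coaction\<close>

lemma drop_first_if_linear:
  "rat_linear h \<Longrightarrow> h (drop_first_if a f w) = drop_first_if a (\<lambda>w. h (f w)) w"
  by (simp add: drop_first_if_def rat_linear_0)

text \<open>A pair of adjacent equal letters, one marked and one unmarked, occurs once as the end
  and once as the beginning of a gap. These contributions cancel.\<close>

lemma remove_last_coact_left:
  "tensor_map (remove_last P1) (\<lambda>x. x) (coact a b w) =
     drop_last_if b (coact a b) w - drop_first_if a (coact a b) w"
proof (induction "length w" arbitrary: a w rule: less_induct)
  case less
  let ?T = "tensor_map (remove_last P1) (\<lambda>x. x)"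
  let ?I = "\<lambda>x s. word_int a s x"
  have linT: "rat_linear ?T"
    by (rule rat_linear_tensor_map[OF rat_linear_remove_last rat_linear_id])
  define h where "h = (\<lambda>s t. times_left (?I (hd (t @ [b])) s) (coact_tail b t))"
  \<comment> \<open>X removes the last letter of the first gap and Y the first letter of the next
    one, in both cases a letter equal to the marked letter between the gaps.\<close>
  define X where "X = (\<lambda>s t. times_left (drop_last_if (hd t) (?I (hd t)) s)
      (prepend_right (hd t) (coact (hd t) b (tl t))))"
  define Y where "Y = (\<lambda>s t. times_left (?I (hd t) s)
      (prepend_right (hd t) (drop_first_if (hd t) (coact (hd t) b) (tl t))))"
  have leib: "?T (times_left l t) = times_left (remove_last P1 l) t + times_left l (?T t)" for l t
    by (rule tensor_eqI[of "\<lambda>t. ?T (times_left l t)"])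
      (auto intro!: rat_linear_plus linT rat_linear_times_left rat_linear_compose[OF linT]
        rat_linear_compose[OF rat_linear_times_left]
        simp: rat_linear_remove_last rat_linear_id remove_last_shuffle tensor_add_left)
  have comm: "?T (prepend_right x t) = prepend_right x (?T t)" for x t
    by (rule tensor_eqI[of "\<lambda>t. ?T (prepend_right x t)"])
      (auto intro: linT rat_linear_prepend_right rat_linear_compose[OF linT]
        rat_linear_compose[OF rat_linear_prepend_right] simp: rat_linear_remove_last rat_linear_id)
  \<comment> \<open>Z removes a letter at the right end of the whole path, either in the first gap,
    if it reaches that end, or further to the right.\<close>
  define Z where "Z = (\<lambda>s t. if t = [] then times_left (drop_last_if b (?I b) s) (coact_tail b [])
      else times_left (?I (hd t) s) (prepend_right (hd t) (drop_last_if b (coact (hd t) b) (tl t))))"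
  have "?T (h s t) = (if t = [] then 0 else X s t) - (if t = [] then 0 else Y s t) + Z s t -
      drop_first_if a (\<lambda>s. h s t) s" if w: "w = s @ t" for s t
  proof (cases t)
    case Nil
    have "?T (coact_tail b []) = 0"
      by (simp add: rat_linear_remove_last rat_linear_id)
    then show ?thesis
      by (simp add: Nil h_def leib Z_def remove_last_word_int rat_linear_diff[OF rat_linear_times_left2]
          drop_first_if_linear[OF rat_linear_times_left2] rat_linear_0[OF rat_linear_times_left]
          del: coact_tail_simps times_left_tensor)
  next
    case (Cons x v)
    have "?T (coact x b v) = drop_last_if b (coact x b) v - drop_first_if x (coact x b) v"
      by (rule less) (simp add: w Cons)
    then show ?thesis
      by (simp add: Cons h_def leib comm X_def Y_def Z_def remove_last_word_int
          rat_linear_diff[OF rat_linear_times_left2] rat_linear_diff[OF rat_linear_times_left]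
          rat_linear_diff[OF rat_linear_prepend_right]
          drop_first_if_linear[OF rat_linear_times_left2])
  qed
  then have "?T (coact a b w) = split_sum (\<lambda>s t. if t = [] then 0 else X s t) w -
      split_sum (\<lambda>s t. if t = [] then 0 else Y s t) w + split_sum Z w -
      split_sum (\<lambda>s t. drop_first_if a (\<lambda>s. h s t) s) w"
    unfolding coact_rec[of a b, folded h_def] split_sum_linear[OF linT] split_sum_add[symmetric]
      split_sum_diff[symmetric] by (rule split_sum_cong)
  moreover have "split_sum (\<lambda>s t. if t = [] then 0 else X s t) w =
      split_sum (\<lambda>s t. if t = [] then 0 else Y s t) w"
  proof -
    \<comment> \<open>The common form of X and Y: two adjacent equal letters different from 0, one
      of them marked and the other one removed.\<close>
    define f where "f = (\<lambda>s t. if tl t = [] \<or> hd t \<noteq> hd (tl t) \<or> hd t = P0 then 0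
      else times_left (?I (hd t) s) (prepend_right (hd t) (coact (hd t) b (tl (tl t)))))"
    note zero = rat_linear_0[OF rat_linear_times_left] rat_linear_0[OF rat_linear_times_left2]
      rat_linear_0[OF rat_linear_prepend_right]
    have "(if t = [] then 0 else X s t) = (if s = [] then 0 else f (butlast s) (last s # t))" for s t
      by (auto simp: X_def f_def drop_last_if_def zero)
    moreover have "(if t = [] then 0 else Y s t) = (if t = [] then 0 else f s t)" for s t
      by (auto simp: Y_def f_def drop_first_if_def zero)
    ultimately show ?thesis
      by (simp only: split_sum_shift)
  qed
  moreover have "split_sum Z w = drop_last_if b (coact a b) w"
  proof (cases w rule: rev_cases)
    case Nil
    then show ?thesis
      by (simp add: Z_def drop_last_if_def rat_linear_0[OF rat_linear_times_left2]
          del: coact_tail_simps)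
  next
    case (snoc v c)
    note zero = rat_linear_0[OF rat_linear_times_left] rat_linear_0[OF rat_linear_times_left2]
      rat_linear_0[OF rat_linear_prepend_right]
    show ?thesis
    proof (cases "c = b \<and> b \<noteq> P0")
      case True
      then have "Z s (t @ [c]) = (if t = [] then 0 else h s t)" for s t
        by (cases t) (simp_all add: Z_def h_def drop_last_if_def zero)
      moreover have "Z w [] = h v []"
        using True by (simp add: Z_def h_def drop_last_if_def snoc)
      moreover note split_sum_nonempty_right[of h v]
      ultimately show ?thesis
        using True
        by (simp add: snoc split_sum_snoc drop_last_if_def coact_rec[of a b, folded h_def])
    next
      case False
      then have "Z s (t @ [c]) = 0" "Z w [] = 0" for s t
        by (cases t; auto simp: Z_def drop_last_if_def snoc zero)+
      then show ?thesis
        using False by (auto simp: snoc split_sum_snoc drop_last_if_def)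
    qed
  qed
  ultimately show ?case
    unfolding split_sum_drop_first_if by (simp add: coact_rec[of a b, abs_def, folded h_def])
qed

text \<open>The right factor is the empty word only if no letter is marked, and then the left factor
  is the whole integral.\<close>

lemma counit_coact_right:
  "tensor_map (\<lambda>x. x) (lin_ext counit) (coact a b w) = word_int a w b \<otimes>\<^sub>Q basis []"
proof -
  let ?T = "tensor_map (\<lambda>x. x) (lin_ext counit)"
  have linT: "rat_linear ?T"
    by (rule rat_linear_tensor_map[OF rat_linear_id rat_linear_lin_ext])
  have 1: "?T (times_left l (prepend_right x t)) = 0" for l x t
  proof (rule tensor_eqI[of "\<lambda>t. ?T (times_left l (prepend_right x t))"])
    show "rat_linear (\<lambda>t. ?T (times_left l (prepend_right x t)))"
      by (intro rat_linear_compose[OF linT] rat_linear_compose[OF rat_linear_times_left]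
          rat_linear_prepend_right)
  next
    show "?T (times_left l (prepend_right x (p \<otimes>\<^sub>Q q))) = 0" for p q
      using rat_linear_eqI[OF rat_linear_compose[OF rat_linear_lin_ext rat_linear_prepend]
          rat_linear_const_0, of counit x q]
      by (simp add: rat_linear_id rat_linear_lin_ext counit_def)
  qed (rule rat_linear_const_0)
  have "?T (coact a b w) =
      split_sum (\<lambda>s t. if t = [] then word_int a s b \<otimes>\<^sub>Q basis [] else 0) w"
    unfolding coact_rec[of a] split_sum_linear[OF linT]
  proof (rule split_sum_cong)
    fix s t show "?T (times_left (word_int a s (hd (t @ [b]))) (coact_tail b t)) =
        (if t = [] then word_int a s b \<otimes>\<^sub>Q basis [] else 0)"
      by (cases t) (simp_all add: 1 rat_linear_id rat_linear_lin_ext counit_def)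
  qed
  also have "\<dots> = word_int a w b \<otimes>\<^sub>Q basis []"
    by (cases w rule: rev_cases) (simp_all add: split_sum_snoc)
  finally show ?thesis .
qed

text \<open>A marked letter 1 that comes last on the right is followed by a gap from 1 to 1. Such a
  gap vanishes unless it is empty, so the marked letter is the last one of w.\<close>

lemma remove_last_coact_right:
  "tensor_map (\<lambda>x. x) (remove_last P1) (coact a P1 w) = drop_last_if P1 (coact a P1) w"
proof (induction "length w" arbitrary: a w rule: less_induct)
  case less
  let ?T = "tensor_map (\<lambda>x. x) (remove_last P1)"
  let ?I = "\<lambda>x s. word_int a s x"
  note zero = rat_linear_0[OF rat_linear_times_left] rat_linear_0[OF rat_linear_times_left2]
    rat_linear_0[OF rat_linear_prepend_right]
  have linT: "rat_linear ?T"
    by (rule rat_linear_tensor_map[OF rat_linear_id rat_linear_remove_last])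
  define h where "h = (\<lambda>s t. times_left (?I (hd (t @ [P1])) s) (coact_tail P1 t))"
  \<comment> \<open>The second summand is the case in which the removed letter is the only marked
    one; its last gap is empty, so t consists of that letter.\<close>
  define Z where "Z = (\<lambda>s t. if t = [] then 0 else
      times_left (?I (hd t) s) (prepend_right (hd t) (drop_last_if P1 (coact (hd t) P1) (tl t))) +
      (if t = [P1] then times_left (?I P1 s) (coact_tail P1 []) else 0))"
  have left: "?T (times_left l t) = times_left l (?T t)" for l t
    by (rule tensor_eqI[of "\<lambda>t. ?T (times_left l t)"])
      (auto intro: linT rat_linear_times_left rat_linear_compose[OF linT]
        rat_linear_compose[OF rat_linear_times_left] simp: rat_linear_remove_last rat_linear_id)
  have pre: "remove_last P1 (prepend x z) =
      prepend x (remove_last P1 z) + (if x = P1 then lin_ext counit z else 0)" for x z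
    by (cases "x = P1"; rule rat_linear_eqI[of "\<lambda>z. remove_last P1 (prepend x z)"])
      (auto intro!: rat_linear_plus rat_linear_compose[OF rat_linear_remove_last]
        rat_linear_compose[OF rat_linear_prepend] rat_linear_prepend rat_linear_remove_last
        rat_linear_lin_ext rat_linear_const_0
        simp: counit_def rat_linear_0[OF rat_linear_prepend])
  have right: "?T (prepend_right x t) = prepend_right x (?T t) +
      (if x = P1 then tensor_map (\<lambda>x. x) (lin_ext counit) t else 0)" for x t
    by (cases "x = P1"; rule tensor_eqI[of "\<lambda>t. ?T (prepend_right x t)"])
      (auto intro!: rat_linear_plus linT rat_linear_prepend_right rat_linear_compose[OF linT]
        rat_linear_compose[OF rat_linear_prepend_right] rat_linear_const_0
        rat_linear_tensor_map rat_linear_lin_ext rat_linear_id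
        simp: rat_linear_remove_last rat_linear_id rat_linear_lin_ext pre tensor_add_right)
  have "?T (h s t) = Z s t" if w: "w = s @ t" for s t
  proof (cases t)
    case Nil
    then show ?thesis
      by (simp add: h_def Z_def rat_linear_remove_last rat_linear_id)
  next
    case (Cons x v)
    have "?T (coact x P1 v) = drop_last_if P1 (coact x P1) v"
      by (rule less) (simp add: w Cons)
    then show ?thesis
      by (auto simp: Cons h_def Z_def left right counit_coact_right word_int_same counit_def
          rat_linear_add[OF rat_linear_times_left] zero)
  qed
  then have "?T (coact a P1 w) = split_sum Z w"
    unfolding coact_rec[of a P1, folded h_def] split_sum_linear[OF linT] by (rule split_sum_cong)
  also have "\<dots> = drop_last_if P1 (coact a P1) w"
  proof (cases w rule: rev_cases)
    case Nil
    then show ?thesis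
      by (simp add: Z_def drop_last_if_def)
  next
    case (snoc v c)
    have "Z w [] = 0" by (simp add: Z_def)
    moreover have "Z s (t @ [c]) = (if c = P1 then h s t else 0)" for s t
      by (cases t) (auto simp: Z_def h_def drop_last_if_def zero)
    ultimately show ?thesis
      by (auto simp: snoc split_sum_snoc drop_last_if_def coact_rec[of a P1, folded h_def])
  qed
  finally show ?case .
qed

section \<open>Regularisation\<close>

definition supported :: "('k \<Rightarrow> bool) \<Rightarrow> ('k \<Rightarrow>\<^sub>0 rat) \<Rightarrow> bool" where
  "supported Q x \<longleftrightarrow> (\<forall>k\<in>Poly_Mapping.keys x. Q k)"

lemma supported_zero [simp]: "supported Q 0"
  and supported_basis [simp]: "supported Q (basis k) \<longleftrightarrow> Q k"
  and supported_add: "supported Q x \<Longrightarrow> supported Q y \<Longrightarrow> supported Q (x + y)"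
  and supported_diff: "supported Q x \<Longrightarrow> supported Q y \<Longrightarrow> supported Q (x - y)"
  and supported_scale: "supported Q x \<Longrightarrow> supported Q (c *\<^sub>Q x)"
  by (auto simp: supported_def in_keys_iff lookup_scaleQ scaleQ_rat_def lookup_add lookup_minus
      lookup_single)

lemma supported_mono: "supported Q x \<Longrightarrow> (\<And>k. Q k \<Longrightarrow> R k) \<Longrightarrow> supported R x"
  by (auto simp: supported_def)

lemma supported_sum: "(\<And>i. i \<in> I \<Longrightarrow> supported Q (f i)) \<Longrightarrow> supported Q (sum f I)"
  by (induction I rule: infinite_finite_induct) (auto intro: supported_add)

lemma supported_lin_ext:
  "supported Q x \<Longrightarrow> (\<And>k. Q k \<Longrightarrow> supported R (f k)) \<Longrightarrow> supported R (lin_ext f x)"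
  unfolding lin_ext_def by (rule supported_sum) (auto simp: supported_def[of Q] intro: supported_scale)

lemma supported_split_sum:
  "(\<And>s t. w = s @ t \<Longrightarrow> supported Q (f s t)) \<Longrightarrow> supported Q (split_sum f w)"
  unfolding split_sum_take_drop[symmetric] by (rule supported_sum) simp

lemma supported_shuffle:
  assumes "supported Q x" "supported R y"
    and "\<And>u v w. Q u \<Longrightarrow> R v \<Longrightarrow> w \<in> set (shuffle_list u v) \<Longrightarrow> S w"
  shows "supported S (x \<star> y)"
proof -
  have "supported S (\<Sum>w\<leftarrow>ws. basis w)" if "\<forall>w\<in>set ws. S w" for ws
    using that by (induction ws) (auto intro: supported_add)
  then show ?thesis
    unfolding shuffle_mult_def using assms(3)
    by (intro supported_lin_ext[OF assms(1)] supported_lin_ext[OF assms(2)]) blast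
qed

lemma supported_induct:
  assumes "supported Q x" "P 0" "\<And>x y. P x \<Longrightarrow> P y \<Longrightarrow> P (x + y)" "\<And>c x. P x \<Longrightarrow> P (c *\<^sub>Q x)"
    "\<And>k. Q k \<Longrightarrow> P (basis k)"
  shows "P x"
proof -
  have "P (\<Sum>k\<in>K. Poly_Mapping.lookup x k *\<^sub>Q basis k)" if "K \<subseteq> Poly_Mapping.keys x" for K
    using finite_subset[OF that finite_keys] that assms
    by (induction K rule: finite_induct) (auto simp: supported_def)
  from this[of "Poly_Mapping.keys x"] show ?thesis
    using lin_ext_id[of x] by (simp add: lin_ext_def)
qed

lemma set_shuffle_list: "w \<in> set (shuffle_list u v) \<Longrightarrow> set w = set u \<union> set v"
  by (induction u v arbitrary: w rule: shuffle_list.induct) auto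

lemma shuffle_list_Nil_iff: "[] \<in> set (shuffle_list u v) \<longleftrightarrow> u = [] \<and> v = []"
  by (induction u v rule: shuffle_list.induct) auto

lemma last_shuffle_list:
  "w \<in> set (shuffle_list u v) \<Longrightarrow> w \<noteq> [] \<Longrightarrow>
    (u \<noteq> [] \<and> last w = last u) \<or> (v \<noteq> [] \<and> last w = last v)"
proof (induction u v arbitrary: w rule: shuffle_list.induct)
  case (3 a u b v)
  then obtain w' where "w = a # w' \<and> w' \<in> set (shuffle_list u (b # v)) \<or>
      w = b # w' \<and> w' \<in> set (shuffle_list (a # u) v)"
    by auto
  then show ?case
  proof
    assume *: "w = a # w' \<and> w' \<in> set (shuffle_list u (b # v))"
    then have "w' \<noteq> []" by (auto simp: shuffle_list_Nil_iff)
    then show ?thesis using * 3(1)[of w'] by auto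
  next
    assume *: "w = b # w' \<and> w' \<in> set (shuffle_list (a # u) v)"
    then have "w' \<noteq> []" by (auto simp: shuffle_list_Nil_iff)
    then show ?thesis using * 3(2)[of w'] by auto
  qed
qed auto

lemma hd_shuffle_list:
  "w \<in> set (shuffle_list u v) \<Longrightarrow> w \<noteq> [] \<Longrightarrow>
    (u \<noteq> [] \<and> hd w = hd u) \<or> (v \<noteq> [] \<and> hd w = hd v)"
  by (cases u; cases v) auto

text \<open>The word \<open>a\<^sup>n\<close> is the \<open>n\<close>-th divided power of the letter \<open>a\<close>. Hence convolution of the
  identity with the following homomorphism is \<open>exp (- a \<partial>)\<close> for the derivation \<open>\<partial>\<close> which
  removes a final letter \<open>a\<close>, and projects onto the kernel of \<open>\<partial>\<close>.\<close>

definition negate_only :: "letter \<Rightarrow> letter list \<Rightarrow> word_alg" where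
  "negate_only a w = (if set w \<subseteq> {a} then (- 1) ^ length w *\<^sub>Q basis w else 0)"

lemma negate_only_simps [simp]:
  "negate_only a [] = basis []"
  "negate_only a (x # w) = (if x = a then - prepend a (negate_only a w) else 0)"
  by (auto simp: negate_only_def scaleQ_one rat_linear_scale[OF rat_linear_prepend]
      rat_linear_0[OF rat_linear_prepend])

lemma shuffle_hom_negate_only: "shuffle_hom (negate_only a)"
proof -
  have "negate_only a w = subst (\<lambda>x y. if x = a \<and> y = a then - 1 else 0) w" for w
    by (induction w) (cases a; simp add: subst_letter_def scaleQ_one)+
  then have "negate_only a = subst (\<lambda>x y. if x = a \<and> y = a then - 1 else 0)" ..
  then show ?thesis by (simp only: shuffle_hom_subst)
qed

lemma remove_last_negate_only:
  "remove_last a (negate_only a t) = (if t = [] then 0 else if hd t = a then - negate_only a (tl t) else 0)"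
proof (cases "set t \<subseteq> {a}")
  case True
  then have "t = replicate (length t) a"
    by (simp add: replicate_length_same subset_eq)
  then obtain n where t: "t = replicate n a" ..
  have butlast_replicate: "butlast (replicate (Suc m) a) = replicate m a" for m
    by (metis butlast_snoc replicate_append_same replicate_Suc)
  show ?thesis
    by (cases n) (simp_all add: t negate_only_def rat_linear_neg[OF rat_linear_remove_last]
        rat_linear_scale[OF rat_linear_remove_last] butlast_replicate set_replicate_conv_if
        del: replicate_Suc flip: replicate_Suc)
next
  case False
  then show ?thesis
    by (cases t) (auto simp: negate_only_def rat_linear_0[OF rat_linear_remove_last])
qed

text \<open>By the Leibniz rule an a is taken from the end of s or from t. All letters of t are
  equal, so it may be taken from the front; the two kinds of terms differ by a shift of the cut and
  have opposite signs.\<close>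

lemma remove_last_conv_negate_only: "remove_last a (conv basis (negate_only a) w) = 0"
proof -
  define f where "f = (\<lambda>s t. if hd t = a then basis s \<star> negate_only a (tl t) else 0)"
  have "remove_last a (conv basis (negate_only a) w) =
      split_sum (\<lambda>s t. if s = [] then 0 else f (butlast s) (last s # t)) w -
      split_sum (\<lambda>s t. if t = [] then 0 else f s t) w"
    unfolding conv_def split_sum_linear[OF rat_linear_remove_last] split_sum_diff[symmetric]
  proof (rule split_sum_cong)
    fix s t
    show "remove_last a (basis s \<star> negate_only a t) =
        (if s = [] then 0 else f (butlast s) (last s # t)) - (if t = [] then 0 else f s t)"
      unfolding remove_last_shuffle remove_last_negate_only
      by (cases "s = []"; cases "t = []"; cases "hd t = a"; cases "last s = a")
        (simp_all add: f_def rat_linear_neg[OF rat_linear_shuffle(1)])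
  qed
  then show ?thesis by (simp add: split_sum_shift)
qed

lemma supported_remove_last:
  assumes "remove_last a x = 0"
  shows "supported (\<lambda>w. w = [] \<or> last w \<noteq> a) x"
proof -
  have lin: "rat_linear (\<lambda>x. Poly_Mapping.lookup x k)" for k :: "letter list"
    by (rule rat_linearI) (simp_all add: lookup_add lookup_scaleQ)
  have *: "Poly_Mapping.lookup (remove_last a x) v = Poly_Mapping.lookup x (v @ [a])" for v
  proof (rule rat_linear_eqI[of "\<lambda>x. Poly_Mapping.lookup (remove_last a x) v"])
    show "Poly_Mapping.lookup (remove_last a (basis w)) v = Poly_Mapping.lookup (basis w) (v @ [a])"
      for w
      by (cases w rule: rev_cases) (auto simp: lookup_single)
  qed (rule rat_linear_compose[OF lin rat_linear_remove_last], rule lin)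
  have zero: "Poly_Mapping.lookup x (v @ [a]) = 0" for v
    unfolding *[symmetric] assms by (rule lookup_zero)
  show ?thesis
    unfolding supported_def keys.rep_eq
  proof (intro ballI)
    fix k assume "k \<in> {k. Poly_Mapping.lookup x k \<noteq> 0}"
    then show "k = [] \<or> last k \<noteq> a"
      using zero by (cases k rule: rev_cases) auto
  qed
qed

text \<open>The clause on the head guarantees that regularising at the end point 1 creates no
  leading 0.\<close>

lemma supported_conv_negate_only_right:
  "supported (\<lambda>v. (v = [] \<or> last v \<noteq> a) \<and> set v \<subseteq> set w \<and>
     (v = [] \<or> hd v \<in> {hd w, a})) (conv basis (negate_only a) w)"
proof -
  have "supported (\<lambda>v. set v \<subseteq> set w \<and> (v = [] \<or> hd v \<in> {hd w, a})) (conv basis (negate_only a) w)"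
    unfolding conv_def
  proof (rule supported_split_sum)
    fix s t assume w: "w = s @ t"
    have 1: "supported (\<lambda>u. u = s) (basis s)" by simp
    have 2: "supported (\<lambda>v. v = t \<and> (v = [] \<or> hd v = a)) (negate_only a t)"
    proof (cases "set t \<subseteq> {a}")
      case True
      then have "t = [] \<or> hd t = a" using hd_in_set by fastforce
      then show ?thesis by (auto simp: negate_only_def intro: supported_scale)
    qed (simp add: negate_only_def)
    show "supported (\<lambda>v. set v \<subseteq> set w \<and> (v = [] \<or> hd v \<in> {hd w, a})) (basis s \<star> negate_only a t)"
    proof (rule supported_shuffle[OF 1 2], clarify)
      fix v assume "v \<in> set (shuffle_list s t)" "t = [] \<or> hd t = a"
      then show "set v \<subseteq> set w \<and> (v = [] \<or> hd v \<in> {hd w, a})"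
        using hd_shuffle_list[of v s t] set_shuffle_list[of v s t] by (auto simp: w)
    qed
  qed
  moreover note supported_remove_last[OF remove_last_conv_negate_only, of a w]
  ultimately show ?thesis by (auto simp: supported_def)
qed

lemma supported_conv_negate_only_left:
  "supported (\<lambda>v. (v = [] \<or> hd v \<noteq> a) \<and> set v \<subseteq> set w) (conv (negate_only a) basis w)"
proof -
  let ?R = "lin_ext (\<lambda>w. basis (rev w))"
  have R: "?R (?R x) = x" for x :: word_alg
    by (rule rat_linear_eqI[of "\<lambda>x. ?R (?R x)"])
      (simp_all add: rat_linear_compose[OF rat_linear_lin_ext] rat_linear_lin_ext rat_linear_id)
  have neg: "?R (negate_only a s) = negate_only a (rev s)" for s
    by (simp add: negate_only_def lin_ext_scale)
  have "?R (conv (negate_only a) basis w) = conv basis (negate_only a) (rev w)"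
    unfolding lin_ext_conv[OF shuffle_hom_rev[OF shuffle_hom_basis]]
    by (simp add: conv_def split_sum_rev neg shuffle_commute)
  then have "conv (negate_only a) basis w = ?R (conv basis (negate_only a) (rev w))"
    using R by metis
  also have "supported (\<lambda>v. (v = [] \<or> hd v \<noteq> a) \<and> set v \<subseteq> set w) \<dots>"
    by (rule supported_lin_ext[OF supported_conv_negate_only_right]) (auto simp: hd_rev)
  finally show ?thesis .
qed

text \<open>Shuffle regularisation with both letters 0 and 1 sent to zero. Leading zeros are treated
  first; the later treatment of final ones does not bring them back.\<close>

definition regularise :: "letter list \<Rightarrow> word_alg" where
  "regularise w = lin_ext (conv basis (negate_only P1)) (conv (negate_only P0) basis w)"

lemma shuffle_hom_regularise: "shuffle_hom regularise"
  unfolding regularise_def[abs_def]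
  by (intro shuffle_hom_compose shuffle_hom_conv shuffle_hom_basis shuffle_hom_negate_only)

lemma supported_regularise: "supported convergent_word (regularise w)"
  unfolding regularise_def
proof (rule supported_lin_ext[OF supported_conv_negate_only_left])
  fix k :: "letter list" assume "(k = [] \<or> hd k \<noteq> P0) \<and> set k \<subseteq> set w"
  then show "supported convergent_word (conv basis (negate_only P1) k)"
    using supported_conv_negate_only_right[of P1 k]
    by (auto simp: supported_def convergent_word_def conv_def)
qed

lemma conv_negate_only_right_eq:
  assumes "w = [] \<or> last w \<noteq> a"
  shows "conv basis (negate_only a) w = basis w"
proof (cases w rule: rev_cases)
  case (snoc v x)
  have "negate_only a (t @ [x]) = 0" for t
    using assms snoc by (auto simp: negate_only_def)
  then show ?thesis by (simp add: snoc conv_def split_sum_snoc)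
qed (simp add: conv_def)

lemma conv_negate_only_left_eq:
  assumes "w = [] \<or> hd w \<noteq> a"
  shows "conv (negate_only a) basis w = basis w"
  using assms by (cases w) (simp_all add: conv_def)

lemma regularise_convergent: "convergent_word w \<Longrightarrow> regularise w = basis w"
  by (auto simp: regularise_def convergent_word_def conv_negate_only_left_eq
      conv_negate_only_right_eq)

lemma basis_shuffle_replicate:
  "basis [a] \<star> basis (replicate n a) = of_nat (Suc n) *\<^sub>Q basis (replicate (Suc n) a)"
proof (induction n)
  case (Suc n)
  then show ?case
    using prepend_shuffle[of a "basis []" a "basis (replicate n a)"]
    by (simp add: rat_linear_scale[OF rat_linear_prepend] rat_linear_add[OF rat_linear_prepend]
        scaleQ_add_left scaleQ_one scaleQ_add_left[of 1 1, simplified])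
qed (simp add: scaleQ_one)

text \<open>A regularised word is a combination of convergent words and differs from the word itself
  by products of shorter words with powers of a letter. The alphabet A is kept because the
  distribution relation concerns words in 0 and 1 only.\<close>

lemma word_algebra_induct:
  assumes P: "\<And>x y. P x \<Longrightarrow> P y \<Longrightarrow> P (x + y)" "\<And>c x. P x \<Longrightarrow> P (c *\<^sub>Q x)"
    "\<And>x y. P x \<Longrightarrow> P y \<Longrightarrow> P (x \<star> y)"
    and P01: "P (basis [P0])" "P (basis [P1])"
    and conv: "\<And>w. set w \<subseteq> A \<Longrightarrow> convergent_word w \<Longrightarrow> P (basis w)"
    and A: "set w \<subseteq> A"
  shows "P (basis w)"
proof -
  have 0: "P 0" and one: "P (basis [])"
    using P(2)[OF P01(1), of 0] conv[of "[]"] by (simp_all add: convergent_word_def)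
  have neg: "P x \<Longrightarrow> P (- x)" for x
    using P(2)[of x "-1"] by (simp add: scaleQ_one)
  have minus: "P x \<Longrightarrow> P y \<Longrightarrow> P (x - y)" for x y
    using P(1)[of x "- y"] neg[of y] by simp
  have sum: "(\<And>s t. w = s @ t \<Longrightarrow> P (f s t)) \<Longrightarrow> P (split_sum f w)" for f w
  proof (induction w arbitrary: f)
    case (Cons x w)
    show ?case
      using Cons.prems[of "[]"] by (auto intro!: P(1) Cons.IH Cons.prems)
  qed simp
  \<comment> \<open>The word a^n is the n-th shuffle power of the letter a divided by n!, which uses
    rational scalars.\<close>
  have neg_only: "P (negate_only a w)" if "P (basis [a])" for a w
  proof -
    have "P (basis (replicate n a))" for n
    proof (induction n)
      case (Suc n)
      then have "P ((1 / of_nat (Suc n)) *\<^sub>Q (basis [a] \<star> basis (replicate n a)))"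
        using that P by blast
      then show ?case
        by (simp add: basis_shuffle_replicate scaleQ_scaleQ scaleQ_one del: of_nat_Suc)
    qed (use one in simp)
    from this[of "length w"] have "P (basis w)" if "set w \<subseteq> {a}"
      using that by (simp add: replicate_length_same subset_eq)
    then show ?thesis
      by (simp add: negate_only_def 0 P(2))
  qed
  \<comment> \<open>Words that do not begin with 0 come first: only their final ones have to be
    removed.\<close>
  have stage1: "P (basis w)" if "set w \<subseteq> A" "w = [] \<or> hd w \<noteq> P0" for w
    using that
  proof (induction "length w" arbitrary: w rule: less_induct)
    case less
    let ?f = "\<lambda>s t. basis s \<star> negate_only P1 t"
    have "P (conv basis (negate_only P1) w)"
    proof (rule supported_induct[OF supported_conv_negate_only_right 0 P(1,2)])
      fix v assume "(v = [] \<or> last v \<noteq> P1) \<and> set v \<subseteq> set w \<and> (v = [] \<or> hd v \<in> {hd w, P1})"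
      then show "P (basis v)"
        using less.prems by (intro conv) (auto simp: convergent_word_def)
    qed
    moreover have "P (split_sum (\<lambda>s t. if t = [] then 0 else ?f s t) w)"
    proof (rule sum)
      fix s t assume w: "w = s @ t"
      show "P (if t = [] then 0 else ?f s t)"
        using less.prems w by (cases s) (auto simp: 0 intro!: P(3) less.hyps neg_only P01)
    qed
    moreover have "basis w = conv basis (negate_only P1) w -
        split_sum (\<lambda>s t. if t = [] then 0 else ?f s t) w"
      by (simp add: conv_def split_sum_nonempty_right[symmetric, of ?f])
    ultimately show ?case
      by (simp only: minus)
  qed
  show ?thesis
    using A
  proof (induction "length w" arbitrary: w rule: less_induct)
    case less
    show ?case
    proof (cases w)
      case (Cons x v)
      let ?f = "\<lambda>s t. negate_only P0 s \<star> basis t"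
      have "P (conv (negate_only P0) basis w)"
        by (rule supported_induct[OF supported_conv_negate_only_left 0 P(1,2)])
          (use less.prems in \<open>auto intro: stage1\<close>)
      moreover have "P (split_sum (\<lambda>s. ?f (x # s)) v)"
        using less.prems by (intro sum P(3) neg_only P01 less.hyps) (auto simp: Cons)
      moreover have "basis w = conv (negate_only P0) basis w - split_sum (\<lambda>s. ?f (x # s)) v"
        by (simp add: conv_def Cons)
      ultimately show ?thesis
        by (simp only: minus)
    qed (simp add: one)
  qed
qed

section \<open>Iterated integrals\<close>

text \<open>This makes \<open>period\<close> a rational linear map and lets \<open>lin_ext\<close>
  take real values.\<close>

instantiation real :: rat_vector
begin
definition scaleQ_real :: "rat \<Rightarrow> real \<Rightarrow> real" where "scaleQ_real c x = of_rat c * x"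
instance
  by standard (simp_all add: scaleQ_real_def algebra_simps of_rat_add of_rat_mult)
end

text \<open>Convergence at 0, for reversed words as read by \<open>iter_int_rev\<close>: their last
  letter belongs to the smallest variable.\<close>

definition starts_nonzero :: "letter list \<Rightarrow> bool" where
  "starts_nonzero w \<longleftrightarrow> w = [] \<or> last w \<noteq> P0"

lemma starts_nonzero_tl: "starts_nonzero (x # w) \<Longrightarrow> starts_nonzero w"
  by (auto simp: starts_nonzero_def split: if_splits)

lemma letter_val_ne: "0 \<le> s \<Longrightarrow> s < 1 \<Longrightarrow> x \<noteq> P0 \<Longrightarrow> s - letter_val x \<noteq> 0"
  by (cases x) auto

text \<open>A function vanishing at 0 to first order can be divided by \<open>s\<close>, so the integrand extends
  continuously to 0.\<close>

lemma iter_int_rev_integrand: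
  assumes "0 < b" "b < 1" "starts_nonzero w" "w \<noteq> []"
  shows "\<exists>g. continuous_on {0..b} g \<and>
    (\<forall>s\<in>{0<..b}. g s = iter_int_rev (tl w) s / (s - letter_val (hd w))) \<and>
    (\<forall>t\<in>{0..b}. iter_int_rev w t = integral {0..t} g)"
  using assms(3,4)
proof (induction w)
  case (Cons x v)
  have prev: "\<exists>g. continuous_on {0..b} g \<and> (\<forall>t\<in>{0..b}. iter_int_rev v t = integral {0..t} g)"
    if "v \<noteq> []"
    using Cons.IH[OF starts_nonzero_tl[OF Cons.prems(1)] that] by blast
  show ?case
  proof (cases "x = P0")
    case True
    then have "v \<noteq> []"
      using Cons.prems by (auto simp: starts_nonzero_def)
    then obtain g where g: "continuous_on {0..b} g"
        "\<And>t. t \<in> {0..b} \<Longrightarrow> iter_int_rev v t = integral {0..t} g"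
      using prev by blast
    let ?G = "\<lambda>t. integral {0..t} g"
    have deriv: "(?G has_real_derivative g t) (at t within {0..b})" if "t \<in> {0..b}" for t
      by (rule integral_has_real_derivative[OF g(1) that])
    define h where "h = (\<lambda>s. if s = 0 then g 0 else ?G s / s)"
    have "continuous_on {0..b} h"
      unfolding continuous_on_def
    proof
      fix s assume s: "s \<in> {0..b}"
      show "(h \<longlongrightarrow> h s) (at s within {0..b})"
      proof (cases "s = 0")
        case True
        have "((\<lambda>y. (?G y - ?G 0) / (y - 0)) \<longlongrightarrow> g 0) (at 0 within {0..b})"
          using deriv[of 0] assms(1) by (simp add: has_field_derivative_iff)
        moreover have "eventually (\<lambda>y. (?G y - ?G 0) / (y - 0) = h y) (at 0 within {0..b})"
          by (simp add: h_def eventually_at_filter)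
        ultimately have "(h \<longlongrightarrow> g 0) (at 0 within {0..b})"
          by (rule Lim_transform_eventually)
        then show ?thesis
          by (simp add: True h_def)
      next
        case False
        have "((\<lambda>y. ?G y / y) \<longlongrightarrow> ?G s / s) (at s within {0..b})"
          using deriv[OF s] False
          by (intro tendsto_divide tendsto_ident_at)
            (auto dest!: DERIV_continuous simp: continuous_within)
        moreover have "eventually (\<lambda>y. ?G y / y = h y) (at s within {0..b})"
          using tendsto_imp_eventually_ne[OF tendsto_ident_at False]
          by (rule eventually_mono) (simp add: h_def)
        ultimately show ?thesis
          using False by (auto simp: h_def[of] intro: Lim_transform_eventually)
      qed
    qed
    moreover have "\<forall>s\<in>{0<..b}. h s = iter_int_rev v s / (s - letter_val P0)"
      by (simp add: h_def g(2))
    moreover have "iter_int_rev (x # v) t = integral {0..t} h" if "t \<in> {0..b}" for t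
      unfolding iter_int_rev.simps True
      by (rule integral_spike[of "{0}"]) (use that in \<open>auto simp: h_def g(2)\<close>)
    ultimately show ?thesis
      unfolding True by auto
  next
    case False
    have "continuous_on {0..b} (iter_int_rev v)"
    proof (cases "v = []")
      case True
      then show ?thesis by simp
    next
      case False
      then obtain g where g: "continuous_on {0..b} g"
        "\<And>t. t \<in> {0..b} \<Longrightarrow> iter_int_rev v t = integral {0..t} g"
        using prev by blast
      show ?thesis
        using indefinite_integral_continuous_1[OF integrable_continuous_real[OF g(1)]]
        by (rule continuous_on_eq) (simp add: g(2))
    qed
    then have "continuous_on {0..b} (\<lambda>s. iter_int_rev v s / (s - letter_val x))"
      using False assms(1,2) by (intro continuous_intros) (auto dest!: letter_val_ne)
    then show ?thesis by auto
  qed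
qed simp

lemma iter_int_rev_0: "w \<noteq> [] \<Longrightarrow> iter_int_rev w 0 = 0"
  by (cases w) simp_all

lemma continuous_on_iter_int_rev:
  assumes "starts_nonzero w" "b < 1"
  shows "continuous_on {0..b} (iter_int_rev w)"
proof (cases "w = [] \<or> b \<le> 0")
  case True
  then consider "w = []" | "b < 0" | "b = 0" by linarith
  then show ?thesis by cases simp_all
next
  case False
  then obtain g where g: "continuous_on {0..b} g"
        "\<And>t. t \<in> {0..b} \<Longrightarrow> iter_int_rev w t = integral {0..t} g"
    using iter_int_rev_integrand[of b w] assms by auto
  show ?thesis
    using indefinite_integral_continuous_1[OF integrable_continuous_real[OF g(1)]]
    by (rule continuous_on_eq) (simp add: g(2))
qed

lemma DERIV_iter_int_rev:
  assumes "starts_nonzero (x # w)" "0 < t" "t < 1"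
  shows "(iter_int_rev (x # w) has_real_derivative iter_int_rev w t / (t - letter_val x)) (at t)"
proof -
  define b where "b = (t + 1) / 2"
  have b: "0 < b" "b < 1" "t < b" using assms by (simp_all add: b_def)
  obtain g where g: "continuous_on {0..b} g"
    "g t = iter_int_rev w t / (t - letter_val x)"
    "\<And>t. t \<in> {0..b} \<Longrightarrow> iter_int_rev (x # w) t = integral {0..t} g"
    using iter_int_rev_integrand[OF b(1,2) assms(1)] b assms(2) by auto
  have "((\<lambda>t. integral {0..t} g) has_real_derivative g t) (at t within {0..b})"
    by (rule integral_has_real_derivative[OF g(1)]) (use b assms in auto)
  then have "(iter_int_rev (x # w) has_real_derivative g t) (at t within {0..b})"
    by (rule has_field_derivative_transform_within[where d=1]) (use b assms g(3) in auto)
  moreover have "at t within {0..b} = at t"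
    using b assms by (intro at_within_interior) auto
  ultimately show ?thesis
    by (simp add: g(2))
qed

text \<open>The true growth at 1 is at most a power of a logarithm. The cruder 1/sqrt(1 - t) is
  integrable and reproduces itself: division by 1 - s gives (1 - s)^(-3/2), whose primitive is
  2/sqrt(1 - s).\<close>

lemma iter_int_rev_bound:
  assumes "starts_nonzero w"
  shows "\<exists>C\<ge>0. \<forall>t\<in>{0..<1}. \<bar>iter_int_rev w t\<bar> \<le> C / sqrt (1 - t)"
  using assms
proof (induction w)
  case Nil
  have "1 \<le> 1 / sqrt (1 - t)" if "0 \<le> t" "t < 1" for t :: real
    using that by simp
  then show ?case by (intro exI[of _ 1]) auto
next
  case (Cons x v)
  then obtain C where C: "C \<ge> 0" "\<And>t. 0 \<le> t \<Longrightarrow> t < 1 \<Longrightarrow> \<bar>iter_int_rev v t\<bar> \<le> C / sqrt (1 - t)"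
    using starts_nonzero_tl by force
  obtain g0 where g0: "continuous_on {0..1/2} g0"
    "\<And>t. t \<in> {0<..1/2} \<Longrightarrow> g0 t = iter_int_rev v t / (t - letter_val x)"
    using iter_int_rev_integrand[of "1/2" "x # v"] Cons.prems by auto
  obtain K where "\<forall>y\<in>g0 ` {0..1/2}. \<bar>y\<bar> \<le> K"
    using compact_imp_bounded[OF compact_continuous_image[OF g0(1) compact_Icc]]
    unfolding bounded_real by blast
  then have K: "\<bar>g0 s\<bar> \<le> K" if "s \<in> {0..1/2}" for s
    using that by blast
  have K0: "K \<ge> 0" using K[of 0] by auto
  \<comment> \<open>K bounds the integrand up to 1/2; from there on the kernel is at most 2/(1 - s),
    which gives 2 C.\<close>
  define B where "B = K + 2 * C"
  have B: "B \<ge> 0" using K0 C(1) by (simp add: B_def)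
  have ge1: "1 \<le> 1 / ((1 - s) * sqrt (1 - s))" if "0 \<le> s" "s < 1" for s :: real
  proof -
    have "(1 - s) * sqrt (1 - s) \<le> 1 * 1"
      using that by (intro mult_mono) auto
    then show ?thesis using that by (simp add: field_simps)
  qed
  have bound: "\<bar>iter_int_rev v s / (s - letter_val x)\<bar> \<le> B / ((1 - s) * sqrt (1 - s))"
    if s: "0 < s" "s < 1" for s
  proof (cases "s \<le> 1 / 2")
    case True
    have "\<bar>iter_int_rev v s / (s - letter_val x)\<bar> \<le> K * 1"
      using K[of s] g0(2)[of s] s True by simp
    also have "\<dots> \<le> B * (1 / ((1 - s) * sqrt (1 - s)))"
      using ge1[of s] s K0 C(1) by (intro mult_mono) (auto simp: B_def)
    finally show ?thesis by simp
  next
    case False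
    have "\<bar>1 / (s - letter_val x)\<bar> \<le> 2 / (1 - s)"
      using s False by (cases x) (auto simp: field_simps)
    then have "\<bar>iter_int_rev v s\<bar> * \<bar>1 / (s - letter_val x)\<bar> \<le> (C / sqrt (1 - s)) * (2 / (1 - s))"
      using C s by (intro mult_mono) auto
    also have "\<dots> = 2 * C / ((1 - s) * sqrt (1 - s))"
      by (simp add: mult.commute)
    also have "\<dots> \<le> B / ((1 - s) * sqrt (1 - s))"
      using s K0 by (intro divide_right_mono) (auto simp: B_def)
    finally show ?thesis by (simp add: abs_mult[symmetric])
  qed
  have "\<bar>iter_int_rev (x # v) t\<bar> \<le> 2 * B / sqrt (1 - t)" if t: "0 < t" "t < 1" for t
  proof -
    obtain g where g: "continuous_on {0..t} g"
      "\<And>s. s \<in> {0<..t} \<Longrightarrow> g s = iter_int_rev v s / (s - letter_val x)"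
      "iter_int_rev (x # v) t = integral {0..t} g"
      using iter_int_rev_integrand[OF t Cons.prems] t by auto
    have int: "((\<lambda>s. B / ((1 - s) * sqrt (1 - s))) has_integral (2 * B / sqrt (1 - t) - 2 * B / sqrt (1 - 0))) {0..t}"
      using t
      by (intro fundamental_theorem_of_calculus)
        (auto simp: has_real_derivative_iff_has_vector_derivative[symmetric] field_simps power2_eq_square
          intro!: derivative_eq_intros)
    have "norm (integral {0..t} g) \<le> integral {0..t} (\<lambda>s. B / ((1 - s) * sqrt (1 - s)))"
    proof (rule integral_norm_bound_integral)
      show "norm (g s) \<le> B / ((1 - s) * sqrt (1 - s))" if "s \<in> {0..t}" for s
      proof (cases "s = 0")
        case True
        \<comment> \<open>At 0 the function g is known only as a continuous extension, so the bound
          is obtained as a limit from the right.\<close>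
        have lower: "((\<lambda>s. \<bar>g s\<bar>) \<longlongrightarrow> \<bar>g 0\<bar>) (at 0 within {0<..t})"
        proof (intro tendsto_intros)
          have "(g \<longlongrightarrow> g 0) (at 0 within {0..t})"
            using g(1) t by (simp add: continuous_on_def)
          then show "(g \<longlongrightarrow> g 0) (at 0 within {0<..t})"
            by (rule tendsto_within_subset) auto
        qed
        have upper: "((\<lambda>s. B / ((1 - s) * sqrt (1 - s))) \<longlongrightarrow> B / ((1 - 0) * sqrt (1 - 0))) (at 0 within {0<..t})"
          by (intro tendsto_intros) auto
        have le: "eventually (\<lambda>s. \<bar>g s\<bar> \<le> B / ((1 - s) * sqrt (1 - s))) (at 0 within {0<..t})"
          unfolding eventually_at_filter using bound g(2) t by (intro always_eventually) auto
        have nontriv: "at 0 within {0<..t} \<noteq> bot"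
          using t by (simp add: at_within_eq_bot_iff)
        show ?thesis
          unfolding True real_norm_def by (rule tendsto_le[OF nontriv upper lower le])
      next
        case False
        then show ?thesis using that t g(2)[of s] bound[of s] by simp
      qed
    qed (use int integrable_continuous_real[OF g(1)] in auto)
    also have "\<dots> \<le> 2 * B / sqrt (1 - t)"
      using integral_unique[OF int] B by simp
    finally show ?thesis by (simp only: g(3) real_norm_def)
  qed
  then have "\<bar>iter_int_rev (x # v) t\<bar> \<le> 2 * B / sqrt (1 - t)" if "t \<in> {0..<1}" for t
    using that B iter_int_rev_0[of "x # v"] by (cases "t = 0") auto
  then show ?case using B by (intro exI[of _ "2 * B"]) auto
qed

text \<open>If the outermost letter is not 1, its kernel is bounded near 1. The integrand is then
  dominated by a multiple of the integrable 1/sqrt(1 - s), and the integral is continuous up to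
  1.\<close>

lemma iter_int_rev_tendsto:
  assumes "starts_nonzero w" "w = [] \<or> hd w \<noteq> P1"
  shows "(iter_int_rev w \<longlongrightarrow> iter_int_rev w 1) (at_left 1)"
proof (cases w)
  case (Cons x v)
  let ?f = "\<lambda>s. iter_int_rev v s / (s - letter_val x)"
  have x: "x \<noteq> P1" and v: "starts_nonzero v"
    using assms Cons starts_nonzero_tl by auto
  obtain C where C: "C \<ge> 0" "\<And>t. 0 \<le> t \<Longrightarrow> t < 1 \<Longrightarrow> \<bar>iter_int_rev v t\<bar> \<le> C / sqrt (1 - t)"
    using iter_int_rev_bound[OF v] by auto
  obtain g0 where g0: "continuous_on {0..1/2} g0"
    "\<And>t. t \<in> {0<..1/2} \<Longrightarrow> g0 t = ?f t"
    using iter_int_rev_integrand[of "1/2" "x # v"] assms Cons by auto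
  obtain K where "\<forall>y\<in>g0 ` {0..1/2}. \<bar>y\<bar> \<le> K"
    using compact_imp_bounded[OF compact_continuous_image[OF g0(1) compact_Icc]]
    unfolding bounded_real by blast
  then have K: "\<bar>g0 s\<bar> \<le> K" if "s \<in> {0..1/2}" for s
    using that by blast
  have K0: "K \<ge> 0" using K[of 0] by auto
  define B where "B = K + 2 * C"
  have bound: "\<bar>?f s\<bar> \<le> B / sqrt (1 - s)" if s: "0 < s" "s < 1" for s
  proof (cases "s \<le> 1 / 2")
    case True
    have "\<bar>?f s\<bar> \<le> K * 1"
      using K[of s] g0(2)[of s] s True by simp
    also have "\<dots> \<le> B * (1 / sqrt (1 - s))"
      using s K0 C(1) by (intro mult_mono) (auto simp: B_def)
    finally show ?thesis by simp
  next
    case False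
    have "\<bar>1 / (s - letter_val x)\<bar> \<le> 2"
      using s False x by (cases x) (auto simp: field_simps)
    then have "\<bar>iter_int_rev v s\<bar> * \<bar>1 / (s - letter_val x)\<bar> \<le> (C / sqrt (1 - s)) * 2"
      using C s by (intro mult_mono) auto
    also have "\<dots> \<le> B / sqrt (1 - s)"
      using s K0 by (simp add: B_def field_simps)
    finally show ?thesis by (simp add: abs_mult[symmetric])
  qed
  have "?f integrable_on {0<..<1}"
  proof (rule measurable_bounded_by_integrable_imp_integrable)
    have "continuous_on {0<..<1} (iter_int_rev v)"
      unfolding continuous_on_eq_continuous_at[OF open_greaterThanLessThan]
    proof
      fix t :: real assume "t \<in> {0<..<1}"
      moreover have "iter_int_rev [] = (\<lambda>t. 1)"
        by (simp add: fun_eq_iff)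
      ultimately show "isCont (iter_int_rev v) t"
        using v DERIV_iter_int_rev[of "hd v" "tl v" t] by (cases v) (auto intro: DERIV_isCont)
    qed
    then have "continuous_on {0<..<1} ?f"
      using x by (intro continuous_intros) (cases x; auto)+
    then show "?f \<in> borel_measurable (lebesgue_on {0<..<1})"
      by (rule continuous_imp_measurable_on_sets_lebesgue) simp
    have "((\<lambda>s. B / sqrt (1 - s)) has_integral (- 2 * B * sqrt (1 - 1) - (- 2 * B * sqrt (1 - 0)))) {0..1}"
      by (rule fundamental_theorem_of_calculus_interior)
        (auto simp: has_real_derivative_iff_has_vector_derivative[symmetric] field_simps
          intro!: derivative_eq_intros continuous_intros)
    then have "(\<lambda>s. B / sqrt (1 - s)) integrable_on {0..1}" by blast
    then show "(\<lambda>s. B / sqrt (1 - s)) integrable_on {0<..<1}"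
      by (simp add: integrable_on_Icc_iff_Ioo)
    show "norm (?f s) \<le> B / sqrt (1 - s)" if "s \<in> {0<..<1}" for s
      using bound[of s] that by simp
  qed simp
  then have "?f integrable_on {0..1}"
    by (simp add: integrable_on_Icc_iff_Ioo)
  then have "continuous_on {0..1} (iter_int_rev w)"
    unfolding Cons iter_int_rev.simps[abs_def] by (rule indefinite_integral_continuous_1)
  then have "(iter_int_rev w \<longlongrightarrow> iter_int_rev w 1) (at 1 within {0..1})"
    by (simp add: continuous_on_def)
  then show ?thesis
    by (simp add: at_within_Icc_at_left)
next
  case Nil
  moreover have "iter_int_rev [] = (\<lambda>t. 1)"
    by (simp add: fun_eq_iff)
  ultimately show ?thesis by simp
qed

lemma starts_nonzero_shuffle:
  "starts_nonzero u \<Longrightarrow> starts_nonzero v \<Longrightarrow> w \<in> set (shuffle_list u v) \<Longrightarrow> starts_nonzero w"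
  using last_shuffle_list[of w u v] by (auto simp: starts_nonzero_def)

lemma DERIV_sum_list:
  fixes f g :: "'a \<Rightarrow> real \<Rightarrow> real"
  assumes "\<And>w. w \<in> set ws \<Longrightarrow> (f w has_real_derivative g w t) F"
  shows "((\<lambda>t. \<Sum>w\<leftarrow>ws. f w t) has_real_derivative (\<Sum>w\<leftarrow>ws. g w t)) F"
  using assms by (induction ws) (auto intro!: derivative_eq_intros)

lemma continuous_on_sum_list:
  fixes f :: "'a \<Rightarrow> real \<Rightarrow> real"
  assumes "\<And>w. w \<in> set ws \<Longrightarrow> continuous_on S (f w)"
  shows "continuous_on S (\<lambda>t. \<Sum>w\<leftarrow>ws. f w t)"
  using assms by (induction ws) (auto intro!: continuous_intros)

lemma tendsto_sum_list:
  fixes f :: "'a \<Rightarrow> 'b \<Rightarrow> real"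
  assumes "\<And>w. w \<in> set ws \<Longrightarrow> (f w \<longlongrightarrow> g w) F"
  shows "((\<lambda>t. \<Sum>w\<leftarrow>ws. f w t) \<longlongrightarrow> (\<Sum>w\<leftarrow>ws. g w)) F"
  using assms by (induction ws) (auto intro!: tendsto_intros)

lemma shuffle_sum_divide:
  fixes f :: "'a list \<Rightarrow> real"
  shows "shuffle_sum (\<lambda>w. f w / c) u v = shuffle_sum f u v / c"
  unfolding shuffle_sum_def divide_inverse by (simp add: sum_list_mult_const)

text \<open>Both sides vanish at 0 if neither word is empty, and the product rule together with the
  induction hypothesis shows that their derivatives agree.\<close>

lemma iter_int_rev_shuffle:
  assumes "starts_nonzero u" "starts_nonzero v" "0 \<le> t" "t < 1"
  shows "iter_int_rev u t * iter_int_rev v t = shuffle_sum (\<lambda>w. iter_int_rev w t) u v"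
  using assms
proof (induction u v arbitrary: t rule: shuffle_list.induct)
  case (3 a u b v)
  let ?F = iter_int_rev
  define S where "S = (\<lambda>t. shuffle_sum (\<lambda>w. ?F w t) (a # u) (b # v))"
  define D where "D = (\<lambda>t. ?F (a # u) t * ?F (b # v) t - S t)"
  have nz: "starts_nonzero w" if "w \<in> set (shuffle_list (a # u) (b # v))" for w
    using starts_nonzero_shuffle[OF "3.prems"(1,2) that] .
  have "S 0 = shuffle_sum (\<lambda>w. 0) (a # u) (b # v)"
    unfolding S_def by (rule shuffle_sum_cong) (auto simp: iter_int_rev_0)
  then have D0: "D 0 = 0"
    by (simp add: D_def iter_int_rev_0 shuffle_sum_def)
  show ?case
  proof (cases "t = 0")
    case False
    have "D t = D 0"
    proof (rule DERIV_isconst_end[of 0 t D])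
      show "continuous_on {0..t} D"
        unfolding D_def S_def shuffle_sum_def using 3 nz
        by (intro continuous_intros continuous_on_sum_list continuous_on_iter_int_rev) auto
      fix s assume s: "0 < s" "s < t"
      note deriv = DERIV_iter_int_rev[OF _ s(1) order.strict_trans[OF s(2) "3.prems"(4)]]
      have S': "(S has_real_derivative
          shuffle_sum (\<lambda>w. ?F w s / (s - letter_val a)) u (b # v) +
          shuffle_sum (\<lambda>w. ?F w s / (s - letter_val b)) (a # u) v) (at s)"
        unfolding S_def shuffle_sum_simps
        unfolding shuffle_sum_def using nz by (intro DERIV_add DERIV_sum_list deriv) auto
      have nz': "starts_nonzero u" "starts_nonzero v"
        using "3.prems" starts_nonzero_tl by blast+
      have IH: "shuffle_sum (\<lambda>w. ?F w s) u (b # v) = ?F u s * ?F (b # v) s"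
        "shuffle_sum (\<lambda>w. ?F w s) (a # u) v = ?F (a # u) s * ?F v s"
        using s "3.prems" nz' "3.IH"(1)[of s] "3.IH"(2)[of s] by (simp_all del: iter_int_rev.simps)
      have "(D has_real_derivative
          (?F (a # u) s * (?F v s / (s - letter_val b)) + ?F u s / (s - letter_val a) * ?F (b # v) s) -
          (shuffle_sum (\<lambda>w. ?F w s / (s - letter_val a)) u (b # v) +
           shuffle_sum (\<lambda>w. ?F w s / (s - letter_val b)) (a # u) v)) (at s)"
        unfolding D_def by (intro DERIV_diff DERIV_mult' deriv S' "3.prems")
      then show "DERIV D s :> 0"
        by (simp add: shuffle_sum_divide IH del: iter_int_rev.simps)
    qed (use "3.prems"(3) False in simp)
    with D0 show ?thesis
      by (simp only: D_def S_def right_minus_eq)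
  next
    case True
    with D0 show ?thesis
      by (simp only: D_def S_def right_minus_eq)
  qed
qed simp_all

text \<open>The limit t \<rightarrow> 1 of the previous identity; shuffles of convergent words again
  converge at both ends.\<close>

lemma iter_int_shuffle:
  assumes "convergent_word u" "convergent_word v"
  shows "iter_int u * iter_int v = shuffle_sum iter_int u v"
proof -
  let ?F = iter_int_rev and ?u = "rev u" and ?v = "rev v"
  have nz: "starts_nonzero ?u" "starts_nonzero ?v" and
    hd: "?u = [] \<or> hd ?u \<noteq> P1" "?v = [] \<or> hd ?v \<noteq> P1"
    using assms by (auto simp: convergent_word_def starts_nonzero_def last_rev hd_rev)
  have "((\<lambda>t. ?F ?u t * ?F ?v t) \<longlongrightarrow> ?F ?u 1 * ?F ?v 1) (at_left 1)"
    by (intro tendsto_mult iter_int_rev_tendsto nz hd)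
  moreover have "((\<lambda>t. shuffle_sum (\<lambda>w. ?F w t) ?u ?v) \<longlongrightarrow> shuffle_sum (\<lambda>w. ?F w 1) ?u ?v) (at_left 1)"
    unfolding shuffle_sum_def
  proof (intro tendsto_sum_list iter_int_rev_tendsto)
    fix w assume w: "w \<in> set (shuffle_list ?u ?v)"
    show "starts_nonzero w" by (rule starts_nonzero_shuffle[OF nz w])
    show "w = [] \<or> hd w \<noteq> P1" using hd_shuffle_list[OF w] hd by auto
  qed
  moreover have "eventually (\<lambda>t. ?F ?u t * ?F ?v t = shuffle_sum (\<lambda>w. ?F w t) ?u ?v) (at_left 1)"
    using eventually_at_left[of 0 "1::real"]
    by (auto intro!: exI[of _ 0] iter_int_rev_shuffle nz)
  ultimately have "?F ?u 1 * ?F ?v 1 = shuffle_sum (\<lambda>w. ?F w 1) ?u ?v"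
    by (intro tendsto_unique[OF trivial_limit_at_left_real Lim_transform_eventually])
  then show ?thesis
    unfolding shuffle_sum_rev by (simp add: iter_int_def[abs_def])
qed

lemma lin_ext_iter_int_shuffle:
  assumes "supported convergent_word x" "supported convergent_word y"
  shows "lin_ext iter_int (x \<star> y) = lin_ext iter_int x * lin_ext iter_int y"
proof -
  have 1: "lin_ext iter_int (basis u \<star> basis v) = iter_int u * iter_int v"
    if "convergent_word u" "convergent_word v" for u v
    using that by (simp add: shuffle_basis shuffle_sum_linear[OF rat_linear_lin_ext] iter_int_shuffle)
  have 2: "lin_ext iter_int (basis u \<star> y) = iter_int u * lin_ext iter_int y"
    if "convergent_word u" for u
    using assms(2)
    by (rule supported_induct)
      (simp_all add: 1 that shuffle_add_right shuffle_scale_right lin_ext_add lin_ext_scale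
        scaleQ_real_def algebra_simps)
  show ?thesis
    using assms(1)
    by (rule supported_induct)
      (simp_all add: 2 shuffle_add_left shuffle_scale_left lin_ext_add lin_ext_scale
        scaleQ_real_def algebra_simps)
qed

section \<open>Existence and uniqueness of the period map\<close>

lemma is_period_map_regularise: "is_period_map (\<lambda>x. lin_ext iter_int (lin_ext regularise x))"
proof -
  have "supported convergent_word (lin_ext regularise x)" for x
    by (rule supported_lin_ext[of "\<lambda>_. True"]) (auto simp: supported_def[of "\<lambda>_. True"] supported_regularise)
  moreover have "regularise [P0] = 0" "regularise [P1] = 0"
    by (simp_all add: regularise_def conv_def lin_ext_diff lin_ext_neg lin_ext_add
        rat_linear_neg[OF rat_linear_shuffle(2)])
  ultimately show ?thesis
    unfolding is_period_map_def
    by (simp add: lin_ext_add lin_ext_scale scaleQ_real_def regularise_convergent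
        shuffle_hom_lin_ext[OF shuffle_hom_regularise] lin_ext_iter_int_shuffle)
qed

text \<open>A multiplicative linear map is determined by its values on the generators in
  \<open>word_algebra_induct\<close>.\<close>

lemma is_period_map_unique:
  assumes "is_period_map \<phi>" "is_period_map \<psi>"
  shows "\<phi> = \<psi>"
proof
  fix x
  have lin: "rat_linear \<phi>" "rat_linear \<psi>"
    using assms by (auto simp: is_period_map_def scaleQ_real_def intro!: rat_linearI)
  have "\<phi> (basis w) = \<psi> (basis w)" for w
    by (rule word_algebra_induct[of "\<lambda>x. \<phi> x = \<psi> x" UNIV])
      (use assms in \<open>auto simp: is_period_map_def\<close>)
  then show "\<phi> x = \<psi> x"
    by (rule rat_linear_eqI[OF lin])
qed

lemma is_period_map_period: "is_period_map period"
proof -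
  have "\<exists>!\<phi>. is_period_map \<phi>"
    using is_period_map_regularise is_period_map_unique by blast
  then show ?thesis
    unfolding period_def by (rule theI')
qed

lemma period_add: "period (x + y) = period x + period y"
  and period_scale: "period (c *\<^sub>Q x) = of_rat c * period x"
  and period_shuffle: "period (x \<star> y) = period x * period y"
  and period_letter: "period (basis [P0]) = 0" "period (basis [P1]) = 0"
  and period_convergent: "convergent_word w \<Longrightarrow> period (basis w) = iter_int w"
  using is_period_map_period by (auto simp: is_period_map_def)

lemma rat_linear_period: "rat_linear period"
  by (rule rat_linearI) (simp_all add: period_add period_scale scaleQ_real_def)

text \<open>The substitution \<open>s \<mapsto> s\<^sup>2\<close> turns \<open>ds / s\<close> into \<open>2 ds / s\<close> and \<open>ds / (s - 1)\<close> into \<open>ds /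
  (s - 1) + ds / (s + 1)\<close>.\<close>

definition double_coeff :: "letter \<Rightarrow> letter \<Rightarrow> rat" where
  "double_coeff x y =
     (if x = P0 \<and> y = P0 then 2 else if x = P1 \<and> (y = P1 \<or> y = Pm1) then 1 else 0)"

lemma double_coeff_simps [simp]:
  "double_coeff P0 P0 = 2" "double_coeff P0 P1 = 0" "double_coeff P0 Pm1 = 0"
  "double_coeff P1 P0 = 0" "double_coeff P1 P1 = 1" "double_coeff P1 Pm1 = 1"
  by (simp_all add: double_coeff_def)

abbreviation double :: "letter list \<Rightarrow> word_alg" where
  "double \<equiv> subst double_coeff"

lemma supported_subst: "supported (list_all2 (\<lambda>x y. c x y \<noteq> 0) w) (subst c w)"
proof (induction w)
  case (Cons x w)
  have "supported (list_all2 (\<lambda>x y. c x y \<noteq> 0) (x # w)) (c x y *\<^sub>Q prepend y (subst c w))" for y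
    unfolding prepend_def
    by (cases "c x y = 0") (auto intro!: supported_scale supported_lin_ext[OF Cons.IH])
  then show ?case
    unfolding subst.simps subst_letter_def by (intro supported_add)
qed simp

lemma list_all2_last: "list_all2 R u v \<Longrightarrow> u \<noteq> [] \<Longrightarrow> R (last u) (last v)"
  by (induction rule: list_all2_induct) auto

lemma list_all2_hd: "list_all2 R u v \<Longrightarrow> u \<noteq> [] \<Longrightarrow> R (hd u) (hd v)"
  by (induction rule: list_all2_induct) auto

lemma double_coeff_nonzero:
  "double_coeff x y \<noteq> 0 \<longleftrightarrow> (x = P0 \<and> y = P0) \<or> (x = P1 \<and> y \<noteq> P0)"
  by (cases x; cases y) (auto simp: double_coeff_def)

lemma supported_double_starts_nonzero:
  "starts_nonzero w \<Longrightarrow> supported starts_nonzero (double w)"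
  by (rule supported_mono[OF supported_subst])
    (auto simp: starts_nonzero_def double_coeff_nonzero dest: list_all2_last)

lemma DERIV_lin_ext:
  assumes "supported Q x" "\<And>w. Q w \<Longrightarrow> (f w has_real_derivative g w) (at t)"
  shows "((\<lambda>t. lin_ext (\<lambda>w. f w t) x) has_real_derivative lin_ext g x) (at t)"
  unfolding lin_ext_def scaleQ_real_def using assms
  by (intro DERIV_sum DERIV_cmult) (auto simp: supported_def)

lemma continuous_on_lin_ext:
  fixes f :: "'k \<Rightarrow> real \<Rightarrow> real"
  assumes "supported Q x" "\<And>w. Q w \<Longrightarrow> continuous_on S (f w)"
  shows "continuous_on S (\<lambda>t. lin_ext (\<lambda>w. f w t) x)"
  unfolding lin_ext_def scaleQ_real_def using assms
  by (intro continuous_intros) (auto simp: supported_def)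

lemma tendsto_lin_ext:
  fixes f :: "'k \<Rightarrow> 'b \<Rightarrow> real"
  assumes "supported Q x" "\<And>w. Q w \<Longrightarrow> (f w \<longlongrightarrow> g w) F"
  shows "((\<lambda>t. lin_ext (\<lambda>w. f w t) x) \<longlongrightarrow> lin_ext g x) F"
  unfolding lin_ext_def scaleQ_real_def using assms
  by (intro tendsto_intros) (auto simp: supported_def)

lemma lin_ext_cong_supported:
  "supported Q x \<Longrightarrow> (\<And>w. Q w \<Longrightarrow> f w = g w) \<Longrightarrow> lin_ext f x = lin_ext g x"
  unfolding lin_ext_def by (intro sum.cong) (auto simp: supported_def)

text \<open>Both sides agree at 0, and the chain rule for s^2 produces exactly the substituted
  forms, for instance 2 s/(s^2 - 1) = 1/(s - 1) + 1/(s + 1).\<close>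

lemma iter_int_rev_double:
  assumes "set w \<subseteq> {P0, P1}" "starts_nonzero w" "0 \<le> t" "t < 1"
  shows "lin_ext (\<lambda>v. iter_int_rev v t) (double w) = iter_int_rev w (t\<^sup>2)"
  using assms
proof (induction w arbitrary: t)
  case (Cons x w)
  let ?F = iter_int_rev
  define L where "L = (\<lambda>t. lin_ext (\<lambda>v. ?F v t) (double (x # w)))"
  define D where "D = (\<lambda>t. L t - ?F (x # w) (t\<^sup>2))"
  note supp = supported_double_starts_nonzero[OF Cons.prems(2)]
  have D0: "D 0 = 0"
  proof -
    have "L 0 = lin_ext (\<lambda>v. 0) (double (x # w))"
      unfolding L_def
      by (rule lin_ext_cong_supported[OF supported_subst])
        (auto simp: list_all2_Cons1 iter_int_rev_0)
    then show ?thesis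
      by (simp add: D_def iter_int_rev_0 lin_ext_def)
  qed
  show ?case
  proof (cases "t = 0")
    case False
    have "D t = D 0"
    proof (rule DERIV_isconst_end[of 0 t D])
      have "continuous_on {0..t} (\<lambda>s. ?F (x # w) (s\<^sup>2))"
      proof (rule continuous_on_compose2[of "{0..t\<^sup>2}" "?F (x # w)"])
        show "continuous_on {0..t\<^sup>2} (?F (x # w))"
          using Cons.prems by (intro continuous_on_iter_int_rev) (auto simp: power_less_one_iff)
      qed (auto intro!: continuous_intros power_mono)
      moreover have "continuous_on {0..t} L"
        unfolding L_def using Cons.prems
        by (intro continuous_on_lin_ext[OF supp] continuous_on_iter_int_rev)
      ultimately show "continuous_on {0..t} D"
        unfolding D_def by (intro continuous_intros)
      fix s assume s: "0 < s" "s < t"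
      then have s1: "s < 1" "0 < s\<^sup>2" "s\<^sup>2 < 1"
        using Cons.prems by (auto simp: power_less_one_iff)
      have IH: "lin_ext (\<lambda>v. ?F v s) (double w) = ?F w (s\<^sup>2)"
        using Cons.prems s starts_nonzero_tl by (intro Cons.IH) auto
      have L': "(L has_real_derivative
          lin_ext (\<lambda>v. ?F (tl v) s / (s - letter_val (hd v))) (double (x # w))) (at s)"
        unfolding L_def
      proof (rule DERIV_lin_ext)
        show "supported (\<lambda>v. v \<noteq> [] \<and> starts_nonzero v) (double (x # w))"
          using supp supported_subst[of double_coeff "x # w"] by (auto simp: supported_def list_all2_Cons1)
        fix v assume "v \<noteq> [] \<and> starts_nonzero v"
        then show "(?F v has_real_derivative ?F (tl v) s / (s - letter_val (hd v))) (at s)"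
          using DERIV_iter_int_rev[of "hd v" "tl v" s] s(1) s1(1) by simp
      qed
      have div: "lin_ext (\<lambda>v. ?F v s / c) (double w) = ?F w (s\<^sup>2) / c" for c
        unfolding IH[symmetric] lin_ext_def by (simp add: scaleQ_real_def sum_divide_distrib)
      have "lin_ext (\<lambda>v. ?F (tl v) s / (s - letter_val (hd v))) (double (x # w)) =
          ?F w (s\<^sup>2) / (s\<^sup>2 - letter_val x) * (2 * s)"
      proof (cases x)
        case P0
        then show ?thesis
          using s s1 unfolding lin_ext_subst_Cons
          by (simp add: div double_coeff_def scaleQ_real_def field_simps power2_eq_square)
      next
        case P1
        have "s\<^sup>2 - 1 = (s - 1) * (s + 1)" by (simp add: field_simps power2_eq_square)
        then show ?thesis
          using s s1 unfolding lin_ext_subst_Cons P1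
          by (simp add: div double_coeff_def scaleQ_real_def divide_simps) (simp add: algebra_simps)
      qed (use Cons.prems in auto)
      with L' have "(L has_real_derivative ?F w (s\<^sup>2) / (s\<^sup>2 - letter_val x) * (2 * s)) (at s)"
        by simp
      moreover have "((\<lambda>s. ?F (x # w) (s\<^sup>2)) has_real_derivative
          ?F w (s\<^sup>2) / (s\<^sup>2 - letter_val x) * (2 * s)) (at s)"
        by (rule DERIV_chain2[where f = "?F (x # w)" and g = "\<lambda>s. s\<^sup>2",
              OF DERIV_iter_int_rev[OF Cons.prems(2) s1(2,3)]])
          (auto intro!: derivative_eq_intros)
      ultimately show "DERIV D s :> 0"
        unfolding D_def using DERIV_diff by fastforce
    qed (use Cons.prems False in auto)
    with D0 show ?thesis
      by (simp only: D_def L_def right_minus_eq)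
  next
    case True
    with D0 show ?thesis
      by (simp only: D_def L_def right_minus_eq)
  qed
qed simp

lemma convergent_word_rev:
  "convergent_word w \<Longrightarrow> starts_nonzero (rev w) \<and> (rev w = [] \<or> hd (rev w) \<noteq> P1)"
  by (auto simp: convergent_word_def starts_nonzero_def last_rev hd_rev)

lemma iter_int_double:
  assumes "set w \<subseteq> {P0, P1}" "convergent_word w"
  shows "lin_ext iter_int (double w) = iter_int w"
proof -
  let ?F = iter_int_rev and ?w = "rev w"
  have nz: "starts_nonzero ?w" and hd: "?w = [] \<or> hd ?w \<noteq> P1"
    using convergent_word_rev[OF assms(2)] by auto
  have supp: "supported (\<lambda>v. starts_nonzero v \<and> (v = [] \<or> hd v \<noteq> P1)) (double ?w)"
    using supported_double_starts_nonzero[OF nz] supported_subst[of double_coeff ?w] hd assms(1)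
    by (cases ?w) (auto simp: supported_def list_all2_Cons1 double_coeff_nonzero
        simp flip: set_rev[of w] split: if_splits)
  have "((\<lambda>t. lin_ext (\<lambda>v. ?F v t) (double ?w)) \<longlongrightarrow> lin_ext (\<lambda>v. ?F v 1) (double ?w)) (at_left 1)"
    by (rule tendsto_lin_ext[OF supp]) (auto intro: iter_int_rev_tendsto)
  moreover have "((\<lambda>t. ?F ?w (t\<^sup>2)) \<longlongrightarrow> ?F ?w 1) (at_left 1)"
  proof (rule filterlim_compose[OF iter_int_rev_tendsto[OF nz hd]])
    have "((\<lambda>t::real. t\<^sup>2) \<longlongrightarrow> 1\<^sup>2) (at_left 1)" by (intro tendsto_intros)
    moreover have "eventually (\<lambda>t::real. t\<^sup>2 < 1) (at_left 1)"
      using eventually_at_left[of 0 "1::real"] by (auto intro!: exI[of _ 0] simp: power_less_one_iff)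
    ultimately show "filterlim (\<lambda>t::real. t\<^sup>2) (at_left 1) (at_left 1)"
      by (auto simp: filterlim_at elim: eventually_mono)
  qed
  moreover have "eventually (\<lambda>t. lin_ext (\<lambda>v. ?F v t) (double ?w) = ?F ?w (t\<^sup>2)) (at_left 1)"
    using eventually_at_left[of 0 "1::real"] assms(1) nz
    by (auto intro!: exI[of _ 0] iter_int_rev_double)
  ultimately have "lin_ext (\<lambda>v. ?F v 1) (double ?w) = ?F ?w 1"
    by (intro tendsto_unique[OF trivial_limit_at_left_real Lim_transform_eventually])
  then show ?thesis
    unfolding lin_ext_subst_rev[symmetric] by (simp add: iter_int_def[abs_def])
qed

lemma period_double:
  assumes "set w \<subseteq> {P0, P1}" "convergent_word w"
  shows "period (double w) = period (basis w)"
proof -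
  have "supported convergent_word (double w)"
  proof (rule supported_mono[OF supported_subst])
    fix v assume *: "list_all2 (\<lambda>x y. double_coeff x y \<noteq> 0) w v"
    show "convergent_word v"
    proof (cases "w = []")
      case False
      then show ?thesis
        using list_all2_last[OF *] list_all2_hd[OF *] assms last_in_set[OF False]
        by (auto simp: convergent_word_def double_coeff_nonzero)
    qed (use * in \<open>simp add: convergent_word_def\<close>)
  qed
  then have "period (double w) = lin_ext iter_int (double w)"
    by (subst rat_linear_eq_lin_ext[OF rat_linear_period])
      (auto intro: lin_ext_cong_supported period_convergent)
  then show ?thesis
    by (simp add: iter_int_double[OF assms] period_convergent[OF assms(2)])
qed

section \<open>Distribution relations for motivic iterated integrals\<close>

text \<open>The letter -1 is sent to zero because \<open>double\<close> vanishes on it; this allows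
  a comparison with \<open>double\<close> on all words.\<close>

definition no_minus :: "letter list \<Rightarrow> word_alg" where
  "no_minus = subst (\<lambda>x y. if x = y \<and> x \<noteq> Pm1 then 1 else 0)"

definition one_to_minus :: "letter list \<Rightarrow> word_alg" where
  "one_to_minus = subst (\<lambda>x y. if x = P1 \<and> y = Pm1 then 1 else 0)"

text \<open>Since \<open>1 - s\<^sup>2\<close> is asymptotic to \<open>2 (1 - s)\<close>, the substitution \<open>s \<mapsto> s\<^sup>2\<close> does not
  preserve the tangential base point at 1. It changes the regularised \<open>I(0; 1; 1)\<close> by \<open>log 2 =
  I(0; -1; 1)\<close>.\<close>

definition base_point_change :: "letter list \<Rightarrow> word_alg" where
  "base_point_change = conv no_minus one_to_minus"

lemma no_minus_simps [simp]:
  "no_minus [] = basis []"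
  "no_minus (x # w) = (if x = Pm1 then 0 else prepend x (no_minus w))"
  by (cases x; simp add: no_minus_def subst_letter_def scaleQ_one)+

lemma one_to_minus_simps [simp]:
  "one_to_minus [] = basis []"
  "one_to_minus (x # w) = (if x = P1 then prepend Pm1 (one_to_minus w) else 0)"
  by (cases x; simp add: one_to_minus_def subst_letter_def scaleQ_one)+

lemma no_minus_eq: "no_minus w = (if Pm1 \<in> set w then 0 else basis w)"
  by (induction w) (auto simp: rat_linear_0[OF rat_linear_prepend])

lemma one_to_minus_eq:
  "one_to_minus w = (if set w \<subseteq> {P1} then basis (replicate (length w) Pm1) else 0)"
  by (induction w) (auto simp: rat_linear_0[OF rat_linear_prepend])

lemma shuffle_hom_base_point_change: "shuffle_hom base_point_change"
  unfolding base_point_change_def no_minus_def one_to_minus_def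
  by (intro shuffle_hom_conv shuffle_hom_subst)

lemma base_point_change_eq:
  assumes "w = [] \<or> last w \<noteq> P1"
  shows "base_point_change w = no_minus w"
proof (cases w rule: rev_cases)
  case (snoc v x)
  have "one_to_minus (t @ [x]) = 0" for t
    using assms snoc by (auto simp: one_to_minus_eq)
  then show ?thesis
    by (simp add: snoc base_point_change_def conv_def split_sum_snoc del: no_minus_simps)
qed (simp add: base_point_change_def conv_def)

lemma double_no_minus: "Pm1 \<in> set w \<Longrightarrow> double w = 0"
  by (induction w)
    (auto simp: subst_letter_def double_coeff_def rat_linear_0[OF rat_linear_prepend])

lemma base_point_change_no_minus:
  assumes "Pm1 \<in> set w"
  shows "base_point_change w = 0"
proof -
  have "no_minus s \<star> one_to_minus t = 0" if "w = s @ t" for s t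
    using assms that by (auto simp: no_minus_eq one_to_minus_eq)
  then have "base_point_change w = split_sum (\<lambda>s t. 0) w"
    unfolding base_point_change_def conv_def by (rule split_sum_cong)
  then show ?thesis by simp
qed

section \<open>The ideal of distribution relations\<close>

definition distribution_generators :: "word_alg set" where
  "distribution_generators =
     {basis [P0], basis [P1]} \<union>
     {double w - basis w | w. set w \<subseteq> {P0, P1} \<and> convergent_word w}"

definition distribution_ideal :: "word_alg set" where
  "distribution_ideal = ratvs.span {g \<star> x | g x. g \<in> distribution_generators}"

lemma distribution_ideal_zero: "0 \<in> distribution_ideal"
  and distribution_ideal_add:
    "x \<in> distribution_ideal \<Longrightarrow> y \<in> distribution_ideal \<Longrightarrow> x + y \<in> distribution_ideal"
  and distribution_ideal_scale: "x \<in> distribution_ideal \<Longrightarrow> c *\<^sub>Q x \<in> distribution_ideal"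
  unfolding distribution_ideal_def
  by (auto intro: ratvs.span_zero ratvs.span_add ratvs.span_scale)

lemma distribution_generators_subset: "g \<in> distribution_generators \<Longrightarrow> g \<in> distribution_ideal"
  unfolding distribution_ideal_def
  by (rule ratvs.span_base) (use shuffle_one_right[of g, symmetric] in blast)

lemma distribution_ideal_shuffle:
  assumes "x \<in> distribution_ideal"
  shows "x \<star> y \<in> distribution_ideal" "y \<star> x \<in> distribution_ideal"
proof -
  show "x \<star> y \<in> distribution_ideal"
    using assms unfolding distribution_ideal_def
  proof (rule rat_linear_span[OF rat_linear_shuffle(2)])
    fix s assume "s \<in> {g \<star> x | g x. g \<in> distribution_generators}"
    then obtain g z where g: "s = g \<star> z" "g \<in> distribution_generators" by auto
    then have "s \<star> y = g \<star> (z \<star> y)" by (simp add: shuffle_assoc)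
    then show "s \<star> y \<in> ratvs.span {g \<star> x | g x. g \<in> distribution_generators}"
      using g(2) by (intro ratvs.span_base) auto
  qed
  then show "y \<star> x \<in> distribution_ideal" by (simp add: shuffle_commute)
qed

text \<open>Both maps are shuffle homomorphisms, so a congruence modulo the ideal has to be checked
  only on the letters 0 and 1 and on convergent words in them. Words containing -1 are killed by
  both maps.\<close>

lemma double_base_point_change:
  "lin_ext double x - lin_ext base_point_change x \<in> distribution_ideal"
proof -
  let ?P = "\<lambda>x. lin_ext double x - lin_ext base_point_change x \<in> distribution_ideal"
  have add: "?P (x + y)" if "?P x" "?P y" for x y
    using distribution_ideal_add[OF that] by (simp add: lin_ext_add algebra_simps)
  have scale: "?P (c *\<^sub>Q x)" if "?P x" for c x
    using distribution_ideal_scale[OF that, of c]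
    by (simp add: lin_ext_scale ratvs.scale_right_diff_distrib)
  have mult: "?P (x \<star> y)" if "?P x" "?P y" for x y
  proof -
    have "lin_ext double (x \<star> y) - lin_ext base_point_change (x \<star> y) =
        (lin_ext double x - lin_ext base_point_change x) \<star> lin_ext double y +
        lin_ext base_point_change x \<star> (lin_ext double y - lin_ext base_point_change y)"
      by (simp add: shuffle_hom_lin_ext shuffle_hom_subst shuffle_hom_base_point_change
          shuffle_diff_left shuffle_diff_right)
    then show ?thesis
      using distribution_ideal_add distribution_ideal_shuffle that by auto
  qed
  have zero: "?P (basis [P0])"
  proof -
    have "double [P0] - base_point_change [P0] = basis [P0]"
      by (simp add: subst_letter_def double_coeff_def base_point_change_def conv_def
          scaleQ_add_left[of 1 1, simplified] scaleQ_one)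
    then show ?thesis
      by (simp add: distribution_generators_subset distribution_generators_def)
  qed
  have one: "?P (basis [P1])"
  proof -
    have "double [P1] - base_point_change [P1] = 0"
      by (simp add: subst_letter_def double_coeff_def base_point_change_def conv_def scaleQ_one)
    then show ?thesis
      by (simp add: distribution_ideal_zero)
  qed
  have conv: "?P (basis w)" if "set w \<subseteq> {P0, P1}" "convergent_word w" for w
  proof -
    have "base_point_change w = basis w"
      using that by (subst base_point_change_eq) (auto simp: convergent_word_def no_minus_eq)
    then show ?thesis
      using that
      by (auto intro!: distribution_generators_subset simp: distribution_generators_def)
  qed
  have "?P (basis w)" for w
  proof (cases "Pm1 \<in> set w")
    case False
    have "set w \<subseteq> {P0, P1}"
    proof
      fix x assume "x \<in> set w"
      with False have "x \<noteq> Pm1" by auto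
      then show "x \<in> {P0, P1}" by (cases x) simp_all
    qed
    show ?thesis
    proof (rule word_algebra_induct[where P = ?P and A = "{P0, P1}"])
      show "?P x \<Longrightarrow> ?P y \<Longrightarrow> ?P (x + y)" for x y by (rule add)
      show "?P x \<Longrightarrow> ?P (c *\<^sub>Q x)" for c x by (rule scale)
      show "?P x \<Longrightarrow> ?P y \<Longrightarrow> ?P (x \<star> y)" for x y by (rule mult)
      show "set v \<subseteq> {P0, P1} \<Longrightarrow> convergent_word v \<Longrightarrow> ?P (basis v)" for v by (rule conv)
    qed (fact zero one \<open>set w \<subseteq> {P0, P1}\<close>)+
  qed (simp add: double_no_minus base_point_change_no_minus distribution_ideal_zero)
  then show ?thesis
    using supported_induct[of "\<lambda>_. True" x ?P] add scale
    by (simp add: supported_def distribution_ideal_zero)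
qed

lemma word_weight_part_supported:
  assumes "supported (\<lambda>w. length w = m) x"
  shows "word_weight_part n x = (if n = m then x else 0)"
proof -
  have "word_weight_part n x = lin_ext (\<lambda>w. if n = m then basis w else 0) x"
    unfolding word_weight_part_def using assms by (rule lin_ext_cong_supported) auto
  then show ?thesis
    by (cases "n = m") (simp_all add: lin_ext_id lin_ext_zero_fun)
qed

lemma word_weight_part_shuffle:
  assumes "supported (\<lambda>w. length w = m) g"
  shows "word_weight_part n (g \<star> x) = (if m \<le> n then g \<star> word_weight_part (n - m) x else 0)"
proof (rule rat_linear_eqI[of "\<lambda>x. word_weight_part n (g \<star> x)"])
  fix w
  have "supported (\<lambda>v. length v = m + length w) (g \<star> basis w)"
    by (rule supported_shuffle[OF assms, of "\<lambda>v. v = w"]) (auto simp: length_shuffle_list)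
  then show "word_weight_part n (g \<star> basis w) =
      (if m \<le> n then g \<star> word_weight_part (n - m) (basis w) else 0)"
    using word_weight_part_supported[of "length w" "basis w" "n - m"]
    by (auto simp: word_weight_part_supported)
next
  show "rat_linear (\<lambda>x. if m \<le> n then g \<star> word_weight_part (n - m) x else 0)"
    by (cases "m \<le> n")
      (simp_all add: rat_linear_const_0 rat_linear_compose[OF rat_linear_shuffle(1)]
        rat_linear_word_weight_part)
qed (rule rat_linear_compose[OF rat_linear_word_weight_part rat_linear_shuffle(1)])

lemma supported_length_subst: "supported (\<lambda>v. length v = length w) (subst c w)"
  by (rule supported_mono[OF supported_subst]) (auto dest: list_all2_lengthD)

text \<open>Letter substitutions preserve the length of a word, which is its weight.\<close>

lemma distribution_generators_homogeneous:
  assumes "g \<in> distribution_generators"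
  shows "\<exists>m. supported (\<lambda>w. length w = m) g"
proof -
  have "supported (\<lambda>v. length v = length w) (double w - basis w)" for w
    by (intro supported_diff supported_length_subst) simp
  then show ?thesis
    using assms by (auto simp: distribution_generators_def)
qed

lemma graded_ideal_distribution: "graded_ideal distribution_ideal"
  unfolding graded_ideal_def
proof (intro conjI ballI allI)
  show "ratvs.subspace distribution_ideal"
    unfolding distribution_ideal_def by (rule ratvs.subspace_span)
  fix x n assume "x \<in> distribution_ideal"
  then show "word_weight_part n x \<in> distribution_ideal"
    unfolding distribution_ideal_def
  proof (rule rat_linear_span[OF rat_linear_word_weight_part])
    fix s assume "s \<in> {g \<star> x | g x. g \<in> distribution_generators}"
    then obtain g z where g: "s = g \<star> z" "g \<in> distribution_generators" by auto
    obtain m where "supported (\<lambda>w. length w = m) g"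
      using distribution_generators_homogeneous[OF g(2)] by auto
    then show "word_weight_part n s \<in> ratvs.span {g \<star> x | g x. g \<in> distribution_generators}"
      using g(2) unfolding g(1)
      by (auto simp: word_weight_part_shuffle intro: ratvs.span_base ratvs.span_zero)
  qed
qed (simp_all add: distribution_ideal_shuffle)

lemma period_distribution_ideal: "x \<in> distribution_ideal \<Longrightarrow> period x = 0"
  unfolding distribution_ideal_def
proof (induction rule: ratvs.span_induct_alt)
  case (step c s y)
  have "period g = 0" if "g \<in> distribution_generators" for g
    using that
    by (auto simp: distribution_generators_def period_letter period_double
        rat_linear_diff[OF rat_linear_period])
  then have "period s = 0"
    using step by (auto simp: period_shuffle)
  then show ?case
    using step by (simp add: period_add period_scale)
qed (simp add: rat_linear_0[OF rat_linear_period])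

lemma tensor_in_span: "t \<in> ratvs.span (range (\<lambda>(a, b). a \<otimes>\<^sub>Q b))"
proof -
  obtain x where x: "t = abs_tensor x"
    by (metis Quotient_abs_rep Quotient_tensor)
  have "abs_tensor x = lin_ext (\<lambda>k. abs_tensor (basis k)) x"
    by (rule rat_linear_eq_lin_ext[OF rat_linear_abs_tensor])
  also have "\<dots> \<in> ratvs.span (range (\<lambda>(a, b). a \<otimes>\<^sub>Q b))"
    unfolding lin_ext_def
    by (intro ratvs.span_sum ratvs.span_scale ratvs.span_base) (auto simp: tensor_def)
  finally show ?thesis by (simp add: x)
qed

definition stable_target :: "word_alg set \<Rightarrow> (word_alg, word_alg) tensor set" where
  "stable_target I = ratvs.span
     ({a \<otimes>\<^sub>Q b | a b. a \<in> I} \<union> {(word_zeta2 \<star> a) \<otimes>\<^sub>Q b | a b. True} \<union> {a \<otimes>\<^sub>Q b | a b. b \<in> I})"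

text \<open>The target of the stability condition is an ideal of the tensor square. As the coaction
  is multiplicative, stability need only be checked on generators.\<close>

lemma stable_target_times:
  assumes I: "graded_ideal I" and s: "s \<in> stable_target I"
  shows "tensor_times s t \<in> stable_target I"
  using s unfolding stable_target_def
proof (rule rat_linear_span[OF rat_linear_tensor_times_left])
  let ?S = "{a \<otimes>\<^sub>Q b | a b. a \<in> I} \<union> {(word_zeta2 \<star> a) \<otimes>\<^sub>Q b | a b. True} \<union>
    {a \<otimes>\<^sub>Q b | a b. b \<in> I}"
  fix s assume s: "s \<in> ?S"
  show "tensor_times s t \<in> ratvs.span ?S"
    using tensor_in_span[of t]
  proof (rule rat_linear_span[OF rat_linear_tensor_times_right])
    fix p :: "(word_alg, word_alg) tensor" assume "p \<in> range (\<lambda>(a, b). a \<otimes>\<^sub>Q b)"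
    then obtain a' b' where p: "p = a' \<otimes>\<^sub>Q b'" by auto
    consider a b where "s = a \<otimes>\<^sub>Q b" "a \<in> I" | a b where "s = (word_zeta2 \<star> a) \<otimes>\<^sub>Q b"
      | a b where "s = a \<otimes>\<^sub>Q b" "b \<in> I"
      using s by blast
    then have "tensor_times s p \<in> ?S"
    proof cases
      case 1
      then have "a \<star> a' \<in> I" using I by (simp add: graded_ideal_def)
      then show ?thesis unfolding 1 p by auto
    next
      case 2
      then show ?thesis unfolding 2 p by (auto simp: shuffle_assoc)
    next
      case 3
      then have "b \<star> b' \<in> I" using I by (simp add: graded_ideal_def)
      then show ?thesis unfolding 3 p by auto
    qed
    then show "tensor_times s p \<in> ratvs.span ?S" by (rule ratvs.span_base)
  qed
qed

text \<open>The map s \<mapsto> s^2 fixes 0 and sends 1 and -1 to 1. For the end point -1 the reason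
  is that doubled words are invariant under reflection of the letters.\<close>

lemma lifts_letter_double:
  assumes "(x = P0 \<and> y = P0) \<or> (x = P1 \<and> y \<noteq> P0)"
  shows "lifts_letter double_coeff x y"
proof -
  have counit: "lin_ext counit (double w) = lin_ext double (counit w)" for w
    by (cases w) (simp_all add: lin_ext_subst_Cons counit_def del: subst.simps(2))
  have prepend: "lin_ext (\<lambda>s. basis (a # f s)) z = prepend a (lin_ext (\<lambda>s. basis (f s)) z)" for a f z
    by (simp add: rat_linear_lin_ext_swap[OF rat_linear_prepend])
  have neg: "lin_ext (\<lambda>s. basis (map letter_neg s)) (double w) = double w" for w
  proof (induction w)
    case (Cons x w)
    then show ?case
      by (simp add: lin_ext_subst_Cons prepend del: subst.simps(2))
        (cases x; simp add: subst_letter_def double_coeff_def add.commute)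
  qed simp
  show ?thesis
    unfolding lifts_letter_def
  proof
    fix s
    show "lin_ext (\<lambda>s. int_from0 s y) (double s) = lin_ext double (int_from0 s x)"
      using assms by (cases y) (auto simp: counit int_from0_P0 fun_cong[OF int_from0_P0] neg lin_ext_id
          simp del: int_from0.simps(1))
  qed
qed

lemma word_coaction_double:
  assumes "set w \<subseteq> {P0, P1}"
  shows "word_coaction (double w) = tensor_map (lin_ext double) (lin_ext double) (coact P0 P1 w)"
  unfolding word_coaction_eq
  by (rule coact_subst) (auto intro!: lifts_letter_double simp: double_coeff_nonzero)

text \<open>No gap of a word in 0 and 1 involves the letter -1. This follows from
  \<open>coact_subst\<close> for the substitution that fixes 0 and 1 and kills -1.\<close>

lemma coact_no_minus:
  assumes "set w \<subseteq> {P0, P1}"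
  shows "tensor_map (lin_ext no_minus) (lin_ext no_minus) (coact P0 P1 w) = coact P0 P1 w"
proof -
  let ?c = "\<lambda>x y. if x = y \<and> x \<noteq> Pm1 then 1 else 0 :: rat"
  have counit: "lin_ext counit (no_minus w) = lin_ext no_minus (counit w)" for w
    by (auto simp: no_minus_eq counit_def)
  have "lifts_letter ?c P0 P0" "lifts_letter ?c P1 P1"
    unfolding lifts_letter_def
    using counit by (auto simp: int_from0_P0 fun_cong[OF int_from0_P0] lin_ext_id no_minus_def
        simp del: int_from0.simps(1))
  then have "lin_ext (coact P0 P1) (no_minus w) =
      tensor_map (lin_ext no_minus) (lin_ext no_minus) (coact P0 P1 w)"
    unfolding no_minus_def
    by (intro coact_subst) (use assms in \<open>auto split: if_splits\<close>)
  moreover have "Pm1 \<notin> set w" using assms by auto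
  ultimately show ?thesis
    by (simp add: no_minus_eq)
qed

text \<open>The two maps differ by something that factors through removal of a final 1. They
  therefore also agree on tensors that this removal kills in the factor concerned.\<close>

lemma base_point_change_decompose:
  "\<exists>K. rat_linear K \<and>
    (\<forall>x. lin_ext base_point_change x = lin_ext no_minus x + K (remove_last P1 x))"
proof -
  define K where "K = lin_ext (\<lambda>v. base_point_change (v @ [P1]) - no_minus (v @ [P1]))"
  have K: "rat_linear K" unfolding K_def by (rule rat_linear_lin_ext)
  have "lin_ext base_point_change x = lin_ext no_minus x + K (remove_last P1 x)" for x
  proof (rule rat_linear_eqI[of "lin_ext base_point_change"])
    show "lin_ext base_point_change (basis w) =
        lin_ext no_minus (basis w) + K (remove_last P1 (basis w))" for w
      by (cases w rule: rev_cases) (auto simp: K_def base_point_change_eq)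
    show "rat_linear (\<lambda>x. lin_ext no_minus x + K (remove_last P1 x))"
      by (intro rat_linear_plus rat_linear_lin_ext rat_linear_compose[OF K] rat_linear_remove_last)
  qed (rule rat_linear_lin_ext)
  with K show ?thesis by blast
qed

lemma coact_base_point_change:
  assumes "set w \<subseteq> {P0, P1}" "w = [] \<or> last w \<noteq> P1"
  shows "tensor_map (lin_ext base_point_change) (lin_ext base_point_change) (coact P0 P1 w) =
    coact P0 P1 w"
proof -
  let ?E = "lin_ext base_point_change" and ?N = "lin_ext no_minus" and ?id = "\<lambda>x::word_alg. x"
  obtain K where K: "rat_linear K" and E: "?E = (\<lambda>x. ?N x + K (remove_last P1 x))"
    using base_point_change_decompose by (metis ext)
  note lin = rat_linear_lin_ext rat_linear_id rat_linear_compose[OF K rat_linear_remove_last]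
  have "tensor_map ?id (\<lambda>x. K (remove_last P1 x)) (coact P0 P1 w) =
      tensor_map ?id K (tensor_map ?id (remove_last P1) (coact P0 P1 w))"
    by (simp add: tensor_map_compose K rat_linear_remove_last rat_linear_id)
  also have "tensor_map ?id (remove_last P1) (coact P0 P1 w) = 0"
    using assms(2) by (auto simp: remove_last_coact_right drop_last_if_def)
  finally have "tensor_map ?id ?E (coact P0 P1 w) = tensor_map ?id ?N (coact P0 P1 w)"
    unfolding E
    by (simp add: tensor_map_fun_add_right lin rat_linear_0[OF rat_linear_tensor_map] K)
  moreover have "tensor_map ?E ?id (coact P0 P1 w) = tensor_map ?N ?id (coact P0 P1 w)"
  proof -
    have "tensor_map (\<lambda>x. K (remove_last P1 x)) ?id (coact P0 P1 w) =
        tensor_map K ?id (tensor_map (remove_last P1) ?id (coact P0 P1 w))"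
      by (simp add: tensor_map_compose K rat_linear_remove_last rat_linear_id)
    also have "tensor_map (remove_last P1) ?id (coact P0 P1 w) = 0"
      using assms(2) by (auto simp: remove_last_coact_left drop_last_if_def drop_first_if_def)
    finally show ?thesis
      unfolding E
      by (simp add: tensor_map_fun_add_left lin rat_linear_0[OF rat_linear_tensor_map] K)
  qed
  \<comment> \<open>Factoring in both orders lets the one-sided equalities be applied one after the
    other.\<close>
  moreover have "tensor_map f g t = tensor_map f ?id (tensor_map ?id g t)"
    "tensor_map f g t = tensor_map ?id g (tensor_map f ?id t)"
    if "rat_linear f" "rat_linear g" for f g and t :: "(word_alg, word_alg) tensor"
    using that by (simp_all add: tensor_map_compose rat_linear_id)
  ultimately have "tensor_map ?E ?E (coact P0 P1 w) = tensor_map ?N ?N (coact P0 P1 w)"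
    by (metis rat_linear_lin_ext)
  then show ?thesis
    by (simp add: coact_no_minus[OF assms(1)])
qed

lemma coaction_stable_distribution: "coaction_stable distribution_ideal"
proof -
  let ?J = distribution_ideal
  have sum: "s + t \<in> stable_target ?J" if "s \<in> stable_target ?J" "t \<in> stable_target ?J" for s t
    using that unfolding stable_target_def by (rule ratvs.span_add)
  have base: "a \<otimes>\<^sub>Q b \<in> stable_target ?J" if "a \<in> ?J \<or> b \<in> ?J" for a b
    unfolding stable_target_def by (rule ratvs.span_base) (use that in auto)
  have "word_coaction g \<in> stable_target ?J" if g: "g \<in> distribution_generators" for g
  proof -
    consider x where "g = basis [x]" "x \<in> {P0, P1}"
      | w where "g = double w - basis w" "set w \<subseteq> {P0, P1}" "convergent_word w"
      using g unfolding distribution_generators_def by blast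
    then show ?thesis
    proof cases
      case 1
      have "basis [x] \<in> ?J"
        using 1 by (intro distribution_generators_subset) (auto simp: distribution_generators_def)
      moreover have "word_coaction g = basis [x] \<otimes>\<^sub>Q basis [] + basis [] \<otimes>\<^sub>Q basis [x]"
        by (simp add: 1 word_coaction_eq coact_def word_int_from_P0)
      ultimately show ?thesis
        by (simp add: sum base)
    next
      case 2
      let ?D = "lin_ext double" and ?E = "lin_ext base_point_change"
      have w: "w = [] \<or> last w \<noteq> P1" using 2 by (auto simp: convergent_word_def)
      have lin: "rat_linear (\<lambda>t. tensor_map ?D ?D t - tensor_map ?E ?E t)"
        by (intro rat_linear_minus rat_linear_tensor_map rat_linear_lin_ext)
      have "tensor_map ?D ?D t - tensor_map ?E ?E t \<in> stable_target ?J" for t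
        using tensor_in_span[of t] unfolding stable_target_def
      proof (rule rat_linear_span[OF lin], fold stable_target_def)
        fix s :: "(word_alg, word_alg) tensor" assume "s \<in> range (\<lambda>(a, b). a \<otimes>\<^sub>Q b)"
        then obtain a b where s: "s = a \<otimes>\<^sub>Q b" by auto
        have "tensor_map ?D ?D s - tensor_map ?E ?E s =
            (?D a - ?E a) \<otimes>\<^sub>Q ?D b + ?E a \<otimes>\<^sub>Q (?D b - ?E b)"
          by (simp add: s rat_linear_lin_ext tensor_diff_left tensor_diff_right)
        then show "tensor_map ?D ?D s - tensor_map ?E ?E s \<in> stable_target ?J"
          by (simp add: sum base double_base_point_change)
      qed
      then show ?thesis
        using coact_base_point_change[OF 2(2) w] word_coaction_double[OF 2(2)]
        by (simp add: 2(1) word_coaction_eq lin_ext_diff) metis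
    qed
  qed
  then have gen: "word_coaction (g \<star> x) \<in> stable_target ?J" if "g \<in> distribution_generators" for g x
    using that by (simp add: word_coaction_shuffle stable_target_times graded_ideal_distribution)
  show ?thesis
    unfolding coaction_stable_def stable_target_def[symmetric]
  proof
    fix x assume "x \<in> ?J"
    then show "word_coaction x \<in> stable_target ?J"
      unfolding distribution_ideal_def[of] stable_target_def word_coaction_eq
      by (rule rat_linear_span[OF rat_linear_lin_ext])
        (use gen in \<open>auto simp: stable_target_def word_coaction_eq distribution_ideal_def\<close>)
  qed
qed

lemma distribution_ideal_motivic: "distribution_ideal \<subseteq> motivic_relations"
  unfolding motivic_relations_def
  using graded_ideal_distribution coaction_stable_distribution period_distribution_ideal
  by (blast intro: ratvs.span_base)

lemma motH_distribution: "x \<in> distribution_ideal \<Longrightarrow> motH_of_words x = 0"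
  using distribution_ideal_motivic by (auto simp: zero_motH_def motH.abs_eq_iff motivic_eq_def)

lemma motH_double: "motH_of_words (lin_ext double x) = motH_of_words (lin_ext base_point_change x)"
  using motH_distribution[OF double_base_point_change]
  by (simp add: rat_linear_diff[OF rat_linear_motH_of_words])

section \<open>The derivations \<open>D\<^sub>r\<close> on words\<close>

definition lie_class :: "word_alg \<Rightarrow> motL" where
  "lie_class x = motL_of (motH_of_words x)"

lemma rat_linear_lie_class: "rat_linear lie_class"
  unfolding lie_class_def by (rule rat_linear_compose[OF rat_linear_motL_of rat_linear_motH_of_words])

lemma lie_class_one: "lie_class (basis []) = 0"
proof -
  have "motH_of_words (basis []) = 1" by (simp add: one_motH_def)
  then show ?thesis
    by (simp add: lie_class_def zero_motL_def motL.abs_eq_iff L_eq_def ratvs.span_base)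
qed

lemma lie_class_shuffle:
  assumes "supported (\<lambda>w. w \<noteq> []) x" "supported (\<lambda>w. w \<noteq> []) y"
  shows "lie_class (x \<star> y) = 0"
proof -
  have "word_weight_part 0 z = 0" if "supported (\<lambda>w. w \<noteq> []) z" for z
  proof -
    have "word_weight_part 0 z = lin_ext (\<lambda>_. 0) z"
      unfolding word_weight_part_def by (rule lin_ext_cong_supported[OF that]) simp
    then show ?thesis by simp
  qed
  then have "weight_part 0 (motH_of_words x) = 0" "weight_part 0 (motH_of_words y) = 0"
    using assms by (simp_all add: weight_part.abs_eq zero_motH_def)
  then have "L_eq (motH_of_words (x \<star> y)) 0"
    unfolding L_eq_def times_motH.abs_eq[symmetric] diff_0_right
    by (intro ratvs.span_base) blast
  then show ?thesis
    by (simp add: lie_class_def zero_motL_def motL.abs_eq_iff)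
qed

lemma lie_class_distribution: "x \<in> distribution_ideal \<Longrightarrow> lie_class x = 0"
  by (simp add: lie_class_def motH_distribution rat_linear_0[OF rat_linear_motL_of])

text \<open>For n \<ge> 2 the word is a product of shorter words divided by n; for n = 0 it is the
  unit.\<close>

lemma lie_class_replicate:
  assumes "n \<noteq> 1"
  shows "lie_class (basis (replicate n a)) = 0"
proof (cases n)
  case (Suc m)
  then have "supported (\<lambda>w. w \<noteq> []) (basis [a])" "supported (\<lambda>w. w \<noteq> []) (basis (replicate m a))"
    using assms by simp_all
  then have "of_nat (Suc m) *\<^sub>Q lie_class (basis (replicate (Suc m) a)) = 0"
    using lie_class_shuffle basis_shuffle_replicate[of a m]
    by (metis rat_linear_scale[OF rat_linear_lie_class])
  then show ?thesis
    unfolding Suc by (metis of_nat_neq_0 ratvs.scale_eq_0_iff)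
qed (simp add: lie_class_one)

text \<open>The class of I(0; \<Phi> u; 1), as shown next. The extra term is log 2 and comes from
  the change of base point.\<close>

definition double_class :: "letter list \<Rightarrow> motL" where
  "double_class u = lie_class (basis u) + (if u = [P1] then lie_class (basis [Pm1]) else 0)"

text \<open>In the convolution that defines \<open>base_point_change\<close> all cuts but the two
  extreme ones give products. Of the words (-1)...(-1) at one extreme only the one of length 1 is
  not a product.\<close>

lemma lie_class_double:
  assumes "set u \<subseteq> {P0, P1}" "u \<noteq> []"
  shows "lie_class (double u) = double_class u"
proof -
  have "lie_class (double u) = lie_class (base_point_change u)"
    using motH_double[of "basis u"] by (simp add: lie_class_def)
  also have "\<dots> = lie_class (one_to_minus u) +
      split_sum (\<lambda>s t. if s = [] then 0 else lie_class (no_minus s \<star> one_to_minus t)) u"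
    using assms(2) unfolding base_point_change_def conv_def split_sum_linear[OF rat_linear_lie_class]
    by (cases u) simp_all
  also have "split_sum (\<lambda>s t. if s = [] then 0 else lie_class (no_minus s \<star> one_to_minus t)) u =
      split_sum (\<lambda>s t. if t = [] then lie_class (basis u) else 0) u"
  proof (rule split_sum_cong)
    fix s t assume u: "u = s @ t"
    have "lie_class (no_minus s \<star> one_to_minus t) = 0" if "s \<noteq> []" "t \<noteq> []"
      using that by (intro lie_class_shuffle) (auto simp: no_minus_eq one_to_minus_eq)
    moreover have "Pm1 \<notin> set s" using assms(1) u by auto
    ultimately show "(if s = [] then 0 else lie_class (no_minus s \<star> one_to_minus t)) =
        (if t = [] then lie_class (basis u) else 0)"
      using assms(2) u by (auto simp: no_minus_eq)
  qed
  also have "\<dots> = lie_class (basis u)"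
    by (cases u rule: rev_cases) (simp_all add: split_sum_snoc)
  also have "lie_class (one_to_minus u) = (if u = [P1] then lie_class (basis [Pm1]) else 0)"
  proof (cases "length u = 1")
    case True
    then obtain x where "u = [x]" by (cases u) auto
    then show ?thesis by (simp add: rat_linear_0[OF rat_linear_lie_class])
  next
    case False
    then show ?thesis
      by (auto simp: one_to_minus_eq lie_class_replicate rat_linear_0[OF rat_linear_lie_class])
  qed
  finally show ?thesis by (simp add: double_class_def)
qed

lemma double_class_zeros: "double_class (replicate n P0) = 0"
proof (cases "n = 1")
  case True
  have "basis [P0] \<in> distribution_ideal"
    by (rule distribution_generators_subset) (simp add: distribution_generators_def)
  then show ?thesis
    by (simp add: True double_class_def lie_class_distribution)
next
  case False
  have "replicate n P0 \<noteq> [P1]" by (cases n) simp_all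
  with False show ?thesis
    by (simp add: double_class_def lie_class_replicate)
qed

text \<open>By \<open>word_int_subst\<close> this is the class of a doubled gap between any two
  letters that lie over a and b.\<close>

definition double_gap :: "letter \<Rightarrow> letter list \<Rightarrow> letter \<Rightarrow> motL" where
  "double_gap a u b = lie_class (lin_ext double (word_int a u b))"

text \<open>Signed reversal of a word of odd length contributes -1, which gives the sign in the last
  case.\<close>

lemma double_gap_eq:
  assumes "set u \<subseteq> {P0, P1}" "odd (length u)"
  shows "double_gap a u a = 0" "double_gap P0 u P1 = double_class u"
    "double_gap P1 u P0 = - double_class (rev u)"
proof -
  have u: "u \<noteq> []" using assms(2) by auto
  then show "double_gap a u a = 0"
    by (simp add: double_gap_def word_int_same counit_def rat_linear_0[OF rat_linear_lie_class])
  show "double_gap P0 u P1 = double_class u"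
    using assms(1) u by (simp add: double_gap_def word_int_from_P0 lie_class_double)
  show "double_gap P1 u P0 = - double_class (rev u)"
    using assms u
    by (simp add: double_gap_def word_int_to_P0 int_to0_def lin_ext_neg lin_ext_scale scaleQ_one
        rat_linear_neg[OF rat_linear_lie_class] lie_class_double)
qed

section \<open>The derivation as a sum over single gaps\<close>

lemma D_words:
  assumes "r \<ge> 1"
  shows "D r (motH_of_words x) =
    tensor_map (\<lambda>x. lie_class (word_weight_part r x)) motH_of_words (word_coaction x)"
proof -
  have proj: "proj_L r (motA_of (motH_of_words x)) = lie_class (word_weight_part r x)" for x
    by (simp add: proj_L_of weight_part.abs_eq lie_class_def)
  have "proj_L r (motA_of 1) = 0"
    using proj[of "basis []"] assms
    by (simp add: one_motH_def word_weight_part_def rat_linear_0[OF rat_linear_lie_class])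
  then show ?thesis
    by (simp add: D_def coaction_of_words rat_linear_diff[OF rat_linear_tensor_map]
        rat_linear_proj_L rat_linear_id tensor_map_compose proj
        rat_linear_compose[OF rat_linear_motA_of rat_linear_motH_of_words] rat_linear_motH_of_words)
qed

text \<open>The term whose gap of length r starts at the left end a; \<open>gap_sum\<close> then
  moves this end through the word. The functional \<mu> is a parameter because the same cuts serve
  for the integrals themselves and for \<open>double_gap\<close>.\<close>

definition gap_cut ::
  "(letter \<Rightarrow> letter list \<Rightarrow> letter \<Rightarrow> motL) \<Rightarrow> nat \<Rightarrow> letter \<Rightarrow> letter \<Rightarrow> letter list \<Rightarrow>
    (motL, word_alg) tensor" where
  "gap_cut \<mu> r a b w =
     split_sum (\<lambda>s t. if length s = r then \<mu> a s (hd (t @ [b])) \<otimes>\<^sub>Q basis t else 0) w"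

primrec gap_sum ::
  "(letter \<Rightarrow> letter list \<Rightarrow> letter \<Rightarrow> motL) \<Rightarrow> nat \<Rightarrow> letter \<Rightarrow> letter \<Rightarrow> letter list \<Rightarrow>
    (motL, word_alg) tensor" where
  "gap_sum \<mu> r a b [] = 0"
| "gap_sum \<mu> r a b (x # w) = gap_cut \<mu> r a b (x # w) + prepend_right x (gap_sum \<mu> r x b w)"

lemma gap_cut_eq:
  "gap_cut \<mu> r a b w =
     (if r \<le> length w then \<mu> a (take r w) (hd (drop r w @ [b])) \<otimes>\<^sub>Q basis (drop r w) else 0)"
proof -
  have "gap_cut \<mu> r a b w = (\<Sum>n\<le>length w. if n = r
      then \<mu> a (take r w) (hd (drop r w @ [b])) \<otimes>\<^sub>Q basis (drop r w) else 0)"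
    unfolding gap_cut_def split_sum_take_drop[symmetric] by (rule sum.cong) (auto simp: min_def)
  then show ?thesis by simp
qed

lemma supported_length_int_from0: "supported (\<lambda>v. length v = length w) (int_from0 w b)"
  by (cases b) auto

lemma supported_length_word_int: "supported (\<lambda>v. length v = length w) (word_int a w b)"
proof -
  have "supported (\<lambda>v. length v = length w) (conv (int_to0 a) (\<lambda>w. int_from0 w b) w)"
    unfolding conv_def
  proof (rule supported_split_sum)
    fix s t assume w: "w = s @ t"
    have "supported (\<lambda>v. length v = length s) (int_to0 a s)"
      using supported_length_int_from0[of "rev s" a] by (simp add: int_to0_def supported_scale)
    then show "supported (\<lambda>v. length v = length w) (int_to0 a s \<star> int_from0 t b)"
      using supported_length_int_from0[of t b]
      by (rule supported_shuffle) (auto simp: w length_shuffle_list)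
  qed
  then show ?thesis by (simp add: fun_cong[OF word_int_conv])
qed

text \<open>In L products of gaps of positive weight vanish, and so does the unit. Exactly one gap
  is therefore nonempty, and the weight fixes its length to be r.\<close>

lemma weight_coact_eq_gap_sum:
  assumes "r \<ge> 1"
  shows "tensor_map (\<lambda>x. lie_class (word_weight_part r x)) (\<lambda>x. x) (coact a b w) =
    gap_sum (\<lambda>a u b. lie_class (word_int a u b)) r a b w"
proof -
  let ?p = "\<lambda>x. lie_class (word_weight_part r x)"
  let ?id = "\<lambda>x::word_alg. x"
  let ?T = "tensor_map ?p ?id"
  have p: "rat_linear ?p"
    by (rule rat_linear_compose[OF rat_linear_lie_class rat_linear_word_weight_part])
  have linT: "rat_linear ?T"
    by (rule rat_linear_tensor_map[OF p rat_linear_id])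
  have look: "rat_linear (\<lambda>x. Poly_Mapping.lookup x [] *\<^sub>Q (c :: motL))" for c
    by (rule rat_linearI)
      (simp_all add: lookup_add lookup_scaleQ scaleQ_add_left scaleQ_scaleQ scaleQ_rat_def)
  \<comment> \<open>Once a nonempty gap l is present, only the constant term of the remaining left
    factor x survives.\<close>
  have drop: "?p (l \<star> x) = Poly_Mapping.lookup x [] *\<^sub>Q (if m = r then lie_class l else 0)"
    if l: "supported (\<lambda>v. length v = m) l" and m: "m \<ge> 1" for l x m
  proof (rule rat_linear_eqI[of "\<lambda>x. ?p (l \<star> x)"])
    fix w
    have w: "word_weight_part n (basis w) = (if length w = n then basis w else 0)" for n
      by (simp add: word_weight_part_def)
    have "supported (\<lambda>w. w \<noteq> []) l"
      using l by (rule supported_mono) (use m in auto)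
    then have "lie_class (l \<star> basis w) = 0" if "w \<noteq> []"
      using that by (intro lie_class_shuffle) auto
    then show "?p (l \<star> basis w) =
        Poly_Mapping.lookup (basis w) [] *\<^sub>Q (if m = r then lie_class l else 0)"
      using word_weight_part_supported[OF l, of r]
      by (cases "w = []")
        (auto simp: word_weight_part_shuffle[OF l] w lookup_single scaleQ_one
          rat_linear_0[OF rat_linear_lie_class])
  qed (auto intro: look rat_linear_const_0 rat_linear_compose[OF p rat_linear_shuffle(1)])
  \<comment> \<open>Taking the constant term on the left forces all gaps in t to be empty, so every
    letter of t is marked.\<close>
  have keep: "tensor_map (\<lambda>x. Poly_Mapping.lookup x [] *\<^sub>Q c) ?id (coact_tail b t) = c \<otimes>\<^sub>Q basis t"
    for c :: motL and t
  proof (induction "length t" arbitrary: t rule: less_induct)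
    case less
    let ?L = "tensor_map (\<lambda>x. Poly_Mapping.lookup x [] *\<^sub>Q c) ?id"
    have linL: "rat_linear ?L" by (rule rat_linear_tensor_map[OF look rat_linear_id])
    show ?case
    proof (cases t)
      case Nil
      then show ?thesis by (simp add: look rat_linear_id lookup_single scaleQ_one)
    next
      case (Cons x v)
      have zero: "?L (times_left l u) = 0" if "supported (\<lambda>v. v \<noteq> []) l" for l u
      proof (rule tensor_eqI[of "\<lambda>u. ?L (times_left l u)"])
        fix p q :: word_alg
        have "supported (\<lambda>v. v \<noteq> []) (l \<star> p)"
          using that by (rule supported_shuffle[of _ _ "\<lambda>_. True"])
            (auto simp: supported_def[of "\<lambda>_. True"] shuffle_list_Nil_iff)
        then have "Poly_Mapping.lookup (l \<star> p) [] = 0"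
          by (auto simp: supported_def in_keys_iff)
        then show "?L (times_left l (p \<otimes>\<^sub>Q q)) = 0"
          by (simp add: look rat_linear_id)
      qed (auto intro: rat_linear_compose[OF linL rat_linear_times_left] rat_linear_const_0)
      have "?L (coact x b v) = ?L (times_left (word_int x [] (hd (v @ [b]))) (coact_tail b v))"
        unfolding coact_rec[of x] split_sum_linear[OF linL]
      proof (rule split_sum_only_Nil)
        fix s t assume "s \<noteq> ([] :: letter list)"
        then show "?L (times_left (word_int x s (hd (t @ [b]))) (coact_tail b t)) = 0"
          by (intro zero supported_mono[OF supported_length_word_int]) auto
      qed
      also have "\<dots> = c \<otimes>\<^sub>Q basis v"
        using less[of v] Cons by simp
      finally have "?L (coact x b v) = c \<otimes>\<^sub>Q basis v" .
      moreover have "?L (prepend_right x u) = prepend_right x (?L u)"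
        for u :: "(word_alg, word_alg) tensor"
        unfolding prepend_right_def
        by (simp add: tensor_map_compose look rat_linear_id rat_linear_prepend)
      ultimately show ?thesis by (simp add: Cons)
    qed
  qed
  have left: "?T (times_left (word_int a s y) (coact_tail b t)) =
      (if length s = r then lie_class (word_int a s y) \<otimes>\<^sub>Q basis t else 0)"
    if "s \<noteq> []" for a s y t
  proof -
    have "?T (times_left (word_int a s y) u) = tensor_map (\<lambda>x. Poly_Mapping.lookup x [] *\<^sub>Q
        (if length s = r then lie_class (word_int a s y) else 0)) ?id u" for u
      unfolding times_left_def
      using drop[OF supported_length_word_int[of s a y]] that
      by (simp add: tensor_map_compose p rat_linear_id rat_linear_shuffle Suc_le_eq)
    then show ?thesis
      by (simp add: keep)
  qed
  have pre: "?T (prepend_right x u) = prepend_right x (?T u)" for x u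
    unfolding prepend_right_def
    by (simp add: tensor_map_compose p rat_linear_id rat_linear_prepend)
  have "?p (basis []) = 0"
    using assms by (simp add: word_weight_part_def rat_linear_0[OF rat_linear_lie_class])
  then have one: "?T (basis [] \<otimes>\<^sub>Q basis []) = 0"
    by (simp add: p rat_linear_id)
  show ?thesis
  proof (induction w arbitrary: a)
    case Nil
    show ?case using one by (simp add: coact_rec[of a])
  next
    case (Cons x v)
    have "?T (coact a b (x # v)) = ?T (coact_tail b (x # v)) +
        split_sum (\<lambda>s t. if length (x # s) = r
          then lie_class (word_int a (x # s) (hd (t @ [b]))) \<otimes>\<^sub>Q basis t else 0) v"
      unfolding coact_rec[of a] split_sum_linear[OF linT]
      by (simp add: left del: coact_tail_simps)
    also have "\<dots> = gap_sum (\<lambda>a u b. lie_class (word_int a u b)) r a b (x # v)"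
      using assms by (simp add: pre Cons.IH gap_cut_def add.commute)
    finally show ?case .
  qed
qed

lemma lin_ext_tensor_left:
  assumes "rat_linear f"
  shows "lin_ext (\<lambda>s. f (g s) \<otimes>\<^sub>Q c) x = f (lin_ext g x) \<otimes>\<^sub>Q c"
  by (simp add: rat_linear_lin_ext_swap[OF rat_linear_compose[OF rat_linear_tensor(2) assms]])

lemma lin_ext_tensor_basis: "lin_ext (\<lambda>v. c \<otimes>\<^sub>Q basis (y # v)) x = c \<otimes>\<^sub>Q prepend y x"
  unfolding prepend_def by (simp add: rat_linear_lin_ext_swap[OF rat_linear_tensor(1)])

lemma lin_ext_length_cong:
  "lin_ext (\<lambda>s. if length s = r then f s else 0) (subst c w) =
     (if length w = r then lin_ext f (subst c w) else 0)"
proof -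
  have "lin_ext (\<lambda>s. if length s = r then f s else 0) (subst c w) =
      lin_ext (\<lambda>s. if length w = r then f s else 0) (subst c w)"
    by (rule lin_ext_cong_supported[OF supported_length_subst]) simp
  then show ?thesis by simp
qed

text \<open>For every choice of signs at its ends the doubled gap has the same class, so it can be
  taken out, and the sum over the remaining letters doubles the rest of the word.\<close>

lemma gap_cut_double:
  assumes w: "set w \<subseteq> {P0, P1}" and a: "lifts_letter double_coeff a' a"
    and b: "lifts_letter double_coeff b' b"
  shows "lin_ext (gap_cut (\<lambda>a u b. lie_class (word_int a u b)) r a b) (double w) =
    tensor_map (\<lambda>x. x) (lin_ext double) (gap_cut double_gap r a' b' w)"
proof -
  let ?\<mu> = "\<lambda>a u b. lie_class (word_int a u b)"
  let ?T = "tensor_map (\<lambda>x::motL. x) (lin_ext double)"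
  have linT: "rat_linear ?T" by (rule rat_linear_tensor_map[OF rat_linear_id rat_linear_lin_ext])
  have gap: "lin_ext (\<lambda>s'. ?\<mu> a s' y \<otimes>\<^sub>Q c) (double s) = double_gap a' s x \<otimes>\<^sub>Q c"
    if "lifts_letter double_coeff x y" for x y s and c :: word_alg
    unfolding lin_ext_tensor_left[OF rat_linear_lie_class] double_gap_def
      word_int_subst[OF a that] ..
  have "lin_ext (\<lambda>s'. lin_ext (\<lambda>t'. if length s' = r
        then ?\<mu> a s' (hd (t' @ [b])) \<otimes>\<^sub>Q basis t' else 0) (double t)) (double s) =
      ?T (if length s = r then double_gap a' s (hd (t @ [b'])) \<otimes>\<^sub>Q basis t else 0)"
    if st: "w = s @ t" for s t
  proof -
    have "lin_ext (\<lambda>s'. lin_ext (\<lambda>t'. ?\<mu> a s' (hd (t' @ [b])) \<otimes>\<^sub>Q basis t') (double t)) (double s) =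
        double_gap a' s (hd (t @ [b'])) \<otimes>\<^sub>Q double t"
    proof (cases t)
      case Nil
      then show ?thesis by (simp add: gap[OF b])
    next
      case (Cons x v)
      have y: "double_coeff x y *\<^sub>Q lin_ext (\<lambda>s'. lin_ext (\<lambda>v'. ?\<mu> a s' y \<otimes>\<^sub>Q basis (y # v'))
          (double v)) (double s) = double_coeff x y *\<^sub>Q (double_gap a' s x \<otimes>\<^sub>Q prepend y (double v))" for y
      proof (cases "double_coeff x y = 0")
        case False
        then have "lifts_letter double_coeff x y"
          by (intro lifts_letter_double) (simp add: double_coeff_nonzero)
        then show ?thesis by (simp add: lin_ext_tensor_basis gap)
      qed simp
      show ?thesis
        by (simp only: Cons lin_ext_subst_Cons lin_ext_fun_add lin_ext_scale_fun append_Cons list.sel y)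
          (simp add: subst_letter_def tensor_add_right tensor_scale_right)
    qed
    moreover have "lin_ext (\<lambda>t'. if P then f t' else 0) x = (if P then lin_ext f x else 0)"
      for P and f :: "letter list \<Rightarrow> (motL, word_alg) tensor" and x
      by simp
    ultimately show ?thesis
      by (simp add: lin_ext_length_cong rat_linear_id rat_linear_lin_ext rat_linear_0[OF linT])
  qed
  then show ?thesis
    unfolding gap_cut_def[abs_def] lin_ext_subst_split_sum split_sum_linear[OF linT]
    by (rule split_sum_cong)
qed

lemma gap_sum_double:
  assumes "set w \<subseteq> {P0, P1}" and "lifts_letter double_coeff a' a"
    and b: "lifts_letter double_coeff b' b"
  shows "lin_ext (gap_sum (\<lambda>a u b. lie_class (word_int a u b)) r a b) (double w) =
    tensor_map (\<lambda>x. x) (lin_ext double) (gap_sum double_gap r a' b' w)"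
  using assms(1,2)
proof (induction w arbitrary: a a')
  case Nil
  show ?case
    by (simp add: rat_linear_0[OF rat_linear_tensor_map] rat_linear_id rat_linear_lin_ext)
next
  case (Cons x w)
  let ?\<mu> = "\<lambda>a u b. lie_class (word_int a u b)"
  let ?T = "tensor_map (\<lambda>x::motL. x) (lin_ext double)"
  let ?X = "?T (gap_sum double_gap r x b' w)"
  have "lin_ext (gap_sum ?\<mu> r a b) (double (x # w)) =
      lin_ext (gap_cut ?\<mu> r a b) (double (x # w)) +
      lin_ext (\<lambda>w. case w of [] \<Rightarrow> 0 | x # w \<Rightarrow> prepend_right x (gap_sum ?\<mu> r x b w)) (double (x # w))"
    unfolding lin_ext_fun_add[symmetric]
    by (rule lin_ext_cong_supported[OF supported_subst]) (auto simp: list_all2_Cons1)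
  moreover have "lin_ext (\<lambda>w. case w of [] \<Rightarrow> 0 | x # w \<Rightarrow> prepend_right x (gap_sum ?\<mu> r x b w))
      (double (x # w)) = ?T (prepend_right x (gap_sum double_gap r x b' w))"
  proof -
    have "double_coeff x y *\<^sub>Q lin_ext (\<lambda>w. prepend_right y (gap_sum ?\<mu> r y b w)) (double w) =
        double_coeff x y *\<^sub>Q prepend_right y ?X" for y
    proof (cases "double_coeff x y = 0")
      case False
      then have "lifts_letter double_coeff x y"
        by (intro lifts_letter_double) (simp add: double_coeff_nonzero)
      then show ?thesis
        using Cons.IH[of x y] Cons.prems(1)
        by (simp add: rat_linear_lin_ext_swap[OF rat_linear_prepend_right, symmetric])
    qed simp
    then show ?thesis
      by (simp only: lin_ext_subst_Cons list.case)
        (simp add: tensor_map_prepend_right rat_linear_id tensor_map_subst_letter)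
  qed
  ultimately show ?case
    using gap_cut_double[OF Cons.prems b]
    by (simp add: rat_linear_add[OF rat_linear_tensor_map] rat_linear_id rat_linear_lin_ext)
qed

section \<open>Doubled words with a sign on the first letter\<close>

definition signed_double :: "letter list \<Rightarrow> word_alg" where
  "signed_double w =
     (case w of [] \<Rightarrow> basis [] | x # v \<Rightarrow> prepend P1 (double v) - prepend Pm1 (double v))"

lemma signed_double_simps [simp]:
  "signed_double [] = basis []"
  "signed_double (x # v) = prepend P1 (double v) - prepend Pm1 (double v)"
  by (simp_all add: signed_double_def)

lemma lin_ext_neg_double: "lin_ext (\<lambda>s. basis (map letter_neg s)) (double w) = double w"
  using lifts_letter_double[of P1 Pm1] by (simp add: lifts_letter_def)

text \<open>The gap contains the signed first letter and ends at 0 or at a lift z of 1. It vanishes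
  if it ends at 0. Otherwise rescaling by z multiplies its sign by z, which puts a sign on z as the
  new first letter of the rest; hence both factors are signed.\<close>

lemma gap_cut_signed_double:
  assumes w: "set w \<subseteq> {P0, P1}" and r: "r \<ge> 1"
  shows "lin_ext (gap_cut (\<lambda>a u b. lie_class (word_int a u b)) r P0 P1) (signed_double (P1 # w)) =
    (if r \<le> length (P1 # w) \<and> hd (drop r (P1 # w) @ [P1]) = P1
     then lie_class (signed_double (take r (P1 # w))) \<otimes>\<^sub>Q signed_double (drop r (P1 # w)) else 0)"
proof -
  let ?\<mu> = "\<lambda>a u b. lie_class (word_int a u b)"
  define f where "f = (\<lambda>y s t. if Suc (length s) = r
    then lie_class (int_from0 (y # s) (hd (t @ [P1]))) \<otimes>\<^sub>Q basis t else 0)"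
  define g where "g = (\<lambda>s t. if Suc (length s) = r
    then (if hd (t @ [P1]) = P1
      then lie_class (signed_double (P1 # s)) \<otimes>\<^sub>Q signed_double t else 0) else 0)"
  have "gap_cut ?\<mu> r P0 P1 (y # v) = split_sum (f y) v" for y v
    using r by (simp add: gap_cut_def f_def word_int_from_P0 cong: if_cong del: int_from0.simps)
  then have "lin_ext (gap_cut ?\<mu> r P0 P1) (signed_double (P1 # w)) =
      lin_ext (split_sum (f P1)) (double w) - lin_ext (split_sum (f Pm1)) (double w)"
    by (simp add: lin_ext_diff lin_ext_prepend)
  also have "\<dots> = split_sum (\<lambda>s t. lin_ext (\<lambda>s'. lin_ext (f P1 s') (double t)) (double s) -
      lin_ext (\<lambda>s'. lin_ext (f Pm1 s') (double t)) (double s)) w"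
    unfolding lin_ext_subst_split_sum split_sum_diff ..
  also have "\<dots> = split_sum g w"
  proof (rule split_sum_cong)
    fix s t assume st: "w = s @ t"
    define F where "F = (\<lambda>y z. lie_class (lin_ext (\<lambda>s'. int_from0 (y # s') z) (double s)))"
    have fF: "lin_ext (\<lambda>s'. lin_ext (f y s') (double t)) (double s) = (if Suc (length s) = r then
        lin_ext (\<lambda>s'. lin_ext (\<lambda>t. lie_class (int_from0 (y # s') (hd (t @ [P1]))) \<otimes>\<^sub>Q basis t) (double t))
          (double s) else 0)" for y
    proof -
      have "lin_ext (f y s') (double t) = (if length s' = r - 1 then
          lin_ext (\<lambda>t. lie_class (int_from0 (y # s') (hd (t @ [P1]))) \<otimes>\<^sub>Q basis t) (double t) else 0)" for s'
      proof -
        have "Suc (length s') = r \<longleftrightarrow> length s' = r - 1" using r by auto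
        then show ?thesis by (simp add: f_def)
      qed
      then show ?thesis
        using r by (auto simp: lin_ext_length_cong)
    qed
    \<comment> \<open>Reflection turns the end point -1 into 1 and exchanges the two lifts of the
      first letter.\<close>
    have F: "F P1 P1 = lie_class (prepend P1 (double s))" "F Pm1 P1 = lie_class (prepend Pm1 (double s))"
      "F P1 Pm1 = lie_class (prepend Pm1 (double s))" "F Pm1 Pm1 = lie_class (prepend P1 (double s))"
    proof -
      have neg: "lin_ext (\<lambda>s'. basis (y # map letter_neg s')) (double s) = prepend y (double s)" for y
        using rat_linear_lin_ext_swap[OF rat_linear_prepend[of y],
            of "\<lambda>s. basis (map letter_neg s)" "double s"]
        by (simp add: lin_ext_neg_double)
      show "F P1 P1 = lie_class (prepend P1 (double s))" "F Pm1 P1 = lie_class (prepend Pm1 (double s))"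
        "F P1 Pm1 = lie_class (prepend Pm1 (double s))" "F Pm1 Pm1 = lie_class (prepend P1 (double s))"
        by (simp_all add: F_def neg) (simp_all add: prepend_def)
    qed
    have inner: "lin_ext (\<lambda>s'. lie_class (int_from0 (y # s') z) \<otimes>\<^sub>Q c) (double s) = F y z \<otimes>\<^sub>Q c"
      for y z and c :: word_alg
      unfolding lin_ext_tensor_left[OF rat_linear_lie_class] F_def ..
    have "lin_ext (\<lambda>s'. lin_ext (\<lambda>t. lie_class (int_from0 (P1 # s') (hd (t @ [P1]))) \<otimes>\<^sub>Q basis t)
          (double t)) (double s) -
        lin_ext (\<lambda>s'. lin_ext (\<lambda>t. lie_class (int_from0 (Pm1 # s') (hd (t @ [P1]))) \<otimes>\<^sub>Q basis t)
          (double t)) (double s) =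
        (if hd (t @ [P1]) = P1 then lie_class (signed_double (P1 # s)) \<otimes>\<^sub>Q signed_double t else 0)"
    proof (cases t)
      case Nil
      then show ?thesis
        by (simp add: inner F rat_linear_diff[OF rat_linear_lie_class] tensor_diff_left
            del: int_from0.simps)
    next
      case (Cons x v)
      have "x = P0 \<or> x = P1" using w st Cons by auto
      then show ?thesis
      proof
        assume "x = P0"
        then show ?thesis
          by (simp add: Cons lin_ext_subst_Cons lin_ext_fun_add double_coeff_def scaleQ_one
              rat_linear_0[OF rat_linear_lie_class] del: subst.simps)
      next
        assume x: "x = P1"
        show ?thesis
          by (simp add: Cons x lin_ext_subst_Cons lin_ext_fun_add double_coeff_def scaleQ_one
              lin_ext_tensor_basis inner F rat_linear_diff[OF rat_linear_lie_class]
              tensor_diff_left tensor_diff_right del: subst.simps int_from0.simps)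
      qed
    qed
    then show "lin_ext (\<lambda>s'. lin_ext (f P1 s') (double t)) (double s) -
        lin_ext (\<lambda>s'. lin_ext (f Pm1 s') (double t)) (double s) = g s t"
      unfolding fF g_def by simp
  qed
  also have "split_sum g w = (\<Sum>n\<le>length w. if n = r - 1 then g (take n w) (drop n w) else 0)"
    unfolding split_sum_take_drop[symmetric] using r by (intro sum.cong) (auto simp: g_def min_def)
  also have "\<dots> = (if r \<le> length (P1 # w) then g (take (r - 1) w) (drop (r - 1) w) else 0)"
    using r by auto
  finally show ?thesis
    using r by (cases r) (auto simp: g_def min_def simp del: signed_double_simps)
qed

text \<open>A gap either contains the signed first letter or lies to its right. In the second case
  it has the same class for both lifts of the first letter, and the sign stays with the remaining
  word.\<close>

lemma D_signed_double:
  assumes w: "set w \<subseteq> {P0, P1}" and r: "r \<ge> 1"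
  shows "D r (motH_of_words (signed_double (P1 # w))) =
    (if r \<le> length (P1 # w) \<and> hd (drop r (P1 # w) @ [P1]) = P1
     then lie_class (signed_double (take r (P1 # w))) \<otimes>\<^sub>Q
       motH_of_words (signed_double (drop r (P1 # w))) else 0) +
    tensor_map (\<lambda>x. x) (\<lambda>x. motH_of_words (lin_ext signed_double x))
      (prepend_right P1 (gap_sum double_gap r P1 P1 w))"
proof -
  let ?p = "\<lambda>x. lie_class (word_weight_part r x)"
  let ?M = "tensor_map (\<lambda>x::motL. x) motH_of_words"
  let ?\<mu> = "\<lambda>a u b. lie_class (word_int a u b)"
  let ?X = "gap_sum double_gap r P1 P1 w"
  have p: "rat_linear ?p"
    by (rule rat_linear_compose[OF rat_linear_lie_class rat_linear_word_weight_part])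
  have M: "rat_linear ?M"
    by (rule rat_linear_tensor_map[OF rat_linear_id rat_linear_motH_of_words])
  have "D r (motH_of_words (signed_double (P1 # w))) =
      ?M (tensor_map ?p (\<lambda>x. x) (word_coaction (signed_double (P1 # w))))"
    unfolding D_words[OF r] by (simp add: tensor_map_compose p rat_linear_id rat_linear_motH_of_words)
  also have "tensor_map ?p (\<lambda>x. x) (word_coaction (signed_double (P1 # w))) =
      lin_ext (gap_sum ?\<mu> r P0 P1) (signed_double (P1 # w))"
    unfolding word_coaction_eq rat_linear_lin_ext_swap[OF rat_linear_tensor_map[OF p rat_linear_id]]
      weight_coact_eq_gap_sum[OF r] ..
  also have "\<dots> = lin_ext (gap_cut ?\<mu> r P0 P1) (signed_double (P1 # w)) +
      (prepend_right P1 (lin_ext (gap_sum ?\<mu> r P1 P1) (double w)) -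
       prepend_right Pm1 (lin_ext (gap_sum ?\<mu> r Pm1 P1) (double w)))"
    by (simp add: lin_ext_diff lin_ext_prepend lin_ext_fun_add
        rat_linear_lin_ext_swap[OF rat_linear_prepend_right])
  also have "prepend_right P1 (lin_ext (gap_sum ?\<mu> r P1 P1) (double w)) -
       prepend_right Pm1 (lin_ext (gap_sum ?\<mu> r Pm1 P1) (double w)) =
      tensor_map (\<lambda>x. x) (lin_ext signed_double) (prepend_right P1 ?X)"
  proof -
    have "prepend_right P1 (tensor_map (\<lambda>x. x) (lin_ext double) t) -
        prepend_right Pm1 (tensor_map (\<lambda>x. x) (lin_ext double) t) =
        tensor_map (\<lambda>x. x) (lin_ext signed_double) (prepend_right P1 t)"
      for t :: "(motL, word_alg) tensor"
    proof (rule tensor_eqI[of "\<lambda>t. prepend_right P1 (tensor_map (\<lambda>x. x) (lin_ext double) t) -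
        prepend_right Pm1 (tensor_map (\<lambda>x. x) (lin_ext double) t)"])
      fix a :: motL and b
      have "prepend P1 (lin_ext double b) - prepend Pm1 (lin_ext double b) =
          lin_ext signed_double (prepend P1 b)"
        by (rule rat_linear_eqI[of "\<lambda>b. prepend P1 (lin_ext double b) - prepend Pm1 (lin_ext double b)"])
          (auto intro: rat_linear_minus rat_linear_lin_ext
            rat_linear_compose[OF rat_linear_prepend rat_linear_lin_ext]
            rat_linear_compose[OF rat_linear_lin_ext rat_linear_prepend])
      then show "prepend_right P1 (tensor_map (\<lambda>x. x) (lin_ext double) (a \<otimes>\<^sub>Q b)) -
          prepend_right Pm1 (tensor_map (\<lambda>x. x) (lin_ext double) (a \<otimes>\<^sub>Q b)) =
          tensor_map (\<lambda>x. x) (lin_ext signed_double) (prepend_right P1 (a \<otimes>\<^sub>Q b))"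
        by (simp add: rat_linear_id rat_linear_lin_ext flip: tensor_diff_right)
    qed (intro rat_linear_minus rat_linear_compose[OF rat_linear_prepend_right]
        rat_linear_compose[OF rat_linear_tensor_map] rat_linear_tensor_map rat_linear_id
        rat_linear_lin_ext rat_linear_prepend_right)+
    then show ?thesis
      using gap_sum_double[OF w lifts_letter_double[of P1 P1] lifts_letter_double[of P1 P1], of r]
        gap_sum_double[OF w lifts_letter_double[of P1 Pm1] lifts_letter_double[of P1 P1], of r]
      by simp
  qed
  also have "?M (lin_ext (gap_cut ?\<mu> r P0 P1) (signed_double (P1 # w)) +
      tensor_map (\<lambda>x. x) (lin_ext signed_double) (prepend_right P1 ?X)) =
      ?M (lin_ext (gap_cut ?\<mu> r P0 P1) (signed_double (P1 # w))) +
      tensor_map (\<lambda>x. x) (\<lambda>x. motH_of_words (lin_ext signed_double x)) (prepend_right P1 ?X)"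
    by (simp add: rat_linear_add[OF M] tensor_map_compose rat_linear_id rat_linear_lin_ext
        rat_linear_motH_of_words)
  finally show ?thesis
    unfolding gap_cut_signed_double[OF w r]
    by (simp add: rat_linear_0[OF M] rat_linear_id rat_linear_motH_of_words
        del: signed_double_simps split del: if_split cong: if_cong)
      (simp add: rat_linear_0[OF M] rat_linear_id rat_linear_motH_of_words del: signed_double_simps)
qed

section \<open>Words of compositions\<close>

definition block_word :: "nat list \<Rightarrow> letter list" where
  "block_word ks = concat (map (\<lambda>k. P1 # replicate (k - 1) P0) ks)"

lemma block_word_simps [simp]:
  "block_word [] = []"
  "block_word (k # ks) = P1 # replicate (k - 1) P0 @ block_word ks"
  "block_word (ks @ ls) = block_word ks @ block_word ls"
  by (simp_all add: block_word_def)

lemma set_block_word: "set (block_word ks) \<subseteq> {P0, P1}"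
  by (induction ks) auto

lemma length_block_word: "\<forall>k\<in>set ks. k \<ge> 1 \<Longrightarrow> length (block_word ks) = sum_list ks"
  by (induction ks) auto

text \<open>Reversed blocks end in their 1; moving one letter 1 from the far end to the front
  restores the form of blocks.\<close>

lemma rev_block_word: "P1 # rev (block_word ks) = block_word (rev ks) @ [P1]"
proof (induction ks)
  case (Cons k ks)
  have "P1 # rev (block_word (k # ks)) = (P1 # rev (block_word ks)) @ replicate (k - 1) P0 @ [P1]"
    by simp
  also have "\<dots> = block_word (rev (k # ks)) @ [P1]"
    unfolding Cons.IH by simp
  finally show ?case .
qed simp

text \<open>The source of the reversed arguments in the third sum: the reversed word is that of a
  gap which starts after the 1 of block k and ends inside a later block.\<close>

lemma rev_zeros_block_word:
  "rev (replicate (k - 1) P0 @ block_word ks @ P1 # replicate l P0) =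
     replicate l P0 @ block_word (rev (k # ks))"
proof -
  have "rev (replicate (k - 1) P0 @ block_word ks @ P1 # replicate l P0) =
      replicate l P0 @ (P1 # rev (block_word ks)) @ replicate (k - 1) P0"
    by simp
  also have "\<dots> = replicate l P0 @ block_word (rev (k # ks))"
    unfolding rev_block_word by simp
  finally show ?thesis .
qed

text \<open>The cut is followed by a letter 1, or by the end point 1, exactly if it lies at a block
  boundary. In the induction p also absorbs the blocks already passed.\<close>

lemma cut_at_one:
  fixes \<Psi> :: "letter list \<Rightarrow> letter list \<Rightarrow> 'v::comm_monoid_add"
  assumes "\<forall>k\<in>set ks. k \<ge> 1" "length p \<le> r"
  shows "(if r \<le> length (p @ block_word ks) \<and> hd (drop r (p @ block_word ks) @ [P1]) = P1
      then \<Psi> (take r (p @ block_word ks)) (drop r (p @ block_word ks)) else 0) =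
    (\<Sum>j\<le>length ks. if length p + sum_list (take j ks) = r
      then \<Psi> (p @ block_word (take j ks)) (block_word (drop j ks)) else 0)"
  using assms
proof (induction ks arbitrary: p)
  case (Cons k ks)
  let ?p = "p @ P1 # replicate (k - 1) P0"
  have k: "k \<ge> 1" using Cons.prems by simp
  have shift: "(\<Sum>j\<le>length (k # ks). if length p + sum_list (take j (k # ks)) = r
        then \<Psi> (p @ block_word (take j (k # ks))) (block_word (drop j (k # ks))) else 0) =
      (if length p = r then \<Psi> p (block_word (k # ks)) else 0) +
      (\<Sum>j\<le>length ks. if length ?p + sum_list (take j ks) = r
        then \<Psi> (?p @ block_word (take j ks)) (block_word (drop j ks)) else 0)"
    using k by (simp add: sum.atMost_Suc_shift add.assoc del: sum.atMost_Suc cong: if_cong)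
  show ?case
  proof (cases "length ?p \<le> r")
    case True
    then have "(if length p = r then \<Psi> p (block_word (k # ks)) else 0) = 0" by auto
    moreover have "?p @ block_word ks = p @ block_word (k # ks)" by simp
    moreover have "\<forall>k\<in>set ks. k \<ge> 1" using Cons.prems by simp
    ultimately show ?thesis
      unfolding shift using Cons.IH[OF _ True] by (simp only: add_0)
  next
    case False
    then have "(\<Sum>j\<le>length ks. if length ?p + sum_list (take j ks) = r
        then \<Psi> (?p @ block_word (take j ks)) (block_word (drop j ks)) else 0) = 0"
      by (intro sum.neutral) auto
    moreover have "hd (drop r (p @ block_word (k # ks)) @ [P1]) = P0" if ne: "length p \<noteq> r"
    proof -
      obtain m where m: "r - length p = Suc m" "m < k - 1"
        using ne Cons.prems False k by (cases "r - length p") auto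
      then show ?thesis
        using Cons.prems(2) by simp
    qed
    moreover have "r \<le> length (p @ block_word (k # ks))"
      using False by simp
    ultimately show ?thesis
      using Cons.prems(2) unfolding shift by auto
  qed
qed auto

text \<open>The cut is followed by a 0 exactly if it lies inside a block, after its 1; the index j
  names that block, counted from 0.\<close>

lemma cut_at_zero:
  fixes \<Psi> :: "letter list \<Rightarrow> letter list \<Rightarrow> 'v::comm_monoid_add"
  assumes "\<forall>k\<in>set ks. k \<ge> 1" "length p \<le> r"
  shows "(if r \<le> length (p @ block_word ks) \<and> hd (drop r (p @ block_word ks) @ [P1]) = P0
      then \<Psi> (take r (p @ block_word ks)) (drop r (p @ block_word ks)) else 0) =
    (\<Sum>j<length ks. if length p + sum_list (take j ks) + 1 \<le> r \<and>
        r < length p + sum_list (take (Suc j) ks)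
      then \<Psi> (p @ block_word (take j ks) @ P1 # replicate (r - (length p + sum_list (take j ks) + 1)) P0)
        (replicate (length p + sum_list (take (Suc j) ks) - r) P0 @ block_word (drop (Suc j) ks))
      else 0)"
  using assms
proof (induction ks arbitrary: p)
  case (Cons k ks)
  let ?p = "p @ P1 # replicate (k - 1) P0"
  have k: "k \<ge> 1" using Cons.prems by simp
  let ?T = "\<lambda>p ks j. if length p + sum_list (take j ks) + 1 \<le> r \<and>
        r < length p + sum_list (take (Suc j) ks)
      then \<Psi> (p @ block_word (take j ks) @ P1 # replicate (r - (length p + sum_list (take j ks) + 1)) P0)
        (replicate (length p + sum_list (take (Suc j) ks) - r) P0 @ block_word (drop (Suc j) ks))
      else 0"
  have shift: "(\<Sum>j<length (k # ks). ?T p (k # ks) j) = ?T p (k # ks) 0 + (\<Sum>j<length ks. ?T ?p ks j)"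
    unfolding length_Cons sum.lessThan_Suc_shift using k
    by (intro arg_cong2[of _ _ _ _ "(+)"] sum.cong) (simp_all add: add.assoc)
  show ?case
  proof (cases "length ?p \<le> r")
    case True
    then have "?T p (k # ks) 0 = 0" using k by auto
    moreover have "?p @ block_word ks = p @ block_word (k # ks)" by simp
    moreover have "\<forall>k\<in>set ks. k \<ge> 1" using Cons.prems by simp
    ultimately show ?thesis
      unfolding shift using Cons.IH[OF _ True] by (simp only: add_0)
  next
    case False
    then have zero: "(\<Sum>j<length ks. ?T ?p ks j) = 0"
      by (intro sum.neutral) auto
    show ?thesis
    proof (cases "length p = r")
      case True
      then show ?thesis unfolding shift zero by simp
    next
      case ne: False
      then obtain m where m: "r - length p = Suc m" "m < k - 1"
        using Cons.prems False k by (cases "r - length p") auto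
      then have r: "r = length p + Suc m" using Cons.prems(2) by simp
      have "k - Suc 0 - m = length p + k - r" using r by simp
      then show ?thesis
        unfolding shift zero using m(2) by (auto simp: r min_def)
    qed
  qed
qed auto

section \<open>Cuts of composition words\<close>

primrec prepend_word :: "letter list \<Rightarrow> (motL, word_alg) tensor \<Rightarrow> (motL, word_alg) tensor" where
  "prepend_word [] t = t"
| "prepend_word (x # u) t = prepend_right x (prepend_word u t)"

lemma rat_linear_prepend_word: "rat_linear (prepend_word u)"
  by (induction u) (auto intro: rat_linear_id rat_linear_compose rat_linear_prepend_right)

lemma prepend_word_tensor [simp]: "prepend_word u (c \<otimes>\<^sub>Q basis v) = c \<otimes>\<^sub>Q basis (u @ v)"
  by (induction u) simp_all

text \<open>The terms of \<open>gap_sum\<close> whose gap starts at a letter of the word itself;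
  unlike \<open>gap_sum\<close>, they do not depend on the left end point.\<close>

definition gap_step ::
  "(letter \<Rightarrow> letter list \<Rightarrow> letter \<Rightarrow> motL) \<Rightarrow> nat \<Rightarrow> letter \<Rightarrow> letter list \<Rightarrow> (motL, word_alg) tensor"
  where "gap_step \<mu> r b w = (case w of [] \<Rightarrow> 0 | x # v \<Rightarrow> prepend_right x (gap_sum \<mu> r x b v))"

lemma gap_step_simps [simp]:
  "gap_step \<mu> r b [] = 0"
  "gap_step \<mu> r b (x # v) = prepend_right x (gap_sum \<mu> r x b v)"
  by (simp_all add: gap_step_def)

lemma gap_sum_eq: "r \<ge> 1 \<Longrightarrow> gap_sum \<mu> r a b w = gap_cut \<mu> r a b w + gap_step \<mu> r b w"
  by (cases w) (simp_all add: gap_cut_eq)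

lemma gap_step_zeros:
  assumes "r \<ge> 1"
  shows "gap_step \<mu> r b (replicate n P0 @ v) =
    (\<Sum>m<n. prepend_word (replicate (Suc m) P0) (gap_cut \<mu> r P0 b (replicate (n - Suc m) P0 @ v))) +
    prepend_word (replicate n P0) (gap_step \<mu> r b v)"
proof (induction n)
  case (Suc n)
  then show ?case
    by (simp add: gap_sum_eq[OF assms] sum.lessThan_Suc_shift rat_linear_add[OF rat_linear_prepend_right]
        rat_linear_sum[OF rat_linear_prepend_right] add.assoc del: sum.lessThan_Suc)
qed simp

lemma letter_01: "set w \<subseteq> {P0, P1} \<Longrightarrow> hd (w @ [P1]) = P0 \<or> hd (w @ [P1]) = P1"
  by (cases w) auto

text \<open>A gap from 0 to 0 vanishes, so the gap ends at a 1, that is at a block boundary. A gap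
  consisting of zeros only has class zero, hence \<open>Suc j\<close>.\<close>

lemma gap_cut_from_zero:
  assumes ks: "\<forall>k\<in>set ks. k \<ge> 1" and r: "odd r"
  shows "gap_cut double_gap r P0 P1 (replicate n P0 @ block_word ks) =
    (\<Sum>j<length ks. if n + sum_list (take (Suc j) ks) = r
      then double_class (replicate n P0 @ block_word (take (Suc j) ks)) \<otimes>\<^sub>Q
        basis (block_word (drop (Suc j) ks)) else 0)"
proof -
  let ?w = "replicate n P0 @ block_word ks"
  let ?\<Psi> = "\<lambda>u v. double_class u \<otimes>\<^sub>Q (basis v :: word_alg)"
  have sub: "set (take r ?w) \<subseteq> {P0, P1}" "set (drop r ?w) \<subseteq> {P0, P1}"
    using set_block_word[of ks] set_take_subset[of r ?w] set_drop_subset[of r ?w] by auto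
  have "gap_cut double_gap r P0 P1 ?w = (if r \<le> length ?w \<and> hd (drop r ?w @ [P1]) = P1
      then ?\<Psi> (take r ?w) (drop r ?w) else 0)"
  proof (cases "r \<le> length ?w")
    case True
    then have len: "length (take r ?w) = r"
      by (simp only: length_take min_absorb2)
    have "odd (length (take r ?w))" unfolding len by (rule r)
    then show ?thesis
      using letter_01[OF sub(2)] True double_gap_eq[OF sub(1)] by (auto simp only: gap_cut_eq) simp_all
  qed (simp add: gap_cut_eq)
  also have "\<dots> = (\<Sum>j<length ks. if n + sum_list (take (Suc j) ks) = r
      then ?\<Psi> (replicate n P0 @ block_word (take (Suc j) ks)) (block_word (drop (Suc j) ks)) else 0)"
  proof (cases "n \<le> r")
    case True
    have "(\<Sum>j\<le>length ks. f j) = f 0 + (\<Sum>j<length ks. f (Suc j))"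
      for f :: "nat \<Rightarrow> (motL, word_alg) tensor"
      unfolding lessThan_Suc_atMost[symmetric] by (rule sum.lessThan_Suc_shift)
    then show ?thesis
      using cut_at_one[OF ks, of "replicate n P0" r ?\<Psi>] True
      by (simp add: double_class_zeros)
  next
    case False
    then have "hd (drop r ?w @ [P1]) = P0" by simp
    then show ?thesis
      using False by (subst sum.neutral) auto
  qed
  finally show ?thesis .
qed

text \<open>A gap from 1 to 1 vanishes, so the gap ends at a 0 inside a block. Path reversal yields
  the reversed word and the minus sign.\<close>

lemma gap_cut_from_one:
  assumes ks: "\<forall>k\<in>set ks. k \<ge> 1" and r: "odd r"
  shows "gap_cut double_gap r P1 P1 (replicate n P0 @ block_word ks) =
    - (\<Sum>j<length ks. if n + sum_list (take j ks) + 1 \<le> r \<and> r < n + sum_list (take (Suc j) ks)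
      then double_class (rev (replicate n P0 @ block_word (take j ks) @
          P1 # replicate (r - (n + sum_list (take j ks) + 1)) P0)) \<otimes>\<^sub>Q
        basis (replicate (n + sum_list (take (Suc j) ks) - r) P0 @ block_word (drop (Suc j) ks))
      else 0)"
proof -
  let ?w = "replicate n P0 @ block_word ks"
  let ?\<Psi> = "\<lambda>u v. double_class (rev u) \<otimes>\<^sub>Q (basis v :: word_alg)"
  have sub: "set (take r ?w) \<subseteq> {P0, P1}" "set (drop r ?w) \<subseteq> {P0, P1}"
    using set_block_word[of ks] set_take_subset[of r ?w] set_drop_subset[of r ?w] by auto
  have "gap_cut double_gap r P1 P1 ?w = - (if r \<le> length ?w \<and> hd (drop r ?w @ [P1]) = P0
      then ?\<Psi> (take r ?w) (drop r ?w) else 0)"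
  proof (cases "r \<le> length ?w")
    case True
    then have len: "length (take r ?w) = r"
      by (simp only: length_take min_absorb2)
    have "odd (length (take r ?w))" unfolding len by (rule r)
    then show ?thesis
      using letter_01[OF sub(2)] True double_gap_eq[OF sub(1)]
      by (auto simp only: gap_cut_eq) (simp_all add: rat_linear_neg[OF rat_linear_tensor(2)])
  qed (simp add: gap_cut_eq)
  also have "(if r \<le> length ?w \<and> hd (drop r ?w @ [P1]) = P0
      then ?\<Psi> (take r ?w) (drop r ?w) else 0) =
    (\<Sum>j<length ks. if n + sum_list (take j ks) + 1 \<le> r \<and> r < n + sum_list (take (Suc j) ks)
      then ?\<Psi> (replicate n P0 @ block_word (take j ks) @
          P1 # replicate (r - (n + sum_list (take j ks) + 1)) P0)
        (replicate (n + sum_list (take (Suc j) ks) - r) P0 @ block_word (drop (Suc j) ks))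
      else 0)"
  proof (cases "n \<le> r")
    case True
    then show ?thesis
      using cut_at_zero[OF ks, of "replicate n P0" r ?\<Psi>, unfolded length_replicate] by simp
  next
    case False
    \<comment> \<open>The gap ends among the leading zeros; its class is zero, and no j on the right
      meets the bounds.\<close>
    then have "take r ?w = replicate r P0" by (simp add: min_def)
    then show ?thesis
      using False by (subst sum.neutral) (auto simp: double_class_zeros)
  qed
  finally show ?thesis .
qed

section \<open>Slices of a composition and the cuts indexed by them\<close>

lemma slice_Cons: "1 \<le> a \<Longrightarrow> slice (k # ks) (Suc a) (Suc b) = slice ks a b"
  unfolding slice_def map_Suc_upt[symmetric, of a "Suc b"] map_map
  by (rule map_cong) (auto simp: nth_Cons')

lemma slice_Cons_1: "slice (k # ks) 1 (Suc j) = k # slice ks 1 j"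
proof -
  have "[1..<Suc (Suc j)] = 1 # [Suc 1..<Suc (Suc j)]" by (rule upt_conv_Cons) simp
  then have "slice (k # ks) 1 (Suc j) = k # slice (k # ks) (Suc 1) (Suc j)"
    by (simp add: slice_def)
  then show ?thesis by (simp only: slice_Cons)
qed

lemma slice_take: "j \<le> length ks \<Longrightarrow> slice ks 1 j = take j ks"
proof (induction ks arbitrary: j)
  case (Cons k ks)
  show ?case
  proof (cases j)
    case (Suc m)
    then show ?thesis using Cons by (simp only: slice_Cons_1) simp
  qed (simp add: slice_def)
qed (simp add: slice_def)

lemma slice_drop: "slice ks (j + 1) (length ks) = drop j ks"
proof (induction ks arbitrary: j)
  case (Cons k ks)
  show ?case
  proof (cases j)
    case 0
    then show ?thesis by (simp add: slice_take[of "length (k # ks)" "k # ks", simplified])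
  next
    case (Suc m)
    then show ?thesis using Cons[of m] slice_Cons[of "m + 1" k ks "length ks"] by simp
  qed
qed (simp add: slice_def)

lemma length_slice: "length (slice ks i j) = Suc j - i"
  by (simp add: slice_def del: upt_Suc)

lemma set_slice: "1 \<le> i \<Longrightarrow> j \<le> length ks \<Longrightarrow> set (slice ks i j) \<subseteq> set ks"
  by (auto simp: slice_def intro!: nth_mem)

text \<open>The pairs with i = 1 are the gaps starting in the first block, the others are left to
  the induction. The shift in \<open>j + 2\<close> arises because blocks after the first are counted
  from 0.\<close>

lemma sum_pairs:
  fixes f :: "nat \<Rightarrow> nat \<Rightarrow> 'v::comm_monoid_add"
  shows "(\<Sum>(i, j)\<in>{(i, j). 1 \<le> i \<and> i < j \<and> j \<le> Suc d}. f i j) =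
    (\<Sum>j<d. f 1 (j + 2)) + (\<Sum>(i, j)\<in>{(i, j). 1 \<le> i \<and> i < j \<and> j \<le> d}. f (Suc i) (Suc j))"
proof -
  let ?A = "(\<lambda>j. (1, j + 2)) ` {..<d}"
  let ?P = "{(i, j). 1 \<le> i \<and> i < j \<and> j \<le> d}"
  let ?B = "(\<lambda>(i, j). (Suc i, Suc j)) ` ?P"
  have fin: "finite ?P" by (rule finite_subset[of _ "{..d} \<times> {..d}"]) auto
  have "{(i, j). 1 \<le> i \<and> i < j \<and> j \<le> Suc d} = ?A \<union> ?B"
  proof (intro equalityI subsetI)
    fix p assume "p \<in> {(i, j). 1 \<le> i \<and> i < j \<and> j \<le> Suc d}"
    then obtain i j where p: "p = (i, j)" "1 \<le> i" "i < j" "j \<le> Suc d" by auto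
    show "p \<in> ?A \<union> ?B"
    proof (cases "i = 1")
      case True
      then have "p = (1, (j - 2) + 2)" "j - 2 < d" using p by auto
      then show ?thesis by blast
    next
      case False
      then have "p = (Suc (i - 1), Suc (j - 1))" "(i - 1, j - 1) \<in> ?P" using p by auto
      then show ?thesis by (auto intro!: image_eqI[of _ _ "(i - 1, j - 1)"])
    qed
  qed auto
  moreover have "?A \<inter> ?B = {}" by auto
  ultimately have "(\<Sum>(i, j)\<in>{(i, j). 1 \<le> i \<and> i < j \<and> j \<le> Suc d}. f i j) =
      (\<Sum>(i, j)\<in>?A. f i j) + (\<Sum>(i, j)\<in>?B. f i j)"
    using fin by (simp add: sum.union_disjoint)
  also have "(\<Sum>(i, j)\<in>?A. f i j) = (\<Sum>j<d. f 1 (j + 2))"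
    by (subst sum.reindex) (auto simp: inj_on_def)
  also have "(\<Sum>(i, j)\<in>?B. f i j) = (\<Sum>(i, j)\<in>?P. f (Suc i) (Suc j))"
    by (subst sum.reindex) (auto simp: inj_on_def case_prod_beta')
  finally show ?thesis .
qed

definition rest_slices :: "nat list \<Rightarrow> nat \<Rightarrow> nat \<Rightarrow> nat \<Rightarrow> nat list" where
  "rest_slices ks r i j =
     slice ks 1 (i - 1) @ [sum_list (slice ks i j) - r] @ slice ks (j + 1) (length ks)"

text \<open>One term of the last two sums of the theorem before signs are attached; ls lists the
  arguments of the zeta value. The merged block keeps its 1 and the 0 at one end of the gap, so its
  length is at least 2: this is the strict upper bound on r.\<close>

definition block_cut :: "nat \<Rightarrow> nat list \<Rightarrow> nat list \<Rightarrow> nat \<Rightarrow> nat \<Rightarrow> (motL, word_alg) tensor" where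
  "block_cut r ks ls i j =
     (if sum_list ls \<le> r \<and> r < sum_list (slice ks i j) - 1
      then double_class (replicate (r - sum_list ls) P0 @ block_word ls)
        \<otimes>\<^sub>Q basis (block_word (rest_slices ks r i j)) else 0)"

abbreviation right_cut :: "nat \<Rightarrow> nat list \<Rightarrow> nat \<Rightarrow> nat \<Rightarrow> (motL, word_alg) tensor" where
  "right_cut r ks i j \<equiv> block_cut r ks (slice ks (i + 1) j) i j"

abbreviation left_cut :: "nat \<Rightarrow> nat list \<Rightarrow> nat \<Rightarrow> nat \<Rightarrow> (motL, word_alg) tensor" where
  "left_cut r ks i j \<equiv> block_cut r ks (rev (slice ks i (j - 1))) i j"

lemma rest_slices_Cons:
  assumes "1 \<le> i" "i < j"
  shows "rest_slices (k # ks) r (Suc i) (Suc j) = k # rest_slices ks r i j"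
proof -
  obtain i' where i: "i = Suc i'" using assms by (cases i) auto
  show ?thesis
    using slice_Cons[of "j + 1" k ks "length ks"] slice_Cons[of i k ks j] assms
    by (simp add: rest_slices_def i slice_Cons_1[of k ks i', simplified])
qed

lemma block_cut_Cons:
  "1 \<le> i \<Longrightarrow> i < j \<Longrightarrow> block_cut r (k # ks) ls (Suc i) (Suc j) =
    prepend_word (P1 # replicate (k - 1) P0) (block_cut r ks ls i j)"
  using slice_Cons[of i k ks j]
  by (simp add: block_cut_def rest_slices_Cons rat_linear_0[OF rat_linear_prepend_word]
      rat_linear_0[OF rat_linear_prepend_right])

lemma right_cut_Cons:
  "1 \<le> i \<Longrightarrow> i < j \<Longrightarrow>
    right_cut r (k # ks) (Suc i) (Suc j) = prepend_word (P1 # replicate (k - 1) P0) (right_cut r ks i j)"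
  using slice_Cons[of "i + 1" k ks j] by (simp only: block_cut_Cons) simp

lemma left_cut_Cons:
  assumes "1 \<le> i" "i < j"
  shows "left_cut r (k # ks) (Suc i) (Suc j) =
    prepend_word (P1 # replicate (k - 1) P0) (left_cut r ks i j)"
proof -
  obtain j' where j: "j = Suc j'" using assms by (cases j) auto
  show ?thesis
    using slice_Cons[of i k ks j'] assms unfolding j by (simp only: block_cut_Cons) simp
qed

lemma rest_slices_1:
  assumes "j < length ks"
  shows "rest_slices (k # ks) r 1 (j + 2) = (k + sum_list (take (Suc j) ks) - r) # drop (Suc j) ks"
proof -
  have "slice (k # ks) 1 (Suc (Suc j)) = k # take (Suc j) ks"
    using assms by (simp only: slice_Cons_1 slice_take Suc_le_eq)
  moreover have "slice (k # ks) (Suc (Suc j) + 1) (length (k # ks)) = drop (Suc j) ks"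
    by (simp only: slice_drop drop_Suc_Cons)
  ultimately show ?thesis
    by (simp add: rest_slices_def slice_def[of _ "Suc 0" 0])
qed

text \<open>Gaps that start at the 1 of the first block give the left cuts with i = 1, gaps that
  start at one of its zeros give the right cuts with i = 1, and all later gaps come from the
  induction hypothesis.\<close>

lemma gap_step_block_word:
  assumes "\<forall>k\<in>set ks. k \<ge> 1" and r: "odd r"
  shows "gap_step double_gap r P1 (block_word ks) =
    (\<Sum>(i, j)\<in>{(i, j). 1 \<le> i \<and> i < j \<and> j \<le> length ks}. right_cut r ks i j) -
    (\<Sum>(i, j)\<in>{(i, j). 1 \<le> i \<and> i < j \<and> j \<le> length ks}. left_cut r ks i j)"
  using assms(1)
proof (induction ks)
  case Nil
  have empty: "{(i, j). 1 \<le> i \<and> i < j \<and> j \<le> length ([] :: nat list)} = {}" by auto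
  show ?case unfolding empty by simp
next
  case (Cons k ks)
  let ?n = "k - 1"
  let ?S = "gap_step double_gap r P1 (block_word ks)"
  let ?u = "P1 # replicate ?n P0"
  let ?\<sigma> = "\<lambda>j. sum_list (take j ks)"
  have k: "k \<ge> 1" and ks: "\<forall>k\<in>set ks. k \<ge> 1" using Cons.prems by auto
  have r1: "r \<ge> 1" using r by (cases r) auto
  have pairs: "{(i, j). 1 \<le> i \<and> i < j \<and> j \<le> length (k # ks)} =
      {(i, j). 1 \<le> i \<and> i < j \<and> j \<le> Suc (length ks)}"
    by simp
  have "gap_step double_gap r P1 (block_word (k # ks)) =
      prepend_right P1 (gap_cut double_gap r P1 P1 (replicate ?n P0 @ block_word ks)) +
      prepend_right P1 (\<Sum>m<?n. prepend_word (replicate (Suc m) P0)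
        (gap_cut double_gap r P0 P1 (replicate (?n - Suc m) P0 @ block_word ks))) +
      prepend_word ?u ?S"
    by (simp add: gap_sum_eq[OF r1] gap_step_zeros[OF r1] rat_linear_add[OF rat_linear_prepend_right]
        add.assoc)
  also have "prepend_right P1 (gap_cut double_gap r P1 P1 (replicate ?n P0 @ block_word ks)) =
      - (\<Sum>j<length ks. left_cut r (k # ks) 1 (j + 2))"
  proof -
    have "(if ?n + ?\<sigma> j + 1 \<le> r \<and> r < ?n + ?\<sigma> (Suc j)
        then double_class (rev (replicate ?n P0 @ block_word (take j ks) @
            P1 # replicate (r - (?n + ?\<sigma> j + 1)) P0)) \<otimes>\<^sub>Q
          basis (P1 # replicate (?n + ?\<sigma> (Suc j) - r) P0 @ block_word (drop (Suc j) ks))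
        else 0) = left_cut r (k # ks) 1 (j + 2)" if j: "j < length ks" for j
    proof -
      have 1: "slice (k # ks) 1 (Suc j) = k # take j ks"
        using j by (simp only: slice_Cons_1 slice_take less_imp_le)
      have 2: "slice (k # ks) 1 (Suc (Suc j)) = k # take (Suc j) ks"
        using j by (simp only: slice_Cons_1 slice_take Suc_le_eq)
      have 3: "?n + ?\<sigma> j + 1 = k + ?\<sigma> j" "?n + ?\<sigma> (Suc j) = k + ?\<sigma> (Suc j) - 1"
        "k + ?\<sigma> (Suc j) - 1 - r = k + ?\<sigma> (Suc j) - r - 1"
        using k by auto
      show ?thesis
        unfolding block_cut_def rest_slices_1[OF j] rev_zeros_block_word 3 using 1 2
        by (simp del: rev.simps block_word_simps(3))
    qed
    then show ?thesis
      unfolding gap_cut_from_one[OF ks r] rat_linear_neg[OF rat_linear_prepend_right]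
        rat_linear_sum[OF rat_linear_prepend_right]
      by (intro arg_cong[of _ _ uminus] sum.cong refl)
        (simp add: rat_linear_0[OF rat_linear_prepend_right] if_distrib[of "prepend_right _"] cong: if_cong)
  qed
  also have "prepend_right P1 (\<Sum>m<?n. prepend_word (replicate (Suc m) P0)
        (gap_cut double_gap r P0 P1 (replicate (?n - Suc m) P0 @ block_word ks))) =
      (\<Sum>j<length ks. right_cut r (k # ks) 1 (j + 2))"
  proof -
    \<comment> \<open>Here l counts the zeros of the first block inside the gap, so k - l is the
      length of the merged block.\<close>
    define g where "g = (\<lambda>j l. if l + ?\<sigma> (Suc j) = r
      then double_class (replicate l P0 @ block_word (take (Suc j) ks)) \<otimes>\<^sub>Q
        (basis (block_word ((k - l) # drop (Suc j) ks)) :: word_alg) else 0)"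
    have "prepend_right P1 (prepend_word (replicate (Suc m) P0)
        (gap_cut double_gap r P0 P1 (replicate (?n - Suc m) P0 @ block_word ks))) =
        (\<Sum>j<length ks. g j (?n - Suc m))" if m: "m < ?n" for m
    proof -
      have "k - (?n - Suc m) - 1 = Suc m" using m by simp
      moreover have lin: "rat_linear (prepend_word (P1 # replicate (Suc m) P0))"
        by (rule rat_linear_prepend_word)
      ultimately show ?thesis
        unfolding prepend_word.simps(2)[symmetric] gap_cut_from_zero[OF ks r] rat_linear_sum[OF lin]
        by (intro sum.cong refl)
          (simp add: g_def rat_linear_0[OF lin] if_distrib[of "prepend_word _"]
            del: prepend_word.simps replicate_Suc cong: if_cong)
    qed
    then have "prepend_right P1 (\<Sum>m<?n. prepend_word (replicate (Suc m) P0)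
        (gap_cut double_gap r P0 P1 (replicate (?n - Suc m) P0 @ block_word ks))) =
        (\<Sum>m<?n. \<Sum>j<length ks. g j (?n - Suc m))"
      by (simp add: rat_linear_sum[OF rat_linear_prepend_right] del: prepend_word.simps replicate_Suc)
    also have "\<dots> = (\<Sum>j<length ks. \<Sum>m<?n. g j (?n - Suc m))"
      by (rule sum.swap)
    also have "\<dots> = (\<Sum>j<length ks. right_cut r (k # ks) 1 (j + 2))"
    proof (rule sum.cong[OF refl])
      fix j assume "j \<in> {..<length ks}"
      then have j: "j < length ks" by simp
      have 1: "slice (k # ks) (1 + 1) (Suc (Suc j)) = take (Suc j) ks"
        using slice_Cons[of 1 k ks "Suc j"] slice_take[of "Suc j" ks] j by simp
      have 2: "slice (k # ks) 1 (Suc (Suc j)) = k # take (Suc j) ks"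
        using j by (simp only: slice_Cons_1 slice_take Suc_le_eq)
      have "(\<Sum>m<?n. g j (?n - Suc m)) = (\<Sum>l<?n. g j l)"
        by (rule sum.nat_diff_reindex)
      \<comment> \<open>The length r of the gap determines l, so at most one starting point
        contributes for each j.\<close>
      also have "\<dots> = (\<Sum>l<?n. if l = r - ?\<sigma> (Suc j)
          then (if ?\<sigma> (Suc j) \<le> r then g j l else 0) else 0)"
        by (intro sum.cong) (auto simp: g_def)
      also have "\<dots> = (if r - ?\<sigma> (Suc j) < ?n \<and> ?\<sigma> (Suc j) \<le> r then g j (r - ?\<sigma> (Suc j)) else 0)"
        by (simp add: sum.delta)
      also have "\<dots> = right_cut r (k # ks) 1 (j + 2)"
      proof -
        have "r - ?\<sigma> (Suc j) < ?n \<and> ?\<sigma> (Suc j) \<le> r \<longleftrightarrow>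
            ?\<sigma> (Suc j) \<le> r \<and> r < k + ?\<sigma> (Suc j) - 1"
          by auto
        moreover have "k - (r - ?\<sigma> (Suc j)) = k + ?\<sigma> (Suc j) - r" if "?\<sigma> (Suc j) \<le> r"
          using that by auto
        ultimately show ?thesis
          unfolding block_cut_def rest_slices_1[OF j] using 1 2
          by (simp add: g_def del: block_word_simps cong: if_cong)
      qed
      finally show "(\<Sum>m<?n. g j (?n - Suc m)) = right_cut r (k # ks) 1 (j + 2)" .
    qed
    finally show ?thesis .
  qed
  also have "prepend_word ?u ?S =
      (\<Sum>(i, j)\<in>{(i, j). 1 \<le> i \<and> i < j \<and> j \<le> length ks}. right_cut r (k # ks) (Suc i) (Suc j)) -
      (\<Sum>(i, j)\<in>{(i, j). 1 \<le> i \<and> i < j \<and> j \<le> length ks}. left_cut r (k # ks) (Suc i) (Suc j))"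
    unfolding Cons.IH[OF ks] rat_linear_diff[OF rat_linear_prepend_word]
      rat_linear_sum[OF rat_linear_prepend_word]
    by (intro arg_cong2[of _ _ _ _ "(-)"] sum.cong refl; clarify)
      (simp_all only: prod.case right_cut_Cons left_cut_Cons)
  finally show ?case
    unfolding pairs sum_pairs by (simp add: algebra_simps)
qed

section \<open>Motivic multiple t values\<close>

lemma zeta_word_Cons:
  "zeta_word 0 (e # es) (k # ks) =
     sign_letter (prod_list (e # es)) # replicate (k - 1) P0 @ zeta_word 0 es ks"
proof -
  have "[0..<length (k # ks)] = 0 # map Suc [0..<length ks]"
    by (simp add: map_Suc_upt upt_conv_Cons del: upt_Suc)
  then show ?thesis
    unfolding zeta_word_def by (simp add: comp_def del: upt_Suc)
qed

lemma zeta_word_zeros: "zeta_word l es ks = replicate l P0 @ zeta_word 0 es ks"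
  by (simp add: zeta_word_def)

lemma zeta_word_ones: "zeta_word l (replicate (length ks) 1) ks = replicate l P0 @ block_word ks"
proof -
  have "zeta_word 0 (replicate (length ks) 1) ks = block_word ks"
  proof (induction ks)
    case (Cons k ks)
    then show ?case
      by (simp add: zeta_word_Cons sign_letter_def prod_list_replicate)
  qed (simp add: zeta_word_def)
  then show ?thesis by (subst zeta_word_zeros) simp
qed

definition sign_lists :: "nat \<Rightarrow> int list set" where
  "sign_lists n = {es. length es = n \<and> set es \<subseteq> {1, - 1}}"

lemma sum_sign_lists_Suc:
  "(\<Sum>es\<in>sign_lists (Suc n). f es) = (\<Sum>es\<in>sign_lists n. f (1 # es) + f (- 1 # es))"
proof -
  have "sign_lists (Suc n) = (#) 1 ` sign_lists n \<union> (#) (- 1) ` sign_lists n"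
    by (auto simp: sign_lists_def length_Suc_conv)
  moreover have "finite (sign_lists n)"
    unfolding sign_lists_def using finite_lists_length_eq[of "{1, - 1 :: int}" n]
    by (simp add: conj_commute)
  ultimately show ?thesis
    by (subst sum.distrib, simp, subst sum.union_disjoint) (auto simp: sum.reindex)
qed

lemma sum_sign_lists_0: "(\<Sum>es\<in>sign_lists 0. f es) = f []"
proof -
  have "sign_lists 0 = {[]}" by (auto simp: sign_lists_def)
  then show ?thesis by simp
qed

lemma prod_sign_list: "es \<in> sign_lists n \<Longrightarrow> prod_list es = 1 \<or> prod_list es = - 1"
  unfolding sign_lists_def by (induction es arbitrary: n) auto

lemma lin_ext_double_zeros:
  "lin_ext f (double (replicate n P0 @ w)) = 2 ^ n *\<^sub>Q lin_ext (\<lambda>v. f (replicate n P0 @ v)) (double w)"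
proof (induction n arbitrary: f)
  case (Suc n)
  show ?case
    unfolding replicate_Suc append_Cons lin_ext_subst_Cons Suc
    by (simp add: scaleQ_scaleQ)
qed (simp add: scaleQ_one)

lemma sum_list_ge_length: "\<forall>k\<in>set ks. k \<ge> (1 :: nat) \<Longrightarrow> length ks \<le> sum_list ks"
  by (induction ks) auto

lemma power_two_Cons:
  assumes "\<forall>k\<in>set (k # ks). k \<ge> 1"
  shows "(2 :: rat) ^ (sum_list (k # ks) - length (k # ks)) = 2 ^ (k - 1) * 2 ^ (sum_list ks - length ks)"
proof -
  have "sum_list (k # ks) - length (k # ks) = (k - 1) + (sum_list ks - length ks)"
    using assms sum_list_ge_length[of ks] by simp
  then show ?thesis by (simp only: power_add)
qed

text \<open>For fixed later signs, the tail product \<eta>_i runs through both signs as \<epsilon>_i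
  does, which replaces each 1 by 1 + (-1). The exponent |k| - d is the number of zeros in the word,
  each of which is doubled.\<close>

lemma sum_signs_double:
  assumes "\<forall>k\<in>set ks. k \<ge> 1"
  shows "2 ^ (sum_list ks - length ks) *\<^sub>Q (\<Sum>es\<in>sign_lists (length ks). f (zeta_word 0 es ks)) =
    lin_ext f (double (block_word ks))"
  using assms
proof (induction ks arbitrary: f)
  case Nil
  show ?case by (simp add: sum_sign_lists_0 zeta_word_def scaleQ_one)
next
  case (Cons k ks)
  let ?g = "\<lambda>y v. f (y # replicate (k - 1) P0 @ v)"
  let ?c = "2 ^ (sum_list ks - length ks) :: rat"
  have "f (zeta_word 0 (1 # es) (k # ks)) + f (zeta_word 0 (- 1 # es) (k # ks)) =
      ?g P1 (zeta_word 0 es ks) + ?g Pm1 (zeta_word 0 es ks)" if "es \<in> sign_lists (length ks)" for es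
    using prod_sign_list[OF that] by (auto simp: zeta_word_Cons sign_letter_def)
  then have "(\<Sum>es\<in>sign_lists (length (k # ks)). f (zeta_word 0 es (k # ks))) =
      (\<Sum>es\<in>sign_lists (length ks). ?g P1 (zeta_word 0 es ks)) +
      (\<Sum>es\<in>sign_lists (length ks). ?g Pm1 (zeta_word 0 es ks))"
    by (simp add: sum_sign_lists_Suc flip: sum.distrib)
  then have "2 ^ (sum_list (k # ks) - length (k # ks)) *\<^sub>Q
        (\<Sum>es\<in>sign_lists (length (k # ks)). f (zeta_word 0 es (k # ks))) =
      2 ^ (k - 1) *\<^sub>Q (lin_ext (?g P1) (double (block_word ks)) + lin_ext (?g Pm1) (double (block_word ks)))"
    unfolding power_two_Cons[OF Cons.prems] scaleQ_scaleQ[symmetric]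
    using Cons.prems by (simp add: scaleQ_add_right Cons.IH[symmetric])
  also have "\<dots> = lin_ext f (double (block_word (k # ks)))"
    unfolding block_word_simps lin_ext_subst_Cons lin_ext_double_zeros
    by (simp add: scaleQ_one scaleQ_add_right)
  finally show ?case .
qed

text \<open>The product of all \<epsilon>_i is \<eta>_1, so the sign is the value of the first
  letter of the word and leaves the other letters alone.\<close>

lemma sum_signs_signed_double:
  assumes "\<forall>k\<in>set ks. k \<ge> 1"
  shows "2 ^ (sum_list ks - length ks) *\<^sub>Q
      (\<Sum>es\<in>sign_lists (length ks). of_int (prod_list es) *\<^sub>Q f (zeta_word 0 es ks)) =
    lin_ext f (signed_double (block_word ks))"
proof (cases ks)
  case Nil
  then show ?thesis by (simp add: sum_sign_lists_0 zeta_word_def scaleQ_one)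
next
  case (Cons k ls)
  let ?g = "\<lambda>y v. f (y # replicate (k - 1) P0 @ v)"
  have ls: "\<forall>k\<in>set ls. k \<ge> 1" and kls: "\<forall>k\<in>set (k # ls). k \<ge> 1" using assms Cons by auto
  have "of_int (prod_list (1 # es)) *\<^sub>Q f (zeta_word 0 (1 # es) (k # ls)) +
      of_int (prod_list (- 1 # es)) *\<^sub>Q f (zeta_word 0 (- 1 # es) (k # ls)) =
      ?g P1 (zeta_word 0 es ls) - ?g Pm1 (zeta_word 0 es ls)" if "es \<in> sign_lists (length ls)" for es
    using prod_sign_list[OF that] by (auto simp: zeta_word_Cons sign_letter_def scaleQ_one)
  then have "(\<Sum>es\<in>sign_lists (length ks). of_int (prod_list es) *\<^sub>Q f (zeta_word 0 es ks)) =
      (\<Sum>es\<in>sign_lists (length ls). ?g P1 (zeta_word 0 es ls)) -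
      (\<Sum>es\<in>sign_lists (length ls). ?g Pm1 (zeta_word 0 es ls))"
    by (simp add: Cons sum_sign_lists_Suc flip: sum_subtractf)
  then have "2 ^ (sum_list ks - length ks) *\<^sub>Q
        (\<Sum>es\<in>sign_lists (length ks). of_int (prod_list es) *\<^sub>Q f (zeta_word 0 es ks)) =
      2 ^ (k - 1) *\<^sub>Q (lin_ext (?g P1) (double (block_word ls)) - lin_ext (?g Pm1) (double (block_word ls)))"
    unfolding power_two_Cons[OF kls, folded Cons] scaleQ_scaleQ[symmetric]
    by (simp add: ratvs.scale_right_diff_distrib sum_signs_double[OF ls, symmetric])
  also have "\<dots> = lin_ext f (signed_double (block_word ks))"
    by (simp add: Cons lin_ext_diff lin_ext_prepend lin_ext_double_zeros ratvs.scale_right_diff_distrib)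
  finally show ?thesis .
qed

lemma I_mot_from_P0: "I_mot P0 w P1 = motH_of_words (basis w)"
  by (simp add: I_mot_def word_int_from_P0)

lemma t_mot_eq:
  assumes "\<forall>k\<in>set ks. k \<ge> 1"
  shows "t_mot ks = (- 1) ^ length ks *\<^sub>Q motH_of_words (signed_double (block_word ks))"
proof -
  let ?f = "\<lambda>w. (- 1) ^ length ks *\<^sub>Q motH_of_words (basis w)"
  have "t_mot ks = lin_ext ?f (signed_double (block_word ks))"
    unfolding sum_signs_signed_double[OF assms, symmetric]
    by (simp add: t_mot_def sign_lists_def zeta_mot_def I_mot_from_P0)
  also have "\<dots> = (- 1) ^ length ks *\<^sub>Q motH_of_words (lin_ext basis (signed_double (block_word ks)))"
    by (simp add: lin_ext_scale_fun rat_linear_lin_ext_swap[OF rat_linear_motH_of_words])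
  finally show ?thesis by (simp add: lin_ext_id)
qed

lemma t_L_eq:
  "\<forall>k\<in>set ks. k \<ge> 1 \<Longrightarrow> t_L ks = (- 1) ^ length ks *\<^sub>Q lie_class (signed_double (block_word ks))"
  by (simp add: t_L_def t_mot_eq lie_class_def rat_linear_scale[OF rat_linear_motL_of])

text \<open>Weight 1 leaves only l = 0 and the single argument 1. There the depth sign -1 turns the
  log 2 in \<open>double_class\<close> into the - log 2 of the formula.\<close>

lemma zeta_L_eq:
  assumes "\<forall>k\<in>set ks. k \<ge> 1" "ks \<noteq> []" "r = l + sum_list ks"
  shows "zeta_L l (replicate (length ks) 1) ks - (if r = 1 then log2_L else 0) =
    (- 1) ^ length ks *\<^sub>Q double_class (replicate l P0 @ block_word ks)"
proof -
  have log: "log2_L = lie_class (basis [Pm1])"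
    by (simp add: log2_L_def log2_mot_def I_mot_from_P0 lie_class_def)
  have len: "length (replicate l P0 @ block_word ks) = r"
    using assms by (simp add: length_block_word)
  obtain k ls where ks: "ks = k # ls" using assms(2) by (cases ks) auto
  have zeta: "zeta_L l (replicate (length ks) 1) ks =
      (- 1) ^ length ks *\<^sub>Q lie_class (basis (replicate l P0 @ block_word ks))"
    by (simp add: zeta_L_def zeta_mot_def zeta_word_ones I_mot_from_P0 lie_class_def
        rat_linear_scale[OF rat_linear_motL_of])
  show ?thesis
  proof (cases "r = 1")
    case True
    then have "l + (k + sum_list ls) = 1" "k \<ge> 1"
      using assms(1,3) ks by simp_all
    then have "l = 0" "k = 1" "sum_list ls = 0" by linarith+
    moreover have "length ls \<le> sum_list ls"
      using assms(1) ks by (intro sum_list_ge_length) simp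
    ultimately have "length ls = 0" by linarith
    with \<open>l = 0\<close> \<open>k = 1\<close> have "l = 0" "k = 1" "ls = []" by simp_all
    then show ?thesis
      unfolding zeta by (simp add: ks True double_class_def log scaleQ_add_right scaleQ_one)
  next
    case False
    have "replicate l P0 @ block_word ks \<noteq> [P1]"
    proof
      assume *: "replicate l P0 @ block_word ks = [P1]"
      show False using len False unfolding * by simp
    qed
    then show ?thesis
      unfolding zeta double_class_def using False by simp
  qed
qed

lemma D_scale: "r \<ge> 1 \<Longrightarrow> D r (c *\<^sub>Q motH_of_words x) = c *\<^sub>Q D r (motH_of_words x)"
proof -
  assume r: "r \<ge> 1"
  have "rat_linear (tensor_map (\<lambda>x. lie_class (word_weight_part r x)) motH_of_words)"
    by (intro rat_linear_tensor_map rat_linear_motH_of_words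
        rat_linear_compose[OF rat_linear_lie_class rat_linear_word_weight_part])
  then show ?thesis
    unfolding rat_linear_scale[OF rat_linear_motH_of_words, symmetric] D_words[OF r] word_coaction_eq
      lin_ext_scale by (rule rat_linear_scale)
qed

lemma sign_tensor:
  assumes "m + n = d"
  shows "(- 1) ^ d *\<^sub>Q (x \<otimes>\<^sub>Q y) = ((- 1) ^ m *\<^sub>Q x) \<otimes>\<^sub>Q ((- 1) ^ n *\<^sub>Q y)"
  unfolding assms[symmetric]
  by (simp add: tensor_scale_left tensor_scale_right scaleQ_scaleQ power_add)

text \<open>The lists ls and \<open>rest_slices ks r i j\<close> have as many entries together as
  ks, so the depth sign of the t value splits between the two factors.\<close>

lemma sign_block_cut:
  assumes ks: "\<forall>k\<in>set ks. k \<ge> 1" and ij: "1 \<le> i" "i < j" "j \<le> length ks"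
    and ls: "\<forall>k\<in>set ls. k \<ge> 1" "length ls = j - i"
  shows "(- 1) ^ length ks *\<^sub>Q
      tensor_map (\<lambda>x. x) (\<lambda>x. motH_of_words (lin_ext signed_double x)) (block_cut r ks ls i j) =
    (if sum_list ls \<le> r \<and> r < sum_list (slice ks i j) - 1
     then (zeta_L (r - sum_list ls) (replicate (j - i) 1) ls - (if r = 1 then log2_L else 0))
       \<otimes>\<^sub>Q t_mot (rest_slices ks r i j) else 0)"
proof (cases "sum_list ls \<le> r \<and> r < sum_list (slice ks i j) - 1")
  case True
  have "i - 1 \<le> length ks" using ij by simp
  then have "set (rest_slices ks r i j) \<subseteq> set ks \<union> {sum_list (slice ks i j) - r}"
    using set_slice[of 1 "i - 1" ks] set_slice[of "j + 1" "length ks" ks]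
    by (auto simp: rest_slices_def)
  then have rest: "\<forall>k\<in>set (rest_slices ks r i j). k \<ge> 1"
    using ks True by fastforce
  have len: "length ls + length (rest_slices ks r i j) = length ks"
    using ij ls(2) by (simp add: rest_slices_def length_slice)
  have "ls \<noteq> []" "r = r - sum_list ls + sum_list ls"
    using ls(2) ij True by auto
  note zeta = zeta_L_eq[OF ls(1) this, unfolded ls(2)]
  show ?thesis
    unfolding block_cut_def if_P[OF True] zeta t_mot_eq[OF rest]
    unfolding ls(2)[symmetric] sign_tensor[OF len, symmetric]
    by (simp add: rat_linear_id rat_linear_compose[OF rat_linear_motH_of_words rat_linear_lin_ext])
next
  case False
  then show ?thesis
    unfolding block_cut_def if_not_P[OF False]
    by (simp add: rat_linear_0[OF rat_linear_tensor_map] rat_linear_id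
        rat_linear_compose[OF rat_linear_motH_of_words rat_linear_lin_ext])
qed

theorem proposition5p6:
  fixes ks :: "nat list" and r d :: nat
  assumes "length ks = d" and "\<forall>k\<in>set ks. k \<ge> 1" and "odd r"
  shows "D r (t_mot ks) =
    (\<Sum>j\<in>{1..d}. if sum_list (slice ks 1 j) = r
       then t_L (slice ks 1 j) \<otimes>\<^sub>Q t_mot (slice ks (j + 1) d) else 0)
  + (\<Sum>(i, j)\<in>{(i, j). 1 \<le> i \<and> i < j \<and> j \<le> d}.
       if sum_list (slice ks (i + 1) j) \<le> r \<and> r < sum_list (slice ks i j) - 1
       then (zeta_L (r - sum_list (slice ks (i + 1) j)) (replicate (j - i) 1) (slice ks (i + 1) j)
              - (if r = 1 then log2_L else 0))
            \<otimes>\<^sub>Q t_mot (slice ks 1 (i - 1) @ [sum_list (slice ks i j) - r] @ slice ks (j + 1) d)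
       else 0)
  - (\<Sum>(i, j)\<in>{(i, j). 1 \<le> i \<and> i < j \<and> j \<le> d}.
       if sum_list (slice ks i (j - 1)) \<le> r \<and> r < sum_list (slice ks i j) - 1
       then (zeta_L (r - sum_list (slice ks i (j - 1))) (replicate (j - i) 1)
                (rev (slice ks i (j - 1)))
              - (if r = 1 then log2_L else 0))
            \<otimes>\<^sub>Q t_mot (slice ks 1 (i - 1) @ [sum_list (slice ks i j) - r] @ slice ks (j + 1) d)
       else 0)"
proof -
  let ?pairs = "{(i, j). 1 \<le> i \<and> i < j \<and> j \<le> d}"
  let ?R = "\<lambda>i j. if sum_list (slice ks (i + 1) j) \<le> r \<and> r < sum_list (slice ks i j) - 1
    then (zeta_L (r - sum_list (slice ks (i + 1) j)) (replicate (j - i) 1) (slice ks (i + 1) j)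
        - (if r = 1 then log2_L else 0))
      \<otimes>\<^sub>Q t_mot (slice ks 1 (i - 1) @ [sum_list (slice ks i j) - r] @ slice ks (j + 1) d) else 0"
  let ?L = "\<lambda>i j. if sum_list (slice ks i (j - 1)) \<le> r \<and> r < sum_list (slice ks i j) - 1
    then (zeta_L (r - sum_list (slice ks i (j - 1))) (replicate (j - i) 1) (rev (slice ks i (j - 1)))
        - (if r = 1 then log2_L else 0))
      \<otimes>\<^sub>Q t_mot (slice ks 1 (i - 1) @ [sum_list (slice ks i j) - r] @ slice ks (j + 1) d) else 0"
  let ?s = "(- 1) ^ d :: rat"
  let ?V = "tensor_map (\<lambda>x. x) (\<lambda>x. motH_of_words (lin_ext signed_double x))"
  note ks = assms(2)
  have r: "r \<ge> 1" using assms(3) by (cases r) auto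
  have V: "rat_linear ?V"
    by (intro rat_linear_tensor_map rat_linear_id rat_linear_compose[OF rat_linear_motH_of_words]
        rat_linear_lin_ext)
  have V_basis: "?V (c \<otimes>\<^sub>Q basis w) = c \<otimes>\<^sub>Q motH_of_words (signed_double w)" for c w
    by (simp add: rat_linear_id rat_linear_compose[OF rat_linear_motH_of_words rat_linear_lin_ext])
  have "D r (motH_of_words (signed_double (block_word ks))) =
      (\<Sum>j\<in>{1..d}. if sum_list (take j ks) = r
        then lie_class (signed_double (block_word (take j ks))) \<otimes>\<^sub>Q
          motH_of_words (signed_double (block_word (drop j ks))) else 0) +
      ?V (gap_step double_gap r P1 (block_word ks))"
  proof (cases ks)
    case Nil
    have "word_weight_part r (basis []) = 0" using r by (simp add: word_weight_part_def)
    then show ?thesis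
      using r assms(1)
      by (simp add: Nil D_words word_coaction_eq coact_rec rat_linear_motH_of_words
          rat_linear_compose[OF rat_linear_lie_class rat_linear_word_weight_part]
          rat_linear_0[OF rat_linear_lie_class] rat_linear_0[OF V])
  next
    case (Cons k ls)
    let ?w = "replicate (k - 1) P0 @ block_word ls"
    let ?\<Psi> = "\<lambda>u v. lie_class (signed_double u) \<otimes>\<^sub>Q motH_of_words (signed_double v)"
    have w: "set ?w \<subseteq> {P0, P1}" using set_block_word[of ls] by auto
    have B: "block_word ks = P1 # ?w" by (simp add: Cons)
    \<comment> \<open>The term j = 0 would be an empty gap and drops out because r is
      positive.\<close>
    have "(\<Sum>j\<le>length ks. f j) = f 0 + (\<Sum>j\<in>{1..d}. f j)" for f :: "nat \<Rightarrow> (motL, motH) tensor"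
      using assms(1) by (simp add: atMost_atLeast0 sum.atLeast_Suc_atMost)
    then have "(if r \<le> length (block_word ks) \<and> hd (drop r (block_word ks) @ [P1]) = P1
        then ?\<Psi> (take r (block_word ks)) (drop r (block_word ks)) else 0) =
      (\<Sum>j\<in>{1..d}. if sum_list (take j ks) = r
        then ?\<Psi> (block_word (take j ks)) (block_word (drop j ks)) else 0)"
      using cut_at_one[OF ks, of "[]" r ?\<Psi>, unfolded append_Nil] r by simp
    moreover have "gap_step double_gap r P1 (block_word ks) =
        prepend_right P1 (gap_sum double_gap r P1 P1 ?w)"
      by (simp add: B)
    ultimately show ?thesis
      using D_signed_double[OF w r, folded B] by (simp only:)
  qed
  then have "D r (t_mot ks) =
      ?s *\<^sub>Q (\<Sum>j\<in>{1..d}. if sum_list (take j ks) = r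
        then lie_class (signed_double (block_word (take j ks))) \<otimes>\<^sub>Q
          motH_of_words (signed_double (block_word (drop j ks))) else 0) +
      ((\<Sum>(i, j)\<in>?pairs. ?s *\<^sub>Q ?V (right_cut r ks i j)) -
       (\<Sum>(i, j)\<in>?pairs. ?s *\<^sub>Q ?V (left_cut r ks i j)))"
    unfolding t_mot_eq[OF ks] D_scale[OF r] gap_step_block_word[OF ks assms(3)] assms(1)
    by (simp add: scaleQ_add_right ratvs.scale_right_diff_distrib rat_linear_diff[OF V]
        rat_linear_sum[OF V] ratvs.scale_sum_right case_prod_beta')
  also have "?s *\<^sub>Q (\<Sum>j\<in>{1..d}. if sum_list (take j ks) = r
        then lie_class (signed_double (block_word (take j ks))) \<otimes>\<^sub>Q
          motH_of_words (signed_double (block_word (drop j ks))) else 0) =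
      (\<Sum>j\<in>{1..d}. if sum_list (slice ks 1 j) = r
       then t_L (slice ks 1 j) \<otimes>\<^sub>Q t_mot (slice ks (j + 1) d) else 0)"
    unfolding ratvs.scale_sum_right
  proof (rule sum.cong[OF refl])
    fix j assume "j \<in> {1..d}"
    then have j: "j \<le> length ks" using assms(1) by simp
    have "\<forall>k\<in>set (take j ks). k \<ge> 1" "\<forall>k\<in>set (drop j ks). k \<ge> 1"
      using ks by (auto dest: in_set_takeD in_set_dropD)
    moreover have "length (take j ks) + length (drop j ks) = d" using j assms(1) by simp
    ultimately show "?s *\<^sub>Q (if sum_list (take j ks) = r
        then lie_class (signed_double (block_word (take j ks))) \<otimes>\<^sub>Q
          motH_of_words (signed_double (block_word (drop j ks))) else 0) =
        (if sum_list (slice ks 1 j) = r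
         then t_L (slice ks 1 j) \<otimes>\<^sub>Q t_mot (slice ks (j + 1) d) else 0)"
      unfolding slice_take[OF j] assms(1)[symmetric] slice_drop
      by (simp only: t_L_eq t_mot_eq sign_tensor assms(1) if_distrib[of "scaleQ _"] ratvs.scale_zero_right)
  qed
  also have "(\<Sum>(i, j)\<in>?pairs. ?s *\<^sub>Q ?V (right_cut r ks i j)) =
    (\<Sum>(i, j)\<in>?pairs. ?R i j)"
  proof (intro sum.cong[OF refl], clarify)
    fix i j assume ij: "1 \<le> i" "i < j" "j \<le> d"
    have "\<forall>k\<in>set (slice ks (i + 1) j). k \<ge> 1" "length (slice ks (i + 1) j) = j - i" "j \<le> length ks"
      using ks set_slice[of "i + 1" j ks] ij assms(1) by (auto simp: length_slice)
    from sign_block_cut[OF ks ij(1,2) this(3,1,2), of r, unfolded assms(1) rest_slices_def]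
    show "?s *\<^sub>Q ?V (right_cut r ks i j) = ?R i j" .
  qed
  also have "(\<Sum>(i, j)\<in>?pairs. ?s *\<^sub>Q ?V (left_cut r ks i j)) =
    (\<Sum>(i, j)\<in>?pairs. ?L i j)"
  proof (intro sum.cong[OF refl], clarify)
    fix i j assume ij: "1 \<le> i" "i < j" "j \<le> d"
    have "j - 1 \<le> length ks" using ij assms(1) by simp
    then have "\<forall>k\<in>set (rev (slice ks i (j - 1))). k \<ge> 1" "length (rev (slice ks i (j - 1))) = j - i"
      "j \<le> length ks"
      using ks set_slice[of i "j - 1" ks] ij assms(1) by (auto simp: length_slice)
    from sign_block_cut[OF ks ij(1,2) this(3,1,2), of r, unfolded assms(1) rest_slices_def sum_list_rev]
    show "?s *\<^sub>Q ?V (left_cut r ks i j) = ?L i j" .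
  qed
  finally show ?thesis by (simp add: add_diff_eq)
qed

end
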